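(* Let $p_1,p_2>1$, $q_1>p_1-1$, $q_2>p_2-1$, let $\mathcal A_1,\mathcal A_2$ be W-$p_1$-C and W-$p_2$-C respectively, and let $(u,v)$ be a weak solution of $$\mathrm{div}_L\mathcal A_1(x,u,\nabla_Lu)\ge v^{q_2},\quad \mathrm{div}_L\mathcal A_2(x,v,\nabla_Lv)\ge u^{q_1},\quad u\ge0,\ v\ge0\quad\text{on }\mathbb R^N.$$ If $$\max\Big\{q_1\frac{p_2q_2+p_1(p_2-1)}{q_1q_2-(p_1-1)(p_2-1)}+p_1,\ q_2\frac{p_1q_1+p_2(p_1-1)}{q_1q_2-(p_1-1)(p_2-1)}+p_2\Big\}\ge Q,$$ then $u=v=0$ a.e. on $\mathbb R^N$. (When $p_1=p_2=p$ this condition reads $\max\big\{q_1\frac{q_2+p-1}{q_1q_2-(p-1)^2},q_2\frac{q_1+p-1}{q_1q_2-(p-1)^2}\big\}\ge\frac{Q-p}{p}$, and when moreover $q_1=q_2=q$ it reads $q(Q-2p)\le(Q-p)(p-1)$.)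
   Context: Setting: $\mathbb G=(\mathbb R^N,\circ,\delta_R)$ is a homogeneous Carnot group with homogeneous dimension $Q$ (the Euclidean case $\mathbb R^N$, $Q=N$, $\nabla_L=\nabla$ is included); $X_1,\dots,X_l$ are the left-invariant generating vector fields of the first layer, $X_i=\sum_j\mu_{ij}(\xi)\partial_{\xi_j}$ with $\mu$ continuous; $\nabla_L=(X_1,\dots,X_l)^T=\mu\nabla$, $\mathrm{div}_Lh=\mathrm{div}(\mu^Th)$; $W^{1,p}_{L,loc}(\mathbb R^N)=\{u\in L^p_{loc}:|\nabla_Lu|\in L^p_{loc}\}$. $\mathcal A:\mathbb R^N\times\mathbb R\times\mathbb R^l\to\mathbb R^l$ Carathéodory (measurable in $x$, continuous in $(t,\xi)$) is W-$p$-C if $\mathcal A(x,t,\xi)\cdot\xi\ge0$ for all $x,t,\xi$, $\mathcal A(x,0,\xi)=0$ or $\mathcal A(x,t,0)=0$, and there is $k_2>0$ with $(\mathcal A(x,t,\xi)\cdot\xi)^{p-1}\ge k_2^{p-1}|\mathcal A(x,t,\xi)|^p$ for all $x,t,\xi$. A weak solution of the system is a pair $(u,v)\in W^{1,p_1}_{L,loc}(\mathbb R^N)\times W^{1,p_2}_{L,loc}(\mathbb R^N)$ with $u,v\ge0$, $\mathcal A_1(\cdot,u,\nabla_Lu)\in L^{p_1'}_{loc}$, $\mathcal A_2(\cdot,v,\nabla_Lv)\in L^{p_2'}_{loc}$, $u^{q_1},v^{q_2}\in L^1_{loc}$, such that for all nonnegative $\phi\in C^1_0(\mathbb R^N)$: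 $-\int\mathcal A_1(x,u,\nabla_Lu)\cdot\nabla_L\phi\ge\int v^{q_2}\phi$ and $-\int\mathcal A_2(x,v,\nabla_Lv)\cdot\nabla_L\phi\ge\int u^{q_1}\phi$. *)

theory Defs
  imports "HOL-Analysis.Analysis"
begin

coinductive smooth_map :: "('a::real_normed_vector \<Rightarrow> 'b::real_normed_vector) \<Rightarrow> bool" where
  "(\<forall>x. f differentiable (at x)) \<Longrightarrow>
   (\<forall>v. smooth_map (\<lambda>x. frechet_derivative f (at x) v)) \<Longrightarrow> smooth_map f"

definition dil :: "('n \<Rightarrow> nat) \<Rightarrow> real \<Rightarrow> real^'n \<Rightarrow> real^'n" where
  "dil deg R x = (\<chi> i. R ^ deg i * x $ i)"

text \<open>Vector fields are represented by their coefficient vectors; Lie bracket [a,b] = (Db)a - (Da)b.\<close>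
definition lie_bracket :: "('a::real_normed_vector \<Rightarrow> 'a) \<Rightarrow> ('a \<Rightarrow> 'a) \<Rightarrow> 'a \<Rightarrow> 'a" where
  "lie_bracket a b = (\<lambda>x. frechet_derivative b (at x) (a x) - frechet_derivative a (at x) (b x))"

inductive_set lie_gen :: "(('a::real_normed_vector) \<Rightarrow> 'a) set \<Rightarrow> ('a \<Rightarrow> 'a) set" for F where
  base: "X \<in> F \<Longrightarrow> X \<in> lie_gen F"
| brk: "X \<in> lie_gen F \<Longrightarrow> Y \<in> lie_gen F \<Longrightarrow> lie_bracket X Y \<in> lie_gen F"

text \<open>Coefficient vector of the left-invariant vector field X_j agreeing with the partial derivative
  along the first-layer coordinate emb j at the origin: X_j f(x) = d/dt f(x o t e_(emb j)) at t=0.\<close>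
definition hfield :: "(real^'n \<Rightarrow> real^'n \<Rightarrow> real^'n) \<Rightarrow> ('l \<Rightarrow> 'n) \<Rightarrow> 'l \<Rightarrow> real^'n \<Rightarrow> real^'n" where
  "hfield op emb j x = frechet_derivative (\<lambda>y. op x y) (at 0) (axis (emb j) 1)"

text \<open>Homogeneous Carnot group on R^N (B-L-U): Lie group law with identity 0, dilations are
  automorphisms, the first layer (degree-1 coordinates, enumerated by emb) generates the Lie algebra.\<close>
definition homogeneous_carnot_group ::
  "(real^'n \<Rightarrow> real^'n \<Rightarrow> real^'n) \<Rightarrow> ('n \<Rightarrow> nat) \<Rightarrow> ('l \<Rightarrow> 'n) \<Rightarrow> bool" where
  "homogeneous_carnot_group op deg emb \<longleftrightarrow>
     (\<forall>x y z. op (op x y) z = op x (op y z)) \<and>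
     (\<forall>x. op x 0 = x \<and> op 0 x = x) \<and>
     (\<forall>x. \<exists>y. op x y = 0 \<and> op y x = 0) \<and>
     smooth_map (\<lambda>z. op (fst z) (snd z)) \<and>
     (\<forall>i. 1 \<le> deg i) \<and>
     (\<forall>R>0. \<forall>x y. dil deg R (op x y) = op (dil deg R x) (dil deg R y)) \<and>
     inj emb \<and> range emb = {i. deg i = 1} \<and>
     span ((\<lambda>X. X 0) ` lie_gen (range (hfield op emb))) = UNIV"

definition hom_dim :: "('n::finite \<Rightarrow> nat) \<Rightarrow> real" where
  "hom_dim deg = real (\<Sum>i\<in>UNIV. deg i)"

definition hgrad :: "(real^'n \<Rightarrow> real^'n \<Rightarrow> real^'n) \<Rightarrow> ('l \<Rightarrow> 'n) \<Rightarrow> (real^'n \<Rightarrow> real) \<Rightarrow> real^'n \<Rightarrow> real^'l" where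
  "hgrad op emb \<phi> x = (\<chi> j. frechet_derivative \<phi> (at x) (hfield op emb j x))"

definition vdiv :: "(real^'n \<Rightarrow> real^'n) \<Rightarrow> real^'n \<Rightarrow> real" where
  "vdiv F x = (\<Sum>k\<in>UNIV. frechet_derivative F (at x) (axis k 1) $ k)"

definition hdiv :: "(real^'n \<Rightarrow> real^'n \<Rightarrow> real^'n) \<Rightarrow> ('l \<Rightarrow> 'n) \<Rightarrow> (real^'n \<Rightarrow> real^'l) \<Rightarrow> real^'n \<Rightarrow> real" where
  "hdiv op emb h x = vdiv (\<lambda>y. \<Sum>j\<in>UNIV. (h y $ j) *\<^sub>R hfield op emb j y) x"

definition C1_0 :: "(real^'n \<Rightarrow> real) \<Rightarrow> bool" where
  "C1_0 \<phi> \<longleftrightarrow> (\<forall>x. \<phi> differentiable (at x)) \<and>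
     (\<forall>v. continuous_on UNIV (\<lambda>x. frechet_derivative \<phi> (at x) v)) \<and>
     compact (closure {x. \<phi> x \<noteq> 0})"

definition Lp_loc :: "real \<Rightarrow> (real^'n \<Rightarrow> real) \<Rightarrow> bool" where
  "Lp_loc p u \<longleftrightarrow> u \<in> borel_measurable lebesgue \<and>
     (\<forall>K. compact K \<longrightarrow> set_integrable lebesgue K (\<lambda>x. \<bar>u x\<bar> powr p))"

definition weak_hgrad :: "(real^'n \<Rightarrow> real^'n \<Rightarrow> real^'n) \<Rightarrow> ('l \<Rightarrow> 'n) \<Rightarrow>
    (real^'n \<Rightarrow> real) \<Rightarrow> (real^'n \<Rightarrow> real^'l) \<Rightarrow> bool" where
  "weak_hgrad op emb u g \<longleftrightarrow>
     (\<forall>\<phi> j. C1_0 \<phi> \<longrightarrow>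
        (\<integral>x. g x $ j * \<phi> x \<partial>lebesgue) =
        - (\<integral>x. u x * hdiv op emb (\<lambda>y. \<phi> y *\<^sub>R axis j 1) x \<partial>lebesgue))"

definition W1p_L_loc :: "(real^'n \<Rightarrow> real^'n \<Rightarrow> real^'n) \<Rightarrow> ('l \<Rightarrow> 'n) \<Rightarrow> real \<Rightarrow>
    (real^'n \<Rightarrow> real) \<Rightarrow> (real^'n \<Rightarrow> real^'l) \<Rightarrow> bool" where
  "W1p_L_loc op emb p u g \<longleftrightarrow> Lp_loc p u \<and> g \<in> borel_measurable lebesgue \<and>
     Lp_loc p (\<lambda>x. norm (g x)) \<and> weak_hgrad op emb u g"

definition caratheodory :: "(real^'n \<Rightarrow> real \<Rightarrow> real^'l \<Rightarrow> real^'l) \<Rightarrow> bool" where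
  "caratheodory A \<longleftrightarrow> (\<forall>t \<xi>. (\<lambda>x. A x t \<xi>) \<in> borel_measurable lebesgue) \<and>
     (\<forall>x. continuous_on UNIV (\<lambda>(t, \<xi>). A x t \<xi>))"

definition WpC :: "real \<Rightarrow> (real^'n \<Rightarrow> real \<Rightarrow> real^'l \<Rightarrow> real^'l) \<Rightarrow> bool" where
  "WpC p A \<longleftrightarrow> caratheodory A \<and>
     (\<forall>x t \<xi>. A x t \<xi> \<bullet> \<xi> \<ge> 0) \<and>
     ((\<forall>x \<xi>. A x 0 \<xi> = 0) \<or> (\<forall>x t. A x t 0 = 0)) \<and>
     (\<exists>k2>0. \<forall>x t \<xi>. (A x t \<xi> \<bullet> \<xi>) powr (p - 1) \<ge> k2 powr (p - 1) * norm (A x t \<xi>) powr p)"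

definition weak_solution :: "(real^'n \<Rightarrow> real^'n \<Rightarrow> real^'n) \<Rightarrow> ('l \<Rightarrow> 'n) \<Rightarrow>
    real \<Rightarrow> real \<Rightarrow> real \<Rightarrow> real \<Rightarrow>
    (real^'n \<Rightarrow> real \<Rightarrow> real^'l \<Rightarrow> real^'l) \<Rightarrow> (real^'n \<Rightarrow> real \<Rightarrow> real^'l \<Rightarrow> real^'l) \<Rightarrow>
    (real^'n \<Rightarrow> real) \<Rightarrow> (real^'n \<Rightarrow> real^'l) \<Rightarrow> (real^'n \<Rightarrow> real) \<Rightarrow> (real^'n \<Rightarrow> real^'l) \<Rightarrow> bool" where
  "weak_solution op emb p1 p2 q1 q2 A1 A2 u Du v Dv \<longleftrightarrow>
     W1p_L_loc op emb p1 u Du \<and> W1p_L_loc op emb p2 v Dv \<and>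
     (AE x in lebesgue. u x \<ge> 0) \<and> (AE x in lebesgue. v x \<ge> 0) \<and>
     (\<lambda>x. A1 x (u x) (Du x)) \<in> borel_measurable lebesgue \<and>
     (\<lambda>x. A2 x (v x) (Dv x)) \<in> borel_measurable lebesgue \<and>
     Lp_loc (p1 / (p1 - 1)) (\<lambda>x. norm (A1 x (u x) (Du x))) \<and>
     Lp_loc (p2 / (p2 - 1)) (\<lambda>x. norm (A2 x (v x) (Dv x))) \<and>
     Lp_loc 1 (\<lambda>x. u x powr q1) \<and> Lp_loc 1 (\<lambda>x. v x powr q2) \<and>
     (\<forall>\<phi>. C1_0 \<phi> \<and> (\<forall>x. \<phi> x \<ge> 0) \<longrightarrow>
        - (\<integral>x. A1 x (u x) (Du x) \<bullet> hgrad op emb \<phi> x \<partial>lebesgue) \<ge> (\<integral>x. v x powr q2 * \<phi> x \<partial>lebesgue) \<and>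
        - (\<integral>x. A2 x (v x) (Dv x) \<bullet> hgrad op emb \<phi> x \<partial>lebesgue) \<ge> (\<integral>x. u x powr q1 * \<phi> x \<partial>lebesgue))"

end

theory Submission
  imports Defs
begin

text \<open>
  Put \<open>h = A\<^sub>2(x, v, \<nabla>\<^sub>L v)\<close>. Testing with \<open>\<gamma>(v) \<eta>\<close> and using \<open>h \<bullet> \<nabla>\<^sub>L v \<ge> k \<bar>h\<bar>\<^sup>p\<^sup>'\<close> gives, for every
  \<open>s > 0\<close> with \<open>s + p - 1 \<le> q\<close>, a Caccioppoli bound of the energy \<open>\<integral> \<bar>h\<bar>\<^sup>p\<^sup>' v\<^sup>s\<^sup>-\<^sup>1 \<eta>\<close> by
  \<open>\<integral> v\<^sup>s\<^sup>+\<^sup>p\<^sup>-\<^sup>1 \<bar>\<nabla>\<^sub>L \<eta>\<bar>\<^sup>p \<eta>\<^sup>1\<^sup>-\<^sup>p\<close>. With small \<open>s\<close> and Hoelder's inequality it bounds the flux \<open>\<integral> \<bar>h\<bar> \<bar>\<nabla>\<^sub>L \<eta>\<bar>\<close>,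
  hence the right-hand side of the other inequality, by a power of \<open>\<integral> v\<^sup>q \<eta>\<close>. Inserting the two
  resulting estimates into each other at scale \<open>R\<close> bounds the growth of \<open>\<integral> v\<^sup>q \<eta>\<close> by \<open>R\<^sup>\<alpha>\<close>, and the
  critical condition says \<open>\<alpha> \<le> p\<close>. This is exactly what the Caccioppoli bound with the largest
  exponent \<open>s = q - p + 1\<close> needs for the energy to be finite on the whole space, and then zero;
  so \<open>h = 0\<close>, which forces \<open>u = 0\<close> and then \<open>v = 0\<close>.

  Test functions \<open>\<gamma>(v) \<eta>\<close> are justified by mollifying \<open>v\<close> along left translations, which commute with
  the left-invariant fields. Translations preserve Lebesgue measure and the fields are divergence
  free because of their homogeneity with respect to the dilations.
\<close>

section \<open>Continuously differentiable maps\<close>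

text \<open>Two points decide the form of the estimates. First, at equality in the critical
  condition, growth of order R^p makes the energy finite but not small. Hence the Caccioppoli bound
  is used in a form that keeps, as a factor on the right, only the energy over the set where the
  gradient of the cut-off is nonzero. This set lies outside the ball of radius R, so once the energy
  is finite that factor is the tail of a convergent integral. Second, the flux bound takes s < 1,
  where the weight v^(s-1) is singular at v = 0, while \<open>0 powr (s - 1) = 0\<close> would
  silently drop the set {v = 0} from the energy. So the flux must be shown to vanish a.e. on that
  set; this holds because the derivative at 0 of the regularised test function is at least of order
  e^(s-1), whereas its energy stays bounded as e tends to 0. Origin of the exponent: let U, V be the
  integrals of u^q1, v^q2 against the cut-off, a1 = (p1-1)/q1, a2 = (p2-1)/q2. The flux bounds read
  V <= C R^(-p1) U^a1 R^(Q(1-a1)) and U <= C R^(-p2) V^a2 R^(Q(1-a2)); eliminating U gives \<alpha>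
  = Q - (p1 + p2 a1)/(1 - a1 a2).\<close>

definition C1 :: "('a::euclidean_space \<Rightarrow> 'b::real_normed_vector) \<Rightarrow> bool" where
  "C1 f \<longleftrightarrow> (\<forall>x. f differentiable (at x)) \<and>
     (\<forall>v. continuous_on UNIV (\<lambda>x. frechet_derivative f (at x) v))"

lemma C1I:
  assumes "\<And>x. (f has_derivative f' x) (at x)" "\<And>v. continuous_on UNIV (\<lambda>x. f' x v)"
  shows "C1 f"
proof -
  have "frechet_derivative f (at x) = f' x" for x
    using frechet_derivative_at[OF assms(1)[of x]] by simp
  then show ?thesis
    using assms by (auto simp: C1_def differentiable_def)
qed

lemma C1_has_derivative:
  "C1 f \<Longrightarrow> (f has_derivative frechet_derivative f (at x)) (at x)"
  by (simp add: C1_def frechet_derivative_works[symmetric])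

lemma C1_continuous_on: "C1 f \<Longrightarrow> continuous_on S f"
  by (meson C1_has_derivative continuous_at_imp_continuous_on has_derivative_continuous)

lemma C1_measurable: "C1 (f :: 'a::euclidean_space \<Rightarrow> 'b::real_normed_vector) \<Longrightarrow> f \<in> borel_measurable borel"
  by (intro borel_measurable_continuous_onI C1_continuous_on)

text \<open>Continuity for each fixed direction becomes joint continuity in base point and direction
  by expanding the direction in the finite basis and using linearity of the derivative.\<close>

lemma C1_derivative_continuous:
  fixes f :: "'a::euclidean_space \<Rightarrow> 'b::real_normed_vector"
  assumes "C1 f" "continuous_on S a" "continuous_on S b"
  shows "continuous_on S (\<lambda>t. frechet_derivative f (at (a t)) (b t))"
proof -
  have lin: "linear (frechet_derivative f (at x))" for x
    using C1_has_derivative[OF assms(1)] has_derivative_linear by blast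
  have eq: "frechet_derivative f (at x) w =
      (\<Sum>i\<in>Basis. (w \<bullet> i) *\<^sub>R frechet_derivative f (at x) i)" for x w
  proof -
    have "frechet_derivative f (at x) w = frechet_derivative f (at x) (\<Sum>i\<in>Basis. (w \<bullet> i) *\<^sub>R i)"
      by (simp add: euclidean_representation)
    also have "\<dots> = (\<Sum>i\<in>Basis. (w \<bullet> i) *\<^sub>R frechet_derivative f (at x) i)"
      by (simp add: linear_sum[OF lin] linear_cmul[OF lin])
    finally show ?thesis .
  qed
  have "continuous_on S (\<lambda>t. frechet_derivative f (at (a t)) i)" for i
    using continuous_on_compose2[of UNIV "\<lambda>x. frechet_derivative f (at x) i" S a] assms
    by (auto simp: C1_def)
  then show ?thesis
    by (subst eq) (intro continuous_intros assms)
qed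

lemma C1_compose:
  assumes "C1 g" "C1 f"
  shows "C1 (\<lambda>x. g (f x))"
proof (rule C1I)
  show "((\<lambda>x. g (f x)) has_derivative
      (\<lambda>v. frechet_derivative g (at (f x)) (frechet_derivative f (at x) v))) (at x)" for x
    by (rule has_derivative_compose[OF C1_has_derivative[OF assms(2)] C1_has_derivative[OF assms(1)]])
  show "continuous_on UNIV (\<lambda>x. frechet_derivative g (at (f x)) (frechet_derivative f (at x) v))" for v
    by (intro C1_derivative_continuous assms C1_continuous_on continuous_intros)
qed

lemma C1_bounded_linear: "bounded_linear f \<Longrightarrow> C1 f"
  by (rule C1I[of f "\<lambda>_. f"]) (auto intro: bounded_linear_imp_has_derivative)

lemma C1_ident: "C1 (\<lambda>x. x)"
  by (rule C1_bounded_linear) (rule bounded_linear_ident)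

lemma C1_const: "C1 (\<lambda>x. c)"
  by (rule C1I[of _ "\<lambda>_ _. 0"]) auto

lemma C1_Pair:
  assumes "C1 f" "C1 g" shows "C1 (\<lambda>x. (f x, g x))"
  by (rule C1I[OF has_derivative_Pair[OF C1_has_derivative[OF assms(1)] C1_has_derivative[OF assms(2)]]])
    (intro continuous_intros C1_derivative_continuous assms)

lemma C1_mult:
  fixes f g :: "'a::euclidean_space \<Rightarrow> real"
  assumes "C1 f" "C1 g" shows "C1 (\<lambda>x. f x * g x)"
  by (rule C1I[OF has_derivative_mult[OF C1_has_derivative[OF assms(1)] C1_has_derivative[OF assms(2)]]])
    (intro continuous_intros C1_derivative_continuous C1_continuous_on assms)

text \<open>Two unfoldings of the coinductive predicate suffice: directional derivatives are again
  differentiable, hence continuous. The second claim is the first one for a directional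
  derivative.\<close>

lemma smooth_map_C1:
  fixes f :: "'a::euclidean_space \<Rightarrow> 'b::real_normed_vector"
  assumes "smooth_map f" shows "C1 f" "C1 (\<lambda>x. frechet_derivative f (at x) v)"
proof -
  have C: "C1 g" if "smooth_map g" for g :: "'a \<Rightarrow> 'b"
  proof -
    have d: "\<forall>x. g differentiable (at x)"
      using that by cases auto
    have "smooth_map (\<lambda>x. frechet_derivative g (at x) v)" for v
      using that by cases auto
    then have "(\<lambda>x. frechet_derivative g (at x) v) differentiable (at x)" for v x
      by (cases rule: smooth_map.cases) auto
    then show ?thesis
      using d by (auto simp: C1_def intro!: continuous_at_imp_continuous_on differentiable_imp_continuous_within)
  qed
  show "C1 f" by (rule C[OF assms])
  show "C1 (\<lambda>x. frechet_derivative f (at x) v)"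
  proof (rule C)
    show "smooth_map (\<lambda>x. frechet_derivative f (at x) v)"
      using assms by cases auto
  qed
qed

lemma C1_0_iff: "C1_0 \<phi> \<longleftrightarrow> C1 \<phi> \<and> compact (closure {x. \<phi> x \<noteq> 0})"
  by (auto simp: C1_0_def C1_def)

section \<open>Groups with dilations\<close>

locale dilation_group =
  fixes op :: "real^'n \<Rightarrow> real^'n \<Rightarrow> real^'n" and deg :: "'n \<Rightarrow> nat"
  assumes assoc: "op (op x y) z = op x (op y z)"
    and unit_right [simp]: "op x 0 = x" and unit_left [simp]: "op 0 x = x"
    and inverse_ex: "\<exists>y. op x y = 0 \<and> op y x = 0"
    and C1_op2: "C1 (\<lambda>z. op (fst z) (snd z))"
    and deg_ge: "1 \<le> deg i"
    and dil_op: "0 < R \<Longrightarrow> dil deg R (op x y) = op (dil deg R x) (dil deg R y)"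
begin

definition ginv :: "real^'n \<Rightarrow> real^'n" where
  "ginv x = (SOME y. op x y = 0 \<and> op y x = 0)"

lemma inv_right [simp]: "op x (ginv x) = 0" and inv_left [simp]: "op (ginv x) x = 0"
  using someI_ex[OF inverse_ex[of x]] by (auto simp: ginv_def)

lemma op_inv_cancel [simp]: "op x (op (ginv x) y) = y" "op (ginv x) (op x y) = y"
  by (simp_all add: assoc[symmetric])

lemma op_inv_cancel_right [simp]: "op (op y x) (ginv x) = y" "op (op y (ginv x)) x = y"
  by (simp_all add: assoc)

lemma ginv_unique: "op x y = 0 \<Longrightarrow> y = ginv x"
  using op_inv_cancel(2)[of x y] by simp

lemma ginv_0 [simp]: "ginv 0 = 0"
  by (rule ginv_unique[symmetric]) simp

lemma ginv_op: "ginv (op x y) = op (ginv y) (ginv x)"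
  by (rule ginv_unique[symmetric]) (metis assoc inv_right op_inv_cancel(1))

lemma dil_0 [simp]: "dil deg R 0 = 0"
  by (simp add: dil_def vec_eq_iff)

lemma dil_dil: "dil deg R (dil deg S x) = dil deg (R * S) x"
  by (simp add: dil_def vec_eq_iff power_mult_distrib)

lemma dil_one [simp]: "dil deg 1 x = x"
  by (simp add: dil_def vec_eq_iff)

lemma linear_dil: "linear (dil deg R)"
  by (rule linearI) (auto simp: dil_def vec_eq_iff algebra_simps)

lemma bounded_linear_dil: "bounded_linear (dil deg R)"
  using linear_dil linear_conv_bounded_linear by blast

lemma dil_tendsto_0: "((\<lambda>R. dil deg R x) \<longlongrightarrow> 0) (at_right 0)"
proof (rule vec_tendstoI)
  fix i
  have "((\<lambda>R::real. R ^ deg i * x $ i) \<longlongrightarrow> 0 ^ deg i * x $ i) (at_right 0)"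
    by (intro tendsto_intros)
  moreover have "(0::real) ^ deg i = 0"
    using deg_ge[of i] by (cases "deg i") auto
  ultimately show "((\<lambda>R. dil deg R x $ i) \<longlongrightarrow> 0 $ i) (at_right 0)"
    by (simp add: dil_def)
qed

definition Dop :: "real^'n \<Rightarrow> real^'n \<Rightarrow> real^'n \<Rightarrow> real^'n \<Rightarrow> real^'n" where
  "Dop x y a b = frechet_derivative (\<lambda>z. op (fst z) (snd z)) (at (x, y)) (a, b)"

lemma op_compose_derivative:
  assumes "(f has_derivative f') (at t within S)" "(g has_derivative g') (at t within S)"
  shows "((\<lambda>t. op (f t) (g t)) has_derivative (\<lambda>h. Dop (f t) (g t) (f' h) (g' h))) (at t within S)"
  unfolding Dop_def
  using has_derivative_compose[OF has_derivative_Pair[OF assms] C1_has_derivative[OF C1_op2]]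
  by simp

lemma op_derivative_right: "((\<lambda>y. op x y) has_derivative (\<lambda>b. Dop x y 0 b)) (at y)"
  using op_compose_derivative[OF has_derivative_const has_derivative_ident] by simp

lemma op_derivative_left: "((\<lambda>x. op x y) has_derivative (\<lambda>a. Dop x y a 0)) (at x)"
  using op_compose_derivative[OF has_derivative_ident has_derivative_const] by simp

lemma Dop_continuous:
  assumes "continuous_on S f" "continuous_on S g" "continuous_on S a" "continuous_on S b"
  shows "continuous_on S (\<lambda>t. Dop (f t) (g t) (a t) (b t))"
  unfolding Dop_def using assms by (intro C1_derivative_continuous[OF C1_op2] continuous_intros)

lemma C1_op:
  assumes "C1 f" "C1 g" shows "C1 (\<lambda>x. op (f x) (g x))"
  using C1_compose[OF C1_op2 C1_Pair[OF assms]] by simp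

lemma linear_Dop_right: "linear (Dop x y 0)"
  using op_derivative_right has_derivative_linear by blast

lemma linear_Dop_left: "linear (\<lambda>a. Dop x y a 0)"
  using op_derivative_left has_derivative_linear by blast

lemma Dop_0_right [simp]: "Dop 0 y 0 b = b"
proof -
  have "((\<lambda>y. y) has_derivative (\<lambda>b. Dop 0 y 0 b)) (at y)"
    using op_derivative_right[of 0 y] by simp
  then have "(\<lambda>b. Dop 0 y 0 b) = (\<lambda>b. b)"
    using has_derivative_unique has_derivative_ident by blast
  then show ?thesis by metis
qed

lemma Dop_0_left [simp]: "Dop x 0 a 0 = a"
proof -
  have "((\<lambda>x. x) has_derivative (\<lambda>a. Dop x 0 a 0)) (at x)"
    using op_derivative_left[where y=0 and x=x] by simp
  then have "(\<lambda>a. Dop x 0 a 0) = (\<lambda>b. b)"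
    using has_derivative_unique has_derivative_ident by blast
  then show ?thesis by metis
qed

text \<open>Differentiate the identity saying that dilations are automorphisms; a dilation is
  linear, so it is its own derivative.\<close>

lemma Dop_dil:
  assumes "0 < R"
  shows "dil deg R (Dop x y a b) = Dop (dil deg R x) (dil deg R y) (dil deg R a) (dil deg R b)"
proof -
  let ?d = "dil deg R"
  have d: "(?d has_derivative ?d) F" for F
    by (rule bounded_linear_imp_has_derivative[OF bounded_linear_dil])
  have "((\<lambda>z. ?d (op (fst z) (snd z))) has_derivative (\<lambda>h. ?d (Dop x y (fst h) (snd h)))) (at (x, y))"
    using has_derivative_compose[OF op_compose_derivative[OF has_derivative_fst[OF has_derivative_ident] has_derivative_snd[OF has_derivative_ident]] d, of "(x,y)" UNIV]
    by simp
  moreover have "((\<lambda>z. op (?d (fst z)) (?d (snd z))) has_derivative (\<lambda>h. Dop (?d x) (?d y) (?d (fst h)) (?d (snd h)))) (at (x, y))"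
    using op_compose_derivative[OF has_derivative_compose[OF has_derivative_fst[OF has_derivative_ident] d]
       has_derivative_compose[OF has_derivative_snd[OF has_derivative_ident] d], of "(x,y)" UNIV]
    by simp
  ultimately have "(\<lambda>h. ?d (Dop x y (fst h) (snd h))) = (\<lambda>h. Dop (?d x) (?d y) (?d (fst h)) (?d (snd h)))"
    using has_derivative_unique dil_op[OF assms] by auto
  from fun_cong[OF this, of "(a, b)"] show ?thesis by simp
qed

text \<open>The Jacobian of a translation is invariant under the dilations, which contract everything
  to the neutral element.\<close>

lemma det_eq_1:
  assumes lin: "\<And>x y. linear (B x y)"
    and cont: "\<And>v x y. continuous_on UNIV (\<lambda>z. B (fst z) (snd z) v)"
    and B0: "B 0 0 = (\<lambda>v. v)"
    and hom: "\<And>R v. 0 < R \<Longrightarrow> dil deg R (B x y v) = B (dil deg R x) (dil deg R y) (dil deg R v)"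
  shows "det (matrix (B x y)) = 1"
proof -
  let ?d = "dil deg"
  have eq: "det (matrix (B (?d R x) (?d R y))) = det (matrix (B x y))" if R: "0 < R" for R
  proof -
    have "?d R \<circ> B x y = B (?d R x) (?d R y) \<circ> ?d R"
      using hom[OF R] by auto
    then have "det (matrix (?d R)) * det (matrix (B x y)) = det (matrix (B (?d R x) (?d R y))) * det (matrix (?d R))"
      using matrix_compose lin linear_dil det_mul by metis
    moreover have "matrix (?d (1/R)) ** matrix (?d R) = mat 1"
      using R by (subst matrix_compose[OF linear_dil linear_dil, symmetric])
        (auto simp: o_def dil_dil matrix_id_mat_1[unfolded id_def])
    then have "det (matrix (?d R)) \<noteq> 0"
      using det_mul[of "matrix (?d (1/R))" "matrix (?d R)"] by auto
    ultimately show ?thesis by simp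
  qed
  have *: "((\<lambda>R. (?d R x, ?d R y)) \<longlongrightarrow> (0, 0)) (at_right 0)"
    by (intro tendsto_Pair dil_tendsto_0)
  have ent: "((\<lambda>R. B (?d R x) (?d R y) v) \<longlongrightarrow> B 0 0 v) (at_right 0)" for v
  proof -
    have "isCont (\<lambda>z. B (fst z) (snd z) v) (0, 0)"
      using cont[of v] by (simp add: continuous_on_eq_continuous_at)
    from isCont_tendsto_compose[OF this *] show ?thesis by simp
  qed
  have "((\<lambda>R. det (matrix (B (?d R x) (?d R y)))) \<longlongrightarrow> det (matrix (B 0 0))) (at_right 0)"
    unfolding det_def matrix_def by (simp, intro tendsto_intros tendsto_vec_nth ent)
  moreover have "\<forall>\<^sub>F R in at_right 0. det (matrix (B (?d R x) (?d R y))) = det (matrix (B x y))"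
    using eq by (intro eventually_at_rightI[of 0 1]) auto
  ultimately have "((\<lambda>R. det (matrix (B x y))) \<longlongrightarrow> det (matrix (B 0 0))) (at_right (0::real))"
    using tendsto_cong by fastforce
  then have "det (matrix (B x y)) = det (matrix (B 0 0))"
    using tendsto_const tendsto_unique trivial_limit_at_right_real by blast
  moreover have "matrix (\<lambda>v::real^'n. v) = (mat 1 :: real^'n^'n)"
    by (auto simp: matrix_def mat_def axis_def vec_eq_iff)
  ultimately show ?thesis
    by (simp add: B0)
qed

lemma det_Dop_right: "det (matrix (Dop x y 0)) = 1"
proof (rule det_eq_1[where B="\<lambda>x y. Dop x y 0"])
  show "dil deg R (Dop x y 0 v) = Dop (dil deg R x) (dil deg R y) 0 (dil deg R v)" if "0 < R" for R v
    using Dop_dil[OF that, of x y 0 v] by simp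
qed (auto intro!: linear_Dop_right Dop_continuous continuous_intros)

lemma det_Dop_left: "det (matrix (\<lambda>a. Dop x y a 0)) = 1"
proof (rule det_eq_1[where B="\<lambda>x y a. Dop x y a 0"])
  show "dil deg R (Dop x y v 0) = Dop (dil deg R x) (dil deg R y) (dil deg R v) 0" if "0 < R" for R v
    using Dop_dil[OF that, of x y v 0] by simp
qed (auto intro!: linear_Dop_left Dop_continuous continuous_intros)

end

section \<open>Invariance of Lebesgue measure under translations\<close>

text \<open>Lebesgue measure is determined by its values on boxes, and the preimage of a box under
  \<open>f\<close> is its image under the inverse \<open>g\<close>. So it is \<open>g\<close> whose
  Jacobian enters the change of variables.\<close>

lemma distr_lborel_unit_jacobian:
  fixes f g :: "real^'m::{finite,wellorder} \<Rightarrow> real^'m::{finite,wellorder}"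
  assumes cont: "continuous_on UNIV f"
    and gf: "\<And>x. g (f x) = x" and fg: "\<And>x. f (g x) = x"
    and der: "\<And>x. (g has_derivative g' x) (at x)" and det: "\<And>x. det (matrix (g' x)) = 1"
  shows "distr lborel borel f = lborel"
proof (rule lborel_eqI[symmetric])
  fix l u :: "real^'m::{finite,wellorder}" assume lu: "\<And>b. b \<in> Basis \<Longrightarrow> l \<bullet> b \<le> u \<bullet> b"
  have [measurable]: "f \<in> borel_measurable borel"
    using cont by (rule borel_measurable_continuous_onI)
  have im: "f -` box l u = g ` box l u"
    using gf fg by (auto simp: image_iff) metis
  have d: "(g has_derivative g' x) (at x within box l u)" for x
    using der has_derivative_at_withinI by blast
  have inj: "inj_on g (box l u)"
    using fg by (metis inj_onI)
  have 1: "(\<lambda>x. \<bar>det (matrix (g' x))\<bar>) integrable_on box l u"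
    using lmeasurable_iff_integrable_on[of "box l u"] by (simp add: det)
  have "g ` box l u \<in> lmeasurable"
    using measurable_differentiable_image_eq[of "box l u" g g', OF _ d inj] 1 by auto
  moreover have "measure lebesgue (g ` box l u) = measure lebesgue (box l u)"
    using measure_differentiable_image_eq[of "box l u" g g', OF _ d inj 1] lmeasure_integral[of "box l u"]
    by (simp add: det)
  ultimately have "emeasure lebesgue (g ` box l u) = emeasure lebesgue (box l u)"
    by (simp add: emeasure_eq_measure2)
  moreover have "g ` box l u \<in> sets borel"
    unfolding im[symmetric] by (metis \<open>f \<in> borel_measurable borel\<close> borel_open measurable_sets_borel open_box)
  ultimately have "emeasure lborel (g ` box l u) = emeasure lborel (box l u)"
    by simp
  then show "emeasure (distr lborel borel f) (box l u) = (\<Prod>b\<in>Basis. (u - l) \<bullet> b)"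
    using lu by (subst emeasure_distr) (auto simp: im)
qed simp

lemma (in dilation_group) C1_op_left: "C1 (op w)"
  using C1_op[OF C1_const C1_ident] .

lemma (in dilation_group) C1_op_right: "C1 (\<lambda>x. op x w)"
  using C1_op[OF C1_ident C1_const] .

lemma lborel_translations_wellorder:
  fixes op :: "real^'m::{finite,wellorder} \<Rightarrow> real^'m::{finite,wellorder} \<Rightarrow> real^'m::{finite,wellorder}"
  assumes "dilation_group op deg"
  shows "distr lborel borel (op w) = lborel" "distr lborel borel (\<lambda>x. op x w) = lborel"
proof -
  interpret dilation_group op deg by fact
  show "distr lborel borel (op w) = lborel"
    by (rule distr_lborel_unit_jacobian[where g="op (ginv w)", OF _ _ _ op_derivative_right])
      (auto intro: C1_continuous_on[OF C1_op_left] simp: det_Dop_right)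
  show "distr lborel borel (\<lambda>x. op x w) = lborel"
    by (rule distr_lborel_unit_jacobian[where g="\<lambda>x. op x (ginv w)", OF _ _ _ op_derivative_left])
      (auto intro: C1_continuous_on[OF C1_op_right] simp: det_Dop_left)
qed

text \<open>The library has the change of variables formula only for vectors indexed by a well-ordered
  type, so an arbitrary finite index type is replaced by a well-ordered copy of it.\<close>

typedef 'n wo = "UNIV :: 'n set" ..

instantiation wo :: (finite) wellorder
begin

definition less_eq_wo :: "'a wo \<Rightarrow> 'a wo \<Rightarrow> bool" where
  "x \<le> y \<longleftrightarrow> to_nat (Rep_wo x) \<le> to_nat (Rep_wo y)"

definition less_wo :: "'a wo \<Rightarrow> 'a wo \<Rightarrow> bool" where
  "x < y \<longleftrightarrow> to_nat (Rep_wo x) < to_nat (Rep_wo y)"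

instance
proof
  show "P a" if "\<And>x. (\<And>y. y < x \<Longrightarrow> P y) \<Longrightarrow> P x" for P and a :: "'a wo"
  proof (induction a rule: measure_induct_rule[where f="\<lambda>x. to_nat (Rep_wo x)"])
    case (less x)
    show ?case
      by (rule that) (rule less, simp add: less_wo_def)
  qed
qed (auto simp: less_eq_wo_def less_wo_def Rep_wo_inject)

end

instance wo :: (finite) finite
proof
  show "finite (UNIV :: 'a wo set)"
    using finite_surj[of "UNIV :: 'a set" UNIV Abs_wo] type_definition.Abs_image[OF type_definition_wo] by auto
qed

definition to_wo :: "real^'n \<Rightarrow> real^'n wo" where "to_wo x = (\<chi> i. x $ Rep_wo i)"
definition of_wo :: "real^'n wo \<Rightarrow> real^'n" where "of_wo x = (\<chi> i. x $ Abs_wo i)"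

lemma of_to_wo [simp]: "of_wo (to_wo x) = x"
  by (simp add: to_wo_def of_wo_def vec_eq_iff Abs_wo_inverse)

lemma to_of_wo [simp]: "to_wo (of_wo x) = x"
  by (simp add: to_wo_def of_wo_def vec_eq_iff Rep_wo_inverse)

lemma bounded_linear_to_wo: "bounded_linear to_wo"
  unfolding linear_conv_bounded_linear[symmetric]
  by (rule linearI) (auto simp: to_wo_def vec_eq_iff)

lemma bounded_linear_of_wo: "bounded_linear of_wo"
  unfolding linear_conv_bounded_linear[symmetric]
  by (rule linearI) (auto simp: of_wo_def vec_eq_iff)

lemma prod_Basis_vec:
  fixes h :: "real^'n \<Rightarrow> real"
  shows "(\<Prod>b\<in>Basis. h b) = (\<Prod>i\<in>UNIV. h (axis i 1))"
proof -
  have B: "(Basis :: (real^'n) set) = (\<lambda>i. axis i 1) ` UNIV"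
    by (auto simp: Basis_vec_def)
  have "inj (\<lambda>i. axis i 1 :: real^'n)"
    by (auto simp: inj_on_def axis_eq_axis)
  from prod.reindex[OF this, of h] show ?thesis
    unfolding B by (simp add: o_def)
qed

lemma box_vec: "box l u = {x :: real^'n. \<forall>i. l $ i < x $ i \<and> x $ i < u $ i}"
  by (auto simp: box_def Basis_vec_def inner_axis)

text \<open>Relabelling coordinates maps boxes to boxes with the same side lengths, only listed in
  another order.\<close>

lemma distr_lborel_of_wo: "distr lborel borel of_wo = (lborel :: (real^'n) measure)"
proof (rule lborel_eqI[symmetric])
  fix l u :: "real^'n" assume lu: "\<And>b. b \<in> Basis \<Longrightarrow> l \<bullet> b \<le> u \<bullet> b"
  then have le: "l $ i \<le> u $ i" for i
    using lu[of "axis i 1"] by (auto simp: Basis_vec_def inner_axis)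
  have [measurable]: "of_wo \<in> borel_measurable borel"
    by (intro borel_measurable_continuous_onI linear_continuous_on bounded_linear_of_wo)
  have pre: "of_wo -` box l u = box (to_wo l) (to_wo u)"
  proof -
    have "(\<forall>i. l $ i < x $ Abs_wo i \<and> x $ Abs_wo i < u $ i) \<longleftrightarrow>
       (\<forall>i. l $ Rep_wo i < x $ i \<and> x $ i < u $ Rep_wo i)" for x :: "real^'n wo"
      by (metis Abs_wo_inverse UNIV_I Rep_wo_inverse)
    then show ?thesis
      by (auto simp: box_vec to_wo_def of_wo_def)
  qed
  have bij: "bij (Rep_wo :: 'n wo \<Rightarrow> 'n)"
    by (metis Abs_wo_inverse Rep_wo_inverse UNIV_I bijI')
  have "emeasure (distr lborel borel of_wo) (box l u) = emeasure lborel (box (to_wo l) (to_wo u))"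
    by (subst emeasure_distr) (auto simp: pre)
  also have "\<dots> = (\<Prod>b\<in>Basis. (to_wo u - to_wo l) \<bullet> b)"
    by (rule emeasure_lborel_box) (auto simp: Basis_vec_def inner_axis to_wo_def le)
  also have "(\<Prod>b\<in>Basis. (to_wo u - to_wo l) \<bullet> b) = (\<Prod>i\<in>UNIV. (u - l) $ Rep_wo i)"
    by (simp add: prod_Basis_vec inner_axis to_wo_def)
  also have "\<dots> = (\<Prod>i\<in>UNIV. (u - l) $ i)"
    by (rule prod.reindex_bij_betw[OF bij])
  also have "\<dots> = (\<Prod>b\<in>Basis. (u - l) \<bullet> b)"
    by (simp add: prod_Basis_vec inner_axis)
  finally show "emeasure (distr lborel borel of_wo) (box l u) = ennreal (\<Prod>b\<in>Basis. (u - l) \<bullet> b)" .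
qed simp

lemma dilation_group_wo:
  assumes "dilation_group op deg"
  shows "dilation_group (\<lambda>x y. to_wo (op (of_wo x) (of_wo y))) (\<lambda>i. deg (Rep_wo i))"
proof -
  interpret dilation_group op deg by fact
  have [simp]: "to_wo 0 = 0" "of_wo 0 = 0"
    by (simp_all add: to_wo_def of_wo_def vec_eq_iff)
  have dil: "of_wo (dil (\<lambda>i. deg (Rep_wo i)) R x) = dil deg R (of_wo x)" for R x
    by (simp add: of_wo_def dil_def vec_eq_iff Abs_wo_inverse)
  have dil': "dil (\<lambda>i. deg (Rep_wo i)) R (to_wo x) = to_wo (dil deg R x)" for R x
    by (simp add: to_wo_def dil_def vec_eq_iff)
  show ?thesis
  proof
    show "\<exists>y. to_wo (op (of_wo x) (of_wo y)) = 0 \<and> to_wo (op (of_wo y) (of_wo x)) = 0" for x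
      by (rule exI[of _ "to_wo (ginv (of_wo x))"]) simp
    show "C1 (\<lambda>z. to_wo (op (of_wo (fst z)) (of_wo (snd z))))"
      by (intro C1_compose[OF C1_bounded_linear[OF bounded_linear_to_wo]] C1_op
          C1_compose[OF C1_bounded_linear[OF bounded_linear_of_wo]]
          C1_bounded_linear bounded_linear_fst bounded_linear_snd)
    show "1 \<le> deg (Rep_wo i)" for i
      by (rule deg_ge)
  qed (auto simp: assoc dil dil' dil_op)
qed

context dilation_group
begin

text \<open>Lebesgue measure is a two-sided Haar measure. Left invariance controls the error of
  translated approximations in L1; right invariance moves the point x into the kernel of the
  mollification.\<close>

lemma lborel_translations:
  "distr lborel borel (op w) = lborel" "distr lborel borel (\<lambda>x. op x w) = lborel"
proof -
  have [measurable]: "of_wo \<in> borel_measurable borel" "to_wo \<in> borel_measurable borel"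
    by (intro borel_measurable_continuous_onI linear_continuous_on bounded_linear_of_wo bounded_linear_to_wo)+
  \<comment> \<open>Invariance passes through the coordinate relabelling: \<open>f\<close> is
    conjugate to its version on the well-ordered copy, and \<open>of_wo\<close> carries the one
    Lebesgue measure to the other.\<close>
  have *: "distr lborel borel f = lborel"
    if f: "distr lborel borel (\<lambda>x. to_wo (f (of_wo x))) = lborel" and [measurable]: "f \<in> borel_measurable borel"
    for f :: "real^'n \<Rightarrow> real^'n"
  proof -
    have "distr lborel borel f = distr (distr lborel borel of_wo) borel f"
      by (simp add: distr_lborel_of_wo)
    also have "\<dots> = distr lborel borel (\<lambda>x. of_wo (to_wo (f (of_wo x))))"
      by (subst distr_distr) (auto simp: o_def)
    also have "\<dots> = distr (distr lborel borel (\<lambda>x. to_wo (f (of_wo x)))) borel of_wo"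
      by (subst distr_distr) (auto simp: o_def)
    finally show ?thesis
      by (simp add: f distr_lborel_of_wo)
  qed
  note wo = lborel_translations_wellorder[OF dilation_group_wo[OF dilation_group_axioms], of "to_wo w"]
  show "distr lborel borel (op w) = lborel"
    using wo(1) by (intro * C1_measurable C1_op_left) simp
  show "distr lborel borel (\<lambda>x. op x w) = lborel"
    using wo(2) by (intro * C1_measurable C1_op_right) simp
qed

lemma op_measurable [measurable (raw)]:
  assumes "f \<in> borel_measurable M" "g \<in> borel_measurable M"
  shows "(\<lambda>x. op (f x) (g x)) \<in> borel_measurable M"
proof -
  have "(\<lambda>z. op (fst z) (snd z)) \<in> borel_measurable (borel \<Otimes>\<^sub>M borel)"
    using C1_measurable[OF C1_op2] by (simp add: borel_prod)
  from measurable_compose[OF measurable_Pair[OF assms] this] show ?thesis by simp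
qed

lemma nn_integral_left:
  assumes [measurable]: "f \<in> borel_measurable borel"
  shows "(\<integral>\<^sup>+x. f (op w x) \<partial>lborel) = (\<integral>\<^sup>+x. f x \<partial>lborel)"
proof -
  have "(\<integral>\<^sup>+x. f x \<partial>distr lborel borel (op w)) = (\<integral>\<^sup>+x. f (op w x) \<partial>lborel)"
    by (rule nn_integral_distr) auto
  then show ?thesis by (simp add: lborel_translations)
qed

lemma integral_right:
  fixes f :: "real^'n \<Rightarrow> 'b::{banach, second_countable_topology}"
  assumes [measurable]: "f \<in> borel_measurable borel"
  shows "(\<integral>x. f (op x w) \<partial>lborel) = (\<integral>x. f x \<partial>lborel)"
proof -
  have "(\<integral>x. f x \<partial>distr lborel borel (\<lambda>x. op x w)) = (\<integral>x. f (op x w) \<partial>lborel)"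
    by (rule integral_distr) auto
  then show ?thesis by (simp add: lborel_translations)
qed

text \<open>\<open>ginv\<close> is obtained by choice, so its regularity has to be derived. The map
  (x, y) to (x, xy) has the explicit inverse (x, y) to (x, x^(-1) y) and an invertible derivative at
  the origin; the inverse function theorem differentiates that inverse, and y = 0 isolates
  \<open>ginv\<close>.\<close>

lemma ginv_derivative_0: "(ginv has_derivative uminus) (at 0)"
proof -
  let ?f = "\<lambda>z :: (real^'n) \<times> (real^'n). (fst z, op (fst z) (snd z))"
  let ?g = "\<lambda>z :: (real^'n) \<times> (real^'n). (fst z, op (ginv (fst z)) (snd z))"
  have add: "Dop 0 0 a b = a + b" for a b
  proof -
    have "linear (\<lambda>z. Dop 0 0 (fst z) (snd z))"
      using C1_has_derivative[OF C1_op2, THEN has_derivative_linear] by (simp add: Dop_def)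
    from linear_add[OF this, of "(a,0)" "(0,b)"] show ?thesis by simp
  qed
  have f': "(?f has_derivative (\<lambda>z. (fst z, fst z + snd z))) (at (0,0))"
    using has_derivative_Pair[OF has_derivative_fst[OF has_derivative_ident]
        op_compose_derivative[OF has_derivative_fst[OF has_derivative_ident] has_derivative_snd[OF has_derivative_ident]], of "(0,0)" UNIV]
    by (simp add: add)
  have "(?g has_derivative (\<lambda>z. (fst z, snd z - fst z))) (at (?f (0,0)))"
    by (rule has_derivative_inverse_strong[OF open_UNIV _ _ _ f'])
      (auto simp: o_def id_def intro!: C1_continuous_on[OF C1_Pair[OF C1_bounded_linear[OF bounded_linear_fst] C1_op2]])
  then have g': "(?g has_derivative (\<lambda>z. (fst z, snd z - fst z))) (at (0,0))"
    by simp
  have "((\<lambda>x. snd (?g (x, 0))) has_derivative (\<lambda>h. snd (h, 0 - h))) (at 0)"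
    using has_derivative_snd[OF has_derivative_compose[OF has_derivative_Pair[OF has_derivative_ident has_derivative_const] g']]
    by simp
  then show ?thesis by simp
qed

text \<open>Translation reduces a general point to the origin: inverting y is inverting x^(-1) y,
  which lies near 0 for y near x, followed by right multiplication with x^(-1).\<close>

lemma ginv_derivative: "(ginv has_derivative (\<lambda>h. Dop 0 (ginv x) (- Dop (ginv x) x 0 h) 0)) (at x)"
proof -
  have eq: "ginv = (\<lambda>y. op (ginv (op (ginv x) y)) (ginv x))"
    by (simp add: ginv_op[symmetric])
  have "((\<lambda>y. ginv (op (ginv x) y)) has_derivative (\<lambda>h. - Dop (ginv x) x 0 h)) (at x)"
    using has_derivative_compose[OF op_derivative_right[of "ginv x" x], of ginv uminus] ginv_derivative_0
    by simp
  from op_compose_derivative[OF this has_derivative_const[of "ginv x"]]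
  show ?thesis by (subst eq) simp
qed

lemma ginv_continuous: "continuous_on S f \<Longrightarrow> continuous_on S (\<lambda>x. ginv (f x))"
proof -
  have "continuous_on UNIV ginv"
    using ginv_derivative by (meson continuous_at_imp_continuous_on has_derivative_continuous)
  then show "continuous_on S f \<Longrightarrow> continuous_on S (\<lambda>x. ginv (f x))"
    by (rule continuous_on_compose2) auto
qed

lemma C1_ginv: "C1 ginv"
  by (rule C1I[OF ginv_derivative]) (intro Dop_continuous continuous_intros ginv_continuous)

end

section \<open>Horizontal vector fields\<close>

text \<open>The fields are first derivatives of the group law, so \<open>C1_hfield\<close> asks for
  one order of differentiability more than \<open>C1_op2\<close>.\<close>

locale carnot = dilation_group op deg
  for op :: "real^'n \<Rightarrow> real^'n \<Rightarrow> real^'n" and deg :: "'n \<Rightarrow> nat" +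
  fixes emb :: "'l::finite \<Rightarrow> 'n"
  assumes deg_emb: "deg (emb j) = 1"
    and C1_hfield: "C1 (hfield op emb j)"
begin

lemma hfield_eq: "hfield op emb j x = Dop x 0 0 (axis (emb j) 1)"
  unfolding hfield_def using frechet_derivative_at[OF op_derivative_right[of x 0]] by simp

lemma hfield_dil:
  assumes "0 < R"
  shows "R *\<^sub>R hfield op emb j (dil deg R x) = dil deg R (hfield op emb j x)"
proof -
  have "dil deg R (axis (emb j) 1) = R *\<^sub>R axis (emb j) 1"
    using deg_emb[of j] by (auto simp: dil_def vec_eq_iff axis_def)
  then have "dil deg R (hfield op emb j x) = Dop (dil deg R x) 0 0 (R *\<^sub>R axis (emb j) 1)"
    using Dop_dil[OF assms, of x 0 0 "axis (emb j) 1"] by (simp add: hfield_eq)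
  also have "\<dots> = R *\<^sub>R hfield op emb j (dil deg R x)"
    by (simp add: hfield_eq linear_cmul[OF linear_Dop_right])
  finally show ?thesis by simp
qed

text \<open>The diagonal partial derivatives of a horizontal field are homogeneous of degree -1 and
  continuous at the origin, hence zero.\<close>

lemma diagonal_derivative_hfield:
  "frechet_derivative (hfield op emb j) (at x) (axis k 1) $ k = 0"
proof -
  let ?X = "hfield op emb j" and ?d = "dil deg"
  let ?p = "\<lambda>x. frechet_derivative ?X (at x) (axis k 1) $ k"
  have der: "(?X has_derivative frechet_derivative ?X (at x)) (at x)" for x
    by (rule C1_has_derivative[OF C1_hfield])
  have eq: "?p x = R * ?p (?d R x)" if R: "0 < R" for R
  proof -
    have d: "(?d R has_derivative ?d R) F" for F
      by (rule bounded_linear_imp_has_derivative[OF bounded_linear_dil])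
    have "((\<lambda>x. R *\<^sub>R ?X (?d R x)) has_derivative (\<lambda>v. R *\<^sub>R frechet_derivative ?X (at (?d R x)) (?d R v))) (at x)"
      by (intro has_derivative_scaleR_right has_derivative_compose[OF d der])
    moreover have "((\<lambda>x. ?d R (?X x)) has_derivative (\<lambda>v. ?d R (frechet_derivative ?X (at x) v))) (at x)"
      by (rule has_derivative_compose[OF der d])
    ultimately have "(\<lambda>v. R *\<^sub>R frechet_derivative ?X (at (?d R x)) (?d R v)) = (\<lambda>v. ?d R (frechet_derivative ?X (at x) v))"
      unfolding hfield_dil[OF R] by (rule has_derivative_unique)
    from fun_cong[OF this, of "axis k 1"]
    have "R *\<^sub>R frechet_derivative ?X (at (?d R x)) (?d R (axis k 1)) = ?d R (frechet_derivative ?X (at x) (axis k 1))" .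
    moreover have "?d R (axis k 1) = R ^ deg k *\<^sub>R axis k 1"
      by (auto simp: dil_def vec_eq_iff axis_def)
    ultimately have "R *\<^sub>R R ^ deg k *\<^sub>R frechet_derivative ?X (at (?d R x)) (axis k 1) = ?d R (frechet_derivative ?X (at x) (axis k 1))"
      using linear_cmul[OF has_derivative_linear[OF der]] by simp
    \<comment> \<open>In the k-th component of the k-th partial derivative the factors
      \<open>R ^ deg k\<close> on both sides cancel, which leaves a single factor R.\<close>
    from arg_cong[OF this, of "\<lambda>v. v $ k"] show ?thesis
      using R by (simp add: dil_def)
  qed
  have "isCont (\<lambda>x. frechet_derivative ?X (at x) (axis k 1)) 0"
    using C1_hfield by (auto simp: C1_def continuous_on_eq_continuous_at)
  then have "((\<lambda>R. frechet_derivative ?X (at (?d R x)) (axis k 1)) \<longlongrightarrow> frechet_derivative ?X (at 0) (axis k 1)) (at_right 0)"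
    by (rule isCont_tendsto_compose[OF _ dil_tendsto_0])
  then have "((\<lambda>R. R * ?p (?d R x)) \<longlongrightarrow> 0 * ?p 0) (at_right 0)"
    by (intro tendsto_intros)
  moreover have "\<forall>\<^sub>F R in at_right 0. R * ?p (?d R x) = ?p x"
    using eq by (intro eventually_at_rightI[of 0 1]) auto
  ultimately have "((\<lambda>R. ?p x) \<longlongrightarrow> 0) (at_right (0::real))"
    using tendsto_cong by fastforce
  then show ?thesis
    using tendsto_const tendsto_unique trivial_limit_at_right_real by blast
qed

text \<open>The product rule gives two terms, and the divergence of the field vanishes by
  \<open>diagonal_derivative_hfield\<close>. Thus the formal adjoint of a generating field is its
  negative, and \<open>weak_hgrad\<close> takes the usual form of integration by parts.\<close>

lemma hdiv_eq_hgrad: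
  assumes "C1 \<phi>"
  shows "hdiv op emb (\<lambda>y. \<phi> y *\<^sub>R axis j 1) x = hgrad op emb \<phi> x $ j"
proof -
  let ?X = "hfield op emb j"
  have "(\<Sum>i\<in>UNIV. ((\<phi> y *\<^sub>R axis j 1) $ i) *\<^sub>R hfield op emb i y) = \<phi> y *\<^sub>R ?X y" for y
  proof -
    have "(\<Sum>i\<in>UNIV. ((\<phi> y *\<^sub>R axis j 1) $ i) *\<^sub>R hfield op emb i y) =
      (\<Sum>i\<in>UNIV. if i = j then \<phi> y *\<^sub>R ?X y else 0)"
      by (rule sum.cong) (auto simp: axis_def)
    then show ?thesis by simp
  qed
  then have "hdiv op emb (\<lambda>y. \<phi> y *\<^sub>R axis j 1) x = vdiv (\<lambda>y. \<phi> y *\<^sub>R ?X y) x"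
    by (simp add: hdiv_def)
  moreover have "((\<lambda>y. \<phi> y *\<^sub>R ?X y) has_derivative
      (\<lambda>h. \<phi> x *\<^sub>R frechet_derivative ?X (at x) h + frechet_derivative \<phi> (at x) h *\<^sub>R ?X x)) (at x)"
    by (intro has_derivative_scaleR C1_has_derivative assms C1_hfield)
  from frechet_derivative_at[OF this]
  have "vdiv (\<lambda>y. \<phi> y *\<^sub>R ?X y) x = (\<Sum>k\<in>UNIV. frechet_derivative \<phi> (at x) (axis k 1) * ?X x $ k)"
    unfolding vdiv_def by (metis (no_types, lifting) diagonal_derivative_hfield add_0 mult_zero_right
        real_scaleR_def vector_add_component vector_scaleR_component sum.cong)
  moreover have "frechet_derivative \<phi> (at x) (?X x) = (\<Sum>k\<in>UNIV. frechet_derivative \<phi> (at x) (axis k 1) * ?X x $ k)"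
  proof -
    have lin: "linear (frechet_derivative \<phi> (at x))"
      by (rule has_derivative_linear[OF C1_has_derivative[OF assms]])
    have "frechet_derivative \<phi> (at x) (?X x) = frechet_derivative \<phi> (at x) (\<Sum>k\<in>UNIV. (?X x $ k) *\<^sub>R axis k 1)"
      using basis_expansion[of "?X x"] by (simp add: scalar_mult_eq_scaleR)
    then show ?thesis
      by (simp add: linear_sum[OF lin] linear_cmul[OF lin] mult.commute)
  qed
  ultimately show ?thesis
    by (simp add: hgrad_def)
qed

lemma hgrad_continuous: "C1 \<phi> \<Longrightarrow> continuous_on S (\<lambda>x. hgrad op emb \<phi> x)"
  unfolding hgrad_def
  by (intro continuous_intros C1_derivative_continuous C1_continuous_on[OF C1_hfield])

lemma hgrad_eqI: "(\<phi> has_derivative \<phi>') (at x) \<Longrightarrow> hgrad op emb \<phi> x = (\<chi> j. \<phi>' (hfield op emb j x))"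
  using frechet_derivative_at by (fastforce simp: hgrad_def vec_eq_iff)

end

lemma carnot_if_homogeneous_carnot_group:
  assumes "homogeneous_carnot_group op deg emb"
  shows "carnot op deg emb"
proof -
  have sm: "smooth_map (\<lambda>z. op (fst z) (snd z))" and inj: "range emb = {i. deg i = 1}"
    using assms by (auto simp: homogeneous_carnot_group_def)
  interpret dilation_group op deg
    using assms smooth_map_C1(1)[OF sm]
    by unfold_locales (auto simp: homogeneous_carnot_group_def)
  have "hfield op emb j = (\<lambda>x. frechet_derivative (\<lambda>z. op (fst z) (snd z)) (at (x, 0)) (0, axis (emb j) 1))" for j
    using frechet_derivative_at[OF op_derivative_right[where y=0]] by (auto simp: hfield_def Dop_def fun_eq_iff)
  moreover have "C1 (\<lambda>x. frechet_derivative (\<lambda>z. op (fst z) (snd z)) (at (x, 0)) (0, axis (emb j) 1))" for j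
    using C1_compose[OF smooth_map_C1(2)[OF sm] C1_Pair[OF C1_ident C1_const]] .
  ultimately show ?thesis
    using inj by unfold_locales auto
qed

section \<open>Differentiation under the integral sign\<close>

text \<open>Borel measurability instead of Lebesgue measurability keeps compositions with the group
  law measurable, also jointly in both factors as Fubini's theorem requires.\<close>

definition locally_integrable :: "(real^'n \<Rightarrow> 'b::{banach, second_countable_topology}) \<Rightarrow> bool" where
  "locally_integrable f \<longleftrightarrow> f \<in> borel_measurable borel \<and>
     (\<forall>K. compact K \<longrightarrow> set_integrable lborel K f)"

lemma locally_integrable_measurable [measurable_dest]:
  "locally_integrable f \<Longrightarrow> f \<in> borel_measurable borel"
  by (simp add: locally_integrable_def)

lemma integrable_kernel:
  fixes f :: "real^'n \<Rightarrow> 'b::{banach, second_countable_topology}" and k :: "real^'n \<Rightarrow> real"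
  assumes f: "locally_integrable f" and k: "continuous_on UNIV k" and Z: "compact Z"
    and kZ: "\<And>z. z \<notin> Z \<Longrightarrow> k z = 0"
  shows "integrable lborel (\<lambda>z. k z *\<^sub>R f z)"
proof -
  have [measurable]: "k \<in> borel_measurable borel" "f \<in> borel_measurable borel"
    using k f by (auto intro: borel_measurable_continuous_onI)
  have "bounded (k ` Z)"
    by (intro compact_imp_bounded compact_continuous_image Z continuous_on_subset[OF k]) auto
  then obtain C where C: "\<And>z. z \<in> Z \<Longrightarrow> \<bar>k z\<bar> \<le> C"
    by (auto simp: bounded_iff)
  have "set_integrable lborel Z f"
    using f Z by (simp add: locally_integrable_def)
  then have "integrable lborel (\<lambda>z. C *\<^sub>R (indicator Z z *\<^sub>R f z))"
    unfolding set_integrable_def by (rule integrable_scaleR_right)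
  then show ?thesis
  proof (rule Bochner_Integration.integrable_bound)
    show "AE z in lborel. norm (k z *\<^sub>R f z) \<le> norm (C *\<^sub>R (indicator Z z *\<^sub>R f z))"
    proof (rule AE_I2)
      show "norm (k z *\<^sub>R f z) \<le> norm (C *\<^sub>R (indicator Z z *\<^sub>R f z))" for z
        using C[of z] kZ[of z] by (cases "z \<in> Z") (auto intro!: mult_right_mono order_trans[OF _ abs_ge_self])
    qed
  qed simp
qed

text \<open>Dominated convergence along sequences: a convergent sequence is bounded, so a single
  compact set contains the supports of all kernels that occur. In \<open>M (z, x)\<close> the first
  argument is the variable of integration.\<close>

lemma continuous_kernel_integral:
  fixes f :: "real^'n \<Rightarrow> real" and M :: "(real^'n) \<times> (real^'n) \<Rightarrow> real"
  assumes f: "locally_integrable f" and M: "continuous_on UNIV M"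
    and supp: "\<And>B. compact B \<Longrightarrow> \<exists>Z. compact Z \<and> (\<forall>x\<in>B. \<forall>z. z \<notin> Z \<longrightarrow> M (z, x) = 0)"
  shows "continuous_on UNIV (\<lambda>x. \<integral>z. M (z, x) * f z \<partial>lborel)"
proof (clarsimp simp: continuous_on_sequentially o_def)
  fix x :: "nat \<Rightarrow> real^'n" and a assume lim: "x \<longlonglongrightarrow> a"
  obtain r where r: "\<And>n. norm (x n) \<le> r"
    using convergent_imp_bounded[OF lim] by (auto simp: bounded_iff)
  have ra: "norm a \<le> r"
    by (rule Lim_norm_ubound[OF sequentially_bot lim]) (use r in auto)
  obtain Z where Z: "compact Z" "\<And>x z. norm x \<le> r \<Longrightarrow> z \<notin> Z \<Longrightarrow> M (z, x) = 0"
    using supp[of "cball 0 r"] by auto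
  have "bounded (M ` (Z \<times> cball 0 r))"
    by (intro compact_imp_bounded compact_continuous_image compact_Times Z continuous_on_subset[OF M]) auto
  then obtain C where C: "\<And>z x. z \<in> Z \<Longrightarrow> norm x \<le> r \<Longrightarrow> \<bar>M (z, x)\<bar> \<le> C"
    by (fastforce simp: bounded_iff)
  have cM: "continuous_on UNIV (\<lambda>z. M (z, x))" for x
    by (rule continuous_on_compose2[OF M]) (auto intro: continuous_intros)
  have [measurable]: "f \<in> borel_measurable borel" "(\<lambda>z. M (z, x)) \<in> borel_measurable borel" for x
    using f cM by (auto intro: borel_measurable_continuous_onI)
  have "set_integrable lborel Z f"
    using f Z by (simp add: locally_integrable_def)
  then have int: "integrable lborel (\<lambda>z. C * \<bar>indicator Z z * f z\<bar>)"
    by (simp add: set_integrable_def)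
  show "(\<lambda>n. \<integral>z. M (z, x n) * f z \<partial>lborel) \<longlonglongrightarrow> (\<integral>z. M (z, a) * f z \<partial>lborel)"
  proof (rule integral_dominated_convergence[OF _ _ int])
    have "isCont M (z, a)" for z
      using M by (simp add: continuous_on_eq_continuous_at)
    then have "(\<lambda>n. M (z, x n)) \<longlonglongrightarrow> M (z, a)" for z
      by (rule isCont_tendsto_compose) (intro tendsto_intros lim)
    then show "AE z in lborel. (\<lambda>n. M (z, x n) * f z) \<longlonglongrightarrow> M (z, a) * f z"
      by (intro AE_I2 tendsto_intros)
    show "AE z in lborel. norm (M (z, x n) * f z) \<le> C * \<bar>indicator Z z * f z\<bar>" for n
    proof (rule AE_I2)
      show "norm (M (z, x n) * f z) \<le> C * \<bar>indicator Z z * f z\<bar>" for z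
        using C[of z "x n"] r[of n] Z(2)[of "x n" z] by (cases "z \<in> Z") (auto simp: abs_mult intro!: mult_right_mono)
    qed
  qed simp_all
qed

text \<open>The derivative of the kernel is uniformly continuous on the relevant compact set, so the
  linearisation error is small uniformly in z and may be integrated against the merely locally
  integrable \<open>f\<close>.\<close>

lemma C1_kernel_integral:
  fixes f :: "real^'n \<Rightarrow> real" and K :: "(real^'n) \<times> (real^'n) \<Rightarrow> real"
  assumes f: "locally_integrable f" and K: "C1 K"
    and supp: "\<And>B. compact B \<Longrightarrow> \<exists>Z. compact Z \<and> (\<forall>x\<in>B. \<forall>z. z \<notin> Z \<longrightarrow> K (z, x) = 0)"
  defines "F \<equiv> \<lambda>x. \<integral>z. K (z, x) * f z \<partial>lborel"
    and "F' \<equiv> \<lambda>x v. \<integral>z. frechet_derivative K (at (z, x)) (0, v) * f z \<partial>lborel"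
  shows "(F has_derivative F' x) (at x)" and "C1 F"
proof -
  let ?K' = "\<lambda>z x v. frechet_derivative K (at (z, x)) (0, v)"
  have derK: "((\<lambda>x. K (z, x)) has_derivative ?K' z x) (at x)" for z x
    using has_derivative_compose[OF has_derivative_Pair[OF has_derivative_const has_derivative_ident] C1_has_derivative[OF K]]
    by simp
  have linK: "linear (?K' z x)" for z x
    by (rule has_derivative_linear[OF derK])
  \<comment> \<open>The set Z is taken for a ball slightly larger than one containing B. Then for z
    outside Z the kernel vanishes in a neighbourhood of each x in B, so its derivative in x vanishes
    as well.\<close>
  have supp': "\<exists>Z. compact Z \<and> (\<forall>x\<in>B. \<forall>z. z \<notin> Z \<longrightarrow> K (z, x) = 0 \<and> ?K' z x = (\<lambda>_. 0))" if B: "compact B" for B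
  proof -
    obtain r where r: "\<And>x. x \<in> B \<Longrightarrow> norm x \<le> r"
      using compact_imp_bounded[OF B] by (auto simp: bounded_iff)
    obtain Z where Z: "compact Z" "\<And>x z. norm x \<le> r + 1 \<Longrightarrow> z \<notin> Z \<Longrightarrow> K (z, x) = 0"
      using supp[of "cball 0 (r + 1)"] by auto
    have "?K' z x = (\<lambda>_. 0)" if "x \<in> B" "z \<notin> Z" for x z
    proof -
      have "((\<lambda>x. K (z, x)) has_derivative (\<lambda>_. 0)) (at x)"
        by (rule has_derivative_transform_within_open[OF has_derivative_const, of "ball 0 (r + 1)"])
          (use Z(2) r[OF that(1)] that(2) in auto)
      then show ?thesis
        using has_derivative_unique[OF derK] by metis
    qed
    then show ?thesis
      using Z r by (intro exI[of _ Z]) force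
  qed
  have cK: "continuous_on UNIV (\<lambda>z. K (z, x))" for x
    by (rule continuous_on_compose2[OF C1_continuous_on[OF K, of UNIV]]) (auto intro: continuous_intros)
  have cK': "continuous_on S (\<lambda>t. ?K' (a t) (b t) (c t))" if "continuous_on S a" "continuous_on S b" "continuous_on S c"
    for S :: "'z::topological_space set" and a b c
    by (intro C1_derivative_continuous[OF K] continuous_intros that)
  have intK: "integrable lborel (\<lambda>z. K (z, x) * f z)" for x
    using supp[of "{x}"] integrable_kernel[OF f cK] by auto
  have intK': "integrable lborel (\<lambda>z. ?K' z x v * f z)" for x v
  proof -
    obtain Z where "compact Z" "\<And>z. z \<notin> Z \<Longrightarrow> ?K' z x v = 0"
      using supp'[of "{x}"] by (auto simp: fun_eq_iff)
    moreover have "continuous_on UNIV (\<lambda>z. ?K' z x v)"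
      by (intro cK' continuous_intros)
    ultimately show ?thesis
      using integrable_kernel[OF f, of "\<lambda>z. ?K' z x v" Z] by auto
  qed
  have linF: "linear (F' x)" for x
    unfolding F'_def
    by (rule linearI) (simp_all add: linear_add[OF linK] linear_cmul[OF linK] distrib_right intK' mult.assoc)
  show der: "(F has_derivative F' x) (at x)" for x
    unfolding has_derivative_at_alt
  proof (intro conjI allI impI)
    show "bounded_linear (F' x)"
      using linF linear_conv_bounded_linear by blast
    fix e :: real assume e: "0 < e"
    obtain Z where Z: "compact Z" and Z0: "\<And>y z. y \<in> cball x 1 \<Longrightarrow> z \<notin> Z \<Longrightarrow> K (z, y) = 0 \<and> ?K' z y = (\<lambda>_. 0)"
      using supp'[of "cball x 1"] by fastforce
    have "set_integrable lborel Z f"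
      using f Z by (simp add: locally_integrable_def)
    then have intf: "integrable lborel (\<lambda>z. \<bar>indicator Z z * f z\<bar>)"
      by (simp add: set_integrable_def)
    define I where "I = (\<integral>z. \<bar>indicator Z z * f z\<bar> \<partial>lborel)"
    have I: "0 \<le> I" by (simp add: I_def)
    \<comment> \<open>The summand 1 only avoids a division by zero when \<open>f\<close> vanishes on
      Z.\<close>
    define e' where "e' = e / (I + 1)"
    have e': "0 < e'" "e' * I \<le> e"
      using e I by (auto simp: e'_def field_simps)
    \<comment> \<open>Directions are restricted to the unit ball for compactness; linearity in the
      direction then gives the bound for every v.\<close>
    have "uniformly_continuous_on (Z \<times> cball x 1 \<times> cball 0 1) (\<lambda>t. ?K' (fst t) (fst (snd t)) (snd (snd t)))"
      by (intro compact_uniformly_continuous cK' continuous_intros compact_Times Z compact_cball)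
    then obtain d where d: "0 < d" and ud: "\<And>s t. s \<in> Z \<times> cball x 1 \<times> cball 0 1 \<Longrightarrow> t \<in> Z \<times> cball x 1 \<times> cball 0 1 \<Longrightarrow>
        dist s t < d \<Longrightarrow> dist (?K' (fst s) (fst (snd s)) (snd (snd s))) (?K' (fst t) (fst (snd t)) (snd (snd t))) < e'"
      unfolding uniformly_continuous_on_def using e'(1) by (metis (no_types, lifting) dist_commute)
    have K'near: "norm (?K' z y v - ?K' z x v) \<le> e' * norm v" if "z \<in> Z" "norm (y - x) < min d 1" for z y v
    proof (cases "v = 0")
      case True
      then show ?thesis using linear_0[OF linK] by simp
    next
      case False
      let ?v = "(1 / norm v) *\<^sub>R v"
      have "dist (?K' z y ?v) (?K' z x ?v) < e'"
        using ud[of "(z, y, ?v)" "(z, x, ?v)"] that False by (auto simp: dist_Pair_Pair dist_norm norm_minus_commute)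
      then have "norm ((1 / norm v) *\<^sub>R (?K' z y v - ?K' z x v)) < e'"
        by (simp only: linear_cmul[OF linK] dist_norm scaleR_diff_right)
      then show ?thesis
        using False by (simp add: field_simps)
    qed
    show "\<exists>d>0. \<forall>y. norm (y - x) < d \<longrightarrow> norm (F y - F x - F' x (y - x)) \<le> e * norm (y - x)"
    proof (intro exI conjI allI impI)
      show "0 < min d 1" using d by simp
      fix y assume y: "norm (y - x) < min d 1"
      have bound: "\<bar>(K (z, y) - K (z, x) - ?K' z x (y - x)) * f z\<bar> \<le> (norm (y - x) * e') * \<bar>indicator Z z * f z\<bar>" for z
      proof (cases "z \<in> Z")
        case False
        then show ?thesis
          using Z0[of x z] Z0[of y z] y
          by (auto simp: dist_norm norm_minus_commute dest!: fun_cong[where x="y - x"])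
      next
        case True
        have "norm (K (z, y) - K (z, x) - ?K' z x (y - x)) \<le> norm (y - x) * e'"
        proof (rule differentiable_bound_linearization[where S="ball x (min d 1)" and f'="?K' z"])
          show "\<And>t. t \<in> {0..1} \<Longrightarrow> x + t *\<^sub>R (y - x) \<in> ball x (min d 1)"
          proof -
            fix t :: real assume t: "t \<in> {0..1}"
            then have "norm (t *\<^sub>R (y - x)) \<le> norm (y - x)"
              by (simp add: mult_left_le_one_le)
            then show "x + t *\<^sub>R (y - x) \<in> ball x (min d 1)"
              using y by (simp add: dist_norm)
          qed
          show "((\<lambda>x. K (z, x)) has_derivative ?K' z w) (at w within ball x (min d 1))" for w
            using derK has_derivative_at_withinI by blast
          show "onorm (?K' z w - ?K' z x) \<le> e'" if "w \<in> ball x (min d 1)" for w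
            using K'near[OF True, of w] that e'(1) by (intro onorm_bound) (auto simp: dist_norm norm_minus_commute)
        qed (use d in auto)
        then show ?thesis
          using True by (simp add: abs_mult mult_right_mono)
      qed
      have "F y - F x - F' x (y - x) = (\<integral>z. (K (z, y) - K (z, x) - ?K' z x (y - x)) * f z \<partial>lborel)"
        by (simp add: F_def F'_def left_diff_distrib intK intK')
      also have "\<bar>\<dots>\<bar> \<le> (\<integral>z. \<bar>(K (z, y) - K (z, x) - ?K' z x (y - x)) * f z\<bar> \<partial>lborel)"
        by (rule integral_abs_bound)
      also have "\<dots> \<le> (\<integral>z. (norm (y - x) * e') * \<bar>indicator Z z * f z\<bar> \<partial>lborel)"
        by (intro integral_mono bound integrable_abs integrable_mult_right intf)
          (simp add: left_diff_distrib intK intK')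
      also have "\<dots> = norm (y - x) * (e' * I)"
        by (simp add: I_def)
      also have "\<dots> \<le> norm (y - x) * e"
        using e'(2) by (rule mult_left_mono) simp
      finally show "norm (F y - F x - F' x (y - x)) \<le> e * norm (y - x)"
        by (simp add: mult.commute)
    qed
  qed
  have "continuous_on UNIV (\<lambda>x. F' x v)" for v
    unfolding F'_def
  proof (rule continuous_kernel_integral[OF f, of "\<lambda>t. ?K' (fst t) (snd t) v", simplified])
    show "continuous_on UNIV (\<lambda>t. frechet_derivative K (at t) (0, v))"
      using C1_derivative_continuous[OF K continuous_on_id continuous_on_const] by simp
    show "\<exists>Z. compact Z \<and> (\<forall>x\<in>B. \<forall>z. z \<notin> Z \<longrightarrow> ?K' z x v = 0)" if "compact B" for B
      using supp'[OF that] by (metis (no_types, lifting))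
  qed
  with der show "C1 F"
    by (intro C1I)
qed

section \<open>Mollification\<close>

text \<open>From exponent 2 on, powers of the positive part are differentiable at 0 too. Mollifiers
  and cut-offs are built from them, since test functions need only be of class C1.\<close>

lemma pos_part_power_derivative:
  assumes "2 \<le> n"
  shows "((\<lambda>t::real. (max 0 t) ^ n) has_real_derivative real n * (max 0 t) ^ (n - 1)) (at t)"
proof (cases t "0 :: real" rule: linorder_cases)
  case less
  have "((\<lambda>t::real. 0) has_real_derivative 0) (at t)" by simp
  then have "((\<lambda>t::real. (max 0 t) ^ n) has_real_derivative 0) (at t)"
    by (rule has_field_derivative_transform_within_open[of _ _ _ "{..<0}"]) (use less assms in auto)
  moreover have "real n * (max 0 t) ^ (n - 1) = 0"
    using less assms by (simp add: max_def)
  ultimately show ?thesis by (simp only:)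
next
  case greater
  have "((\<lambda>t::real. t ^ n) has_real_derivative real n * t ^ (n - 1)) (at t)"
    by (rule derivative_eq_intros refl | simp)+
  then have "((\<lambda>t::real. (max 0 t) ^ n) has_real_derivative real n * t ^ (n - 1)) (at t)"
    by (rule has_field_derivative_transform_within_open[of _ _ _ "{0<..}"]) (use greater in auto)
  then show ?thesis using greater by simp
next
  case equal
  have "((\<lambda>h::real. (max 0 h) ^ (n - 1)) \<longlongrightarrow> (max 0 0) ^ (n - 1)) (at 0)"
    by (intro tendsto_intros)
  moreover have "\<forall>\<^sub>F h::real in at 0. (max 0 h) ^ (n - 1) = ((max 0 (0 + h)) ^ n - (max 0 0) ^ n) / h"
    unfolding eventually_at_filter
  proof (intro always_eventually allI impI)
    show "(max 0 h) ^ (n - 1) = ((max 0 (0 + h)) ^ n - (max 0 0) ^ n) / h" if "h \<noteq> 0" for h :: real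
      using that assms by (cases "0 < h") (auto simp: max_def power_eq_if)
  qed
  ultimately have "((\<lambda>h::real. ((max 0 (0 + h)) ^ n - (max 0 0) ^ n) / h) \<longlongrightarrow> (max 0 0) ^ (n - 1)) (at 0)"
    using tendsto_cong by fastforce
  moreover have z: "(max 0 (0::real)) ^ (n - 1) = 0"
    using assms by simp
  ultimately have "((\<lambda>h::real. ((max 0 (0 + h)) ^ n - (max 0 0) ^ n) / h) \<longlongrightarrow> real n * (max 0 0) ^ (n - 1)) (at 0)"
    by (simp only: z mult_zero_right)
  then show ?thesis
    using equal by (simp add: DERIV_def)
qed

lemma C1_pos_part_power:
  fixes f :: "'a::euclidean_space \<Rightarrow> real"
  assumes "2 \<le> n" "C1 f"
  shows "C1 (\<lambda>x. (max 0 (f x)) ^ n)"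
proof (rule C1_compose[OF _ assms(2)])
  show "C1 (\<lambda>t::real. (max 0 t) ^ n)"
    by (rule C1I[OF pos_part_power_derivative[OF assms(1), unfolded has_field_derivative_def]])
      (intro continuous_intros)
qed

lemma C1_const_minus_norm_square: "C1 (\<lambda>x::'a::euclidean_space. c - x \<bullet> x)"
proof (rule C1I)
  show "((\<lambda>x::'a. c - x \<bullet> x) has_derivative (\<lambda>h. 0 - (x \<bullet> h + h \<bullet> x))) (at x)" for x
    by (intro has_derivative_diff has_derivative_const has_derivative_inner has_derivative_ident)
qed (intro continuous_intros)

definition mollifier :: "real \<Rightarrow> (real^'n \<Rightarrow> real) \<Rightarrow> bool" where
  "mollifier \<delta> J \<longleftrightarrow> C1_0 J \<and> (\<forall>w. 0 \<le> J w) \<and> (\<integral>w. J w \<partial>lborel) = 1 \<and> (\<forall>w. J w \<noteq> 0 \<longrightarrow> norm w < \<delta>)"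

lemma C1_0_integrable: "C1_0 J \<Longrightarrow> integrable lborel J"
proof -
  assume J: "C1_0 J"
  have "locally_integrable (\<lambda>_::real^'n. 1::real)"
    using borel_integrable_compact[of _ "\<lambda>_. 1::real"]
    by (auto simp: locally_integrable_def set_integrable_def)
  then have "integrable lborel (\<lambda>z. J z *\<^sub>R (1::real))"
  proof (rule integrable_kernel)
    show "continuous_on UNIV J" "compact (closure {x. J x \<noteq> 0})"
      using J C1_continuous_on by (auto simp: C1_0_iff)
    show "J z = 0" if "z \<notin> closure {x. J x \<noteq> 0}" for z
      using that closure_subset[of "{x. J x \<noteq> 0}"] by auto
  qed
  then show ?thesis by simp
qed

lemma ex_mollifier:
  assumes "0 < \<delta>"
  shows "\<exists>J :: real^'n \<Rightarrow> real. mollifier \<delta> J"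
proof -
  define b where "b x = (max 0 ((\<delta>/2)\<^sup>2 - x \<bullet> x)) ^ 2" for x :: "real^'n"
  have b0: "0 \<le> b x" for x
    by (simp add: b_def)
  have C: "C1 b"
    unfolding b_def by (intro C1_pos_part_power C1_const_minus_norm_square) simp
  have nz: "norm x \<le> \<delta>/2" if "b x \<noteq> 0" for x
  proof -
    have "x \<bullet> x < (\<delta>/2)\<^sup>2"
      using that by (auto simp: b_def max_def split: if_splits)
    then show ?thesis
      using assms by (metis abs_le_square_iff abs_norm_cancel abs_of_pos half_gt_zero less_imp_le power2_norm_eq_inner)
  qed
  then have sub: "{x. b x \<noteq> 0} \<subseteq> cball 0 (\<delta>/2)"
    by auto
  have cpt: "compact (closure {x. b x \<noteq> 0})"
    using bounded_subset[OF bounded_cball sub] compact_closure by blast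
  have C0: "C1_0 b"
    using C cpt by (simp add: C1_0_iff)
  have int: "integrable lborel b"
    by (rule C1_0_integrable[OF C0])
  \<comment> \<open>A vanishing integral would make the closed zero set of \<open>b\<close> have
    full measure, hence be the whole space, although \<open>b 0\<close> is positive.\<close>
  have "(\<integral>x. b x \<partial>lborel) \<noteq> 0"
  proof
    assume "(\<integral>x. b x \<partial>lborel) = 0"
    then have "AE x in lborel. b x = 0"
      using integral_nonneg_eq_0_iff_AE[OF int] by (simp add: b0)
    then have "AE x in lebesgue. x \<in> {x. b x = 0}"
      using AE_completion by auto
    moreover have "closed {x. b x = 0}"
      by (intro closed_Collect_eq C1_continuous_on C continuous_on_const)
    ultimately have "b 0 = 0"
      using mem_closed_if_AE_lebesgue by blast
    then show False
      using assms by (simp add: b_def)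
  qed
  moreover have "0 \<le> (\<integral>x. b x \<partial>lborel)"
    by (intro integral_nonneg_AE AE_I2) (simp add: b_def)
  ultimately have pos: "0 < (\<integral>x. b x \<partial>lborel)"
    by simp
  define c where "c = inverse (\<integral>x. b x \<partial>lborel)"
  have c: "0 < c" using pos by (simp add: c_def)
  have "{x. c * b x \<noteq> 0} = {x. b x \<noteq> 0}"
    using c by auto
  then have "C1_0 (\<lambda>x. c * b x)"
    using cpt C1_mult[OF C1_const C] by (simp add: C1_0_iff)
  moreover have "0 \<le> c * b x" for x
    using c by (simp add: b_def)
  moreover have "(\<integral>x. c * b x \<partial>lborel) = 1"
    using pos by (simp add: c_def)
  moreover have "norm w < \<delta>" if "c * b w \<noteq> 0" for w
    using nz[of w] that assms by auto
  ultimately show ?thesis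
    by (intro exI[of _ "\<lambda>x. c * b x"]) (auto simp: mollifier_def)
qed

text \<open>Induction over integrable functions. An indicator is approximated by a Urysohn function
  between a closed inner and an open outer approximation of the set, and differs from it only in the
  small gap between the two.\<close>

lemma continuous_L1_dense:
  fixes g :: "real^'n \<Rightarrow> 'b::{banach, second_countable_topology}"
  assumes "integrable lborel g" "0 < (e::real)"
  shows "\<exists>c. continuous_on UNIV c \<and> (\<integral>\<^sup>+x. norm (g x - c x) \<partial>lborel) < e"
  using assms
proof (induction arbitrary: e rule: integrable_induct)
  case (base A b)
  define e' where "e' = e / (norm b + 1)"
  have e': "0 < e'" "norm b * e' < e"
    using base(3) by (auto simp: e'_def field_simps add_pos_nonneg intro!: divide_pos_pos)
  have A: "A \<in> sets lebesgue"
    using base by auto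
  obtain U where U: "open U" "A \<subseteq> U" "emeasure lebesgue (U - A) < ennreal (e'/2)"
    using sets_lebesgue_outer_open[OF A half_gt_zero[OF e'(1)]] by metis
  obtain T where T: "closed T" "T \<subseteq> A" "emeasure lebesgue (A - T) < ennreal (e'/2)"
    using sets_lebesgue_inner_closed[OF A half_gt_zero[OF e'(1)]] by metis
  obtain c :: "real^'n \<Rightarrow> real" where c: "continuous_on UNIV c" "\<And>x. c x \<in> closed_segment 1 0"
      "\<And>x. x \<in> T \<Longrightarrow> c x = 1" "\<And>x. x \<in> - U \<Longrightarrow> c x = 0"
  proof (rule Urysohn[of T "-U" "1::real" 0])
    show "closed T" "closed (- U)" "T \<inter> - U = {}"
      using T U by auto
  qed metis
  have [measurable]: "A \<in> sets borel" "U \<in> sets borel" "T \<in> sets borel"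
    using base T U by auto
  have "norm (indicator A x *\<^sub>R b - c x *\<^sub>R b) \<le> norm b * indicator (U - T) x" for x
  proof -
    have "\<bar>indicator A x - c x\<bar> \<le> indicator (U - T) x"
    proof -
      have "0 \<le> c x" "c x \<le> 1"
        using c(2)[of x] by (auto simp: closed_segment_eq_real_ivl)
      moreover have "x \<notin> U \<Longrightarrow> x \<notin> A" "x \<in> T \<Longrightarrow> x \<in> A"
        using T(2) U(2) by auto
      ultimately show ?thesis
        using c(3)[of x] c(4)[of x] by (cases "x \<in> T"; cases "x \<in> U"; cases "x \<in> A") simp_all
    qed
    then have "\<bar>indicator A x - c x\<bar> * norm b \<le> indicator (U - T) x * norm b"
      by (rule mult_right_mono) simp
    then show ?thesis
      by (simp add: scaleR_diff_left[symmetric] mult.commute)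
  qed
  then have "ennreal (norm (indicator A x *\<^sub>R b - c x *\<^sub>R b)) \<le> ennreal (norm b) * indicator (U - T) x" for x
    using ennreal_leI[of _ "norm b * indicator (U - T) x"] by (simp add: ennreal_mult' ennreal_indicator)
  then have "(\<integral>\<^sup>+x. norm (indicator A x *\<^sub>R b - c x *\<^sub>R b) \<partial>lborel) \<le> (\<integral>\<^sup>+x. ennreal (norm b) * indicator (U - T) x \<partial>lborel)"
    by (intro nn_integral_mono)
  also have "\<dots> = norm b * emeasure lborel (U - T)"
    by (simp add: nn_integral_cmult)
  also have "emeasure lborel (U - T) \<le> ennreal e'"
  proof -
    have "U - T = (U - A) \<union> (A - T)" using T U by auto
    then have "emeasure lborel (U - T) \<le> emeasure lborel (U - A) + emeasure lborel (A - T)"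
      using emeasure_subadditive[of "U - A" lborel "A - T"] by auto
    also have "\<dots> \<le> ennreal (e'/2) + ennreal (e'/2)"
      using U(3) T(3) by (intro add_mono) auto
    also have "\<dots> = ennreal e'"
      using e' by (simp add: ennreal_plus[symmetric])
    finally show ?thesis .
  qed
  also have "norm b * ennreal e' < e"
    using e' by (simp add: ennreal_mult'[symmetric] ennreal_less_iff)
  finally have "(\<integral>\<^sup>+x. norm (indicator A x *\<^sub>R b - c x *\<^sub>R b) \<partial>lborel) < e"
    by (simp add: mult_left_mono)
  then show ?case
    by (intro exI[of _ "\<lambda>x. c x *\<^sub>R b"]) (auto intro!: continuous_intros c)
next
  case (add f g)
  obtain c where c: "continuous_on UNIV c" "(\<integral>\<^sup>+x. norm (f x - c x) \<partial>lborel) < ennreal (e/2)"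
    using add.IH(1)[of "e/2"] add.prems by auto
  obtain d where d: "continuous_on UNIV d" "(\<integral>\<^sup>+x. norm (g x - d x) \<partial>lborel) < ennreal (e/2)"
    using add.IH(2)[of "e/2"] add.prems by auto
  have [measurable]: "f \<in> borel_measurable borel" "g \<in> borel_measurable borel" "c \<in> borel_measurable borel" "d \<in> borel_measurable borel"
    using add.hyps c d by (auto intro: borel_measurable_continuous_onI)
  have "(\<integral>\<^sup>+x. norm (f x + g x - (c x + d x)) \<partial>lborel) \<le> (\<integral>\<^sup>+x. ennreal (norm (f x - c x)) + norm (g x - d x) \<partial>lborel)"
    by (intro nn_integral_mono) (simp add: ennreal_plus[symmetric] norm_diff_triangle_ineq ennreal_leI del: ennreal_plus)
  also have "\<dots> = (\<integral>\<^sup>+x. norm (f x - c x) \<partial>lborel) + (\<integral>\<^sup>+x. norm (g x - d x) \<partial>lborel)"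
    by (rule nn_integral_add) auto
  also have "\<dots> < ennreal (e/2) + ennreal (e/2)"
    using c d by (intro add_strict_mono) auto
  also have "\<dots> = ennreal e"
    using add.prems by (simp add: ennreal_plus[symmetric] del: ennreal_plus)
  finally show ?case
    by (intro exI[of _ "\<lambda>x. c x + d x"]) (auto intro!: continuous_intros c d)
next
  case (lim f s)
  have [measurable]: "f \<in> borel_measurable borel" "\<And>i. s i \<in> borel_measurable borel"
    using lim by auto
  have "(\<lambda>i. \<integral>\<^sup>+x. norm (f x - s i x) \<partial>lborel) \<longlonglongrightarrow> (\<integral>\<^sup>+x. 0 \<partial>(lborel :: (real^'n) measure))"
  proof (rule nn_integral_dominated_convergence[where w="\<lambda>x. ennreal (3 * norm (f x))"])
    \<comment> \<open>The simple functions satisfy |s_j| <= 2 |f|, whence the majorant 3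
      |f|.\<close>
    show "AE x in lborel. ennreal (norm (f x - s j x)) \<le> ennreal (3 * norm (f x))" for j
    proof (intro AE_I2 ennreal_leI)
      show "norm (f x - s j x) \<le> 3 * norm (f x)" for x
        using norm_triangle_ineq4[of "f x" "s j x"] lim(3)[of x j] by simp
    qed
    show "AE x in lborel. (\<lambda>i. ennreal (norm (f x - s i x))) \<longlonglongrightarrow> 0"
    proof (intro AE_I2)
      fix x
      have "(\<lambda>i. norm (f x - s i x)) \<longlonglongrightarrow> norm (f x - f x)"
        by (intro tendsto_intros lim(2)) simp
      then show "(\<lambda>i. ennreal (norm (f x - s i x))) \<longlonglongrightarrow> 0"
        using tendsto_ennrealI by fastforce
    qed
    have "integrable lborel (\<lambda>x. 3 * norm (f x))"
      using lim by auto
    then show "(\<integral>\<^sup>+x. ennreal (3 * norm (f x)) \<partial>lborel) < \<infinity>"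
      by (subst nn_integral_eq_integral) auto
  qed auto
  then have "\<forall>\<^sub>F i in sequentially. (\<integral>\<^sup>+x. norm (f x - s i x) \<partial>lborel) < ennreal (e/2)"
    using lim.prems by (intro order_tendstoD(2)) auto
  then obtain i where i: "(\<integral>\<^sup>+x. norm (f x - s i x) \<partial>lborel) < ennreal (e/2)"
    by (auto simp: eventually_sequentially)
  obtain c where c: "continuous_on UNIV c" "(\<integral>\<^sup>+x. norm (s i x - c x) \<partial>lborel) < ennreal (e/2)"
    using lim.IH[of "e/2" i] lim.prems by auto
  have [measurable]: "c \<in> borel_measurable borel"
    using c by (auto intro: borel_measurable_continuous_onI)
  have "(\<integral>\<^sup>+x. norm (f x - c x) \<partial>lborel) \<le> (\<integral>\<^sup>+x. ennreal (norm (f x - s i x)) + norm (s i x - c x) \<partial>lborel)"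
    by (intro nn_integral_mono)
      (metis diff_add_cancel add_diff_eq ennreal_leI ennreal_plus norm_ge_zero norm_triangle_ineq)
  also have "\<dots> = (\<integral>\<^sup>+x. norm (f x - s i x) \<partial>lborel) + (\<integral>\<^sup>+x. norm (s i x - c x) \<partial>lborel)"
    by (rule nn_integral_add) auto
  also have "\<dots> < ennreal (e/2) + ennreal (e/2)"
    using c i by (intro add_strict_mono) auto
  also have "\<dots> = ennreal e"
    using lim.prems by (simp add: ennreal_plus[symmetric] del: ennreal_plus)
  finally show ?case
    using c by blast
qed


section \<open>Mollification along left translations\<close>

context carnot
begin

definition moll :: "(real^'n \<Rightarrow> real) \<Rightarrow> (real^'n \<Rightarrow> 'b) \<Rightarrow> real^'n \<Rightarrow> 'b::{banach, second_countable_topology}" where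
  "moll J f x = (\<integral>w. J w *\<^sub>R f (op w x) \<partial>lborel)"

text \<open>The substitution z = wx, allowed by right invariance, moves x from the nonsmooth
  \<open>f\<close> into the kernel, where it can be differentiated.\<close>

lemma moll_eq:
  assumes [measurable]: "J \<in> borel_measurable borel" "f \<in> borel_measurable borel"
  shows "moll J f x = (\<integral>z. J (op z (ginv x)) *\<^sub>R f z \<partial>lborel)"
proof -
  have "(\<lambda>z. J (op z (ginv x)) *\<^sub>R f z) \<in> borel_measurable borel"
    by measurable
  from integral_right[OF this, of x] show ?thesis
    by (simp add: moll_def)
qed

text \<open>If z x^(-1) lies in the support of \<open>J\<close>, then z lies in the product of that
  support with B, a continuous image of a compact set.\<close>

lemma translates_support:
  assumes "C1_0 J" "compact B"
  shows "\<exists>Z. compact Z \<and> (\<forall>x\<in>B. \<forall>z. z \<notin> Z \<longrightarrow> J (op z (ginv x)) = 0)"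
proof (intro exI conjI ballI allI impI)
  let ?Z = "(\<lambda>z. op (fst z) (snd z)) ` (closure {w. J w \<noteq> 0} \<times> B)"
  show "compact ?Z"
    using assms by (intro compact_continuous_image compact_Times C1_continuous_on[OF C1_op2]) (auto simp: C1_0_iff)
  show "J (op z (ginv x)) = 0" if "x \<in> B" "z \<notin> ?Z" for x z
  proof (rule ccontr)
    assume "J (op z (ginv x)) \<noteq> 0"
    then have "(op z (ginv x), x) \<in> closure {w. J w \<noteq> 0} \<times> B"
      using closure_subset[of "{w. J w \<noteq> 0}"] that(1) by auto
    from imageI[OF this, of "\<lambda>z. op (fst z) (snd z)"] show False
      using that(2) by simp
  qed
qed

lemma C1_kernel: "C1 J \<Longrightarrow> C1 (\<lambda>t. J (op (fst t) (ginv (snd t))))"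
  by (rule C1_compose[OF _ C1_op[OF C1_bounded_linear[OF bounded_linear_fst]
        C1_compose[OF C1_ginv C1_bounded_linear[OF bounded_linear_snd]]]])

lemma integrable_moll:
  assumes J: "C1_0 J" and f: "locally_integrable f"
  shows "integrable lborel (\<lambda>z. J (op z (ginv x)) *\<^sub>R f z)" "integrable lborel (\<lambda>w. J w *\<^sub>R f (op w x))"
proof -
  have [measurable]: "J \<in> borel_measurable borel" "f \<in> borel_measurable borel"
    using J f by (auto simp: C1_0_iff C1_measurable)
  obtain Z where Z: "compact Z" "\<And>z. z \<notin> Z \<Longrightarrow> J (op z (ginv x)) = 0"
    using translates_support[OF J, of "{x}"] by auto
  have "continuous_on UNIV (\<lambda>z. J (op z (ginv x)))"
    by (rule C1_continuous_on[OF C1_compose[OF _ C1_op_right]]) (use J in \<open>simp add: C1_0_iff\<close>)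
  from integrable_kernel[OF f this Z] show *: "integrable lborel (\<lambda>z. J (op z (ginv x)) *\<^sub>R f z)" .
  have "integrable (distr lborel borel (\<lambda>w. op w x)) (\<lambda>z. J (op z (ginv x)) *\<^sub>R f z)"
    using * by (simp add: lborel_translations)
  then show "integrable lborel (\<lambda>w. J w *\<^sub>R f (op w x))"
    by (subst (asm) integrable_distr_eq) auto
qed

lemma C1_moll:
  fixes f :: "real^'n \<Rightarrow> real"
  assumes J: "C1_0 J" and f: "locally_integrable f"
  shows "C1 (moll J f)"
    and "(moll J f has_derivative (\<lambda>v. \<integral>z. frechet_derivative (\<lambda>t. J (op (fst t) (ginv (snd t)))) (at (z, x)) (0, v) * f z \<partial>lborel)) (at x)"
proof -
  have [measurable]: "J \<in> borel_measurable borel" "f \<in> borel_measurable borel"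
    using J f by (auto simp: C1_0_iff C1_measurable)
  have eq: "moll J f = (\<lambda>x. \<integral>z. J (op (fst (z, x)) (ginv (snd (z, x)))) * f z \<partial>lborel)"
    by (simp add: moll_eq fun_eq_iff)
  have C: "C1 (\<lambda>t. J (op (fst t) (ginv (snd t))))"
    using J by (intro C1_kernel) (simp add: C1_0_iff)
  have supp: "\<exists>Z. compact Z \<and> (\<forall>x\<in>B. \<forall>z. z \<notin> Z \<longrightarrow> J (op (fst (z, x)) (ginv (snd (z, x)))) = 0)" if "compact B" for B
    using translates_support[OF J that] by simp
  note K = C1_kernel_integral[OF f C supp]
  show "C1 (moll J f)"
    unfolding eq by (rule K(2))
  show "(moll J f has_derivative (\<lambda>v. \<integral>z. frechet_derivative (\<lambda>t. J (op (fst t) (ginv (snd t)))) (at (z, x)) (0, v) * f z \<partial>lborel)) (at x)"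
    unfolding eq by (rule K(1))
qed

text \<open>The mollification averages left translates, with which the left-invariant fields commute;
  on the kernel this says that the horizontal derivatives in the two variables are opposite.\<close>

lemma kernel_derivative:
  assumes J: "C1 J"
  shows "frechet_derivative (\<lambda>t. J (op (fst t) (ginv (snd t)))) (at (z, x)) (0, hfield op emb j x)
     = - frechet_derivative (\<lambda>z. J (op z (ginv x))) (at z) (hfield op emb j z)"
proof -
  define e where "e = axis (emb j) (1::real)"
  \<comment> \<open>Both sides are derivatives of this one function at 0. Moving x along the field
    inserts the inverse of \<open>t *\<^sub>R e\<close> at y, moving z inserts
    \<open>t *\<^sub>R e\<close> itself, and inversion has derivative -1 at 0.\<close>
  define E where "E y = J (op z (op y (ginv x)))" for y
  let ?K = "\<lambda>t. J (op (fst t) (ginv (snd t)))"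
  have CE: "C1 E"
    unfolding E_def by (rule C1_compose[OF J C1_op[OF C1_const C1_op_right]])
  let ?E = "frechet_derivative E (at 0)"
  have dE: "(E has_derivative ?E) (at 0)"
    by (rule C1_has_derivative[OF CE])
  have line: "((\<lambda>t. t *\<^sub>R e) has_derivative (\<lambda>t. t *\<^sub>R e)) (at (0::real))"
    by (rule bounded_linear_imp_has_derivative[OF bounded_linear_scaleR_left])
  have opline: "((\<lambda>t. op y (t *\<^sub>R e)) has_derivative (\<lambda>t. Dop y 0 0 (t *\<^sub>R e))) (at (0::real))" for y
    using has_derivative_compose[OF line] op_derivative_right[of y 0] by simp
  have 1: "((\<lambda>t. ?K (z, op x (t *\<^sub>R e))) has_derivative
      (\<lambda>t. frechet_derivative ?K (at (z, x)) (0, Dop x 0 0 (t *\<^sub>R e)))) (at (0::real))"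
    using has_derivative_compose[OF has_derivative_Pair[OF has_derivative_const opline], of ?K, of _ z x] C1_has_derivative[OF C1_kernel[OF J], of "(z, x)"]
    by simp
  have "((\<lambda>t. E (ginv (t *\<^sub>R e))) has_derivative (\<lambda>t. ?E (- (t *\<^sub>R e)))) (at (0::real))"
    using has_derivative_compose[OF has_derivative_compose[OF line], of ginv uminus E ?E] ginv_derivative_0 dE by simp
  moreover have "?K (z, op x (t *\<^sub>R e)) = E (ginv (t *\<^sub>R e))" for t
    by (simp add: E_def ginv_op)
  ultimately have "(\<lambda>t::real. frechet_derivative ?K (at (z, x)) (0, Dop x 0 0 (t *\<^sub>R e))) = (\<lambda>t. ?E (- (t *\<^sub>R e)))"
    using has_derivative_unique[OF 1] by simp
  from fun_cong[OF this, of 1] have a: "frechet_derivative ?K (at (z, x)) (0, hfield op emb j x) = ?E (- e)"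
    by (simp add: hfield_eq e_def)
  have "C1 (\<lambda>z. J (op z (ginv x)))"
    by (rule C1_compose[OF J C1_op_right])
  then have 2: "((\<lambda>t. J (op (op z (t *\<^sub>R e)) (ginv x))) has_derivative
      (\<lambda>t. frechet_derivative (\<lambda>z. J (op z (ginv x))) (at z) (Dop z 0 0 (t *\<^sub>R e)))) (at (0::real))"
    using has_derivative_compose[OF opline[of z], of "\<lambda>z. J (op z (ginv x))"] C1_has_derivative by force
  have "((\<lambda>t. E (t *\<^sub>R e)) has_derivative (\<lambda>t. ?E (t *\<^sub>R e))) (at (0::real))"
    using has_derivative_compose[OF line, of E ?E] dE by simp
  moreover have "J (op (op z (t *\<^sub>R e)) (ginv x)) = E (t *\<^sub>R e)" for t
    by (simp add: E_def assoc)
  ultimately have "(\<lambda>t::real. frechet_derivative (\<lambda>z. J (op z (ginv x))) (at z) (Dop z 0 0 (t *\<^sub>R e))) = (\<lambda>t. ?E (t *\<^sub>R e))"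
    using has_derivative_unique[OF 2] by simp
  from fun_cong[OF this, of 1] have b: "frechet_derivative (\<lambda>z. J (op z (ginv x))) (at z) (hfield op emb j z) = ?E e"
    by (simp add: hfield_eq e_def)
  show ?thesis
    using a b linear_neg[OF has_derivative_linear[OF dE]] by simp
qed

lemma C1_0_translate:
  assumes J: "C1_0 J" shows "C1_0 (\<lambda>z. J (op z (ginv x)))"
proof -
  obtain Z where Z: "compact Z" "\<And>z. z \<notin> Z \<Longrightarrow> J (op z (ginv x)) = 0"
    using translates_support[OF J, of "{x}"] by auto
  then have "{z. J (op z (ginv x)) \<noteq> 0} \<subseteq> Z"
    by auto
  then have "bounded {z. J (op z (ginv x)) \<noteq> 0}"
    using Z(1) compact_imp_bounded bounded_subset by blast
  then show ?thesis
    using C1_compose[OF _ C1_op_right, of J] J by (simp add: C1_0_iff compact_closure)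
qed

text \<open>The derivative in x falls on the kernel, \<open>kernel_derivative\<close> turns it into
  one in z, and the weak identity is applied with z to J(z x^(-1)) as test function.\<close>

lemma hgrad_moll:
  fixes g :: "real^'n \<Rightarrow> real^'l"
  assumes J: "C1_0 J" and f: "locally_integrable f" and g: "locally_integrable g"
    and weak: "\<And>\<phi> j. C1_0 \<phi> \<Longrightarrow>
        (\<integral>x. g x $ j * \<phi> x \<partial>lborel) = - (\<integral>x. f x * hgrad op emb \<phi> x $ j \<partial>lborel)"
  shows "hgrad op emb (moll J f) x = moll J g x"
proof (rule vec_eq_iff[THEN iffD2], rule allI)
  fix j
  have [measurable]: "J \<in> borel_measurable borel" "g \<in> borel_measurable borel"
    using J g by (auto simp: C1_0_iff C1_measurable)
  have CJ: "C1 J" using J by (simp add: C1_0_iff)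
  have "hgrad op emb (moll J f) x $ j =
      (\<integral>z. frechet_derivative (\<lambda>t. J (op (fst t) (ginv (snd t)))) (at (z, x)) (0, hfield op emb j x) * f z \<partial>lborel)"
    by (simp add: hgrad_eqI[OF C1_moll(2)[OF J f]])
  also have "\<dots> = - (\<integral>z. f z * hgrad op emb (\<lambda>z. J (op z (ginv x))) z $ j \<partial>lborel)"
    by (simp add: kernel_derivative[OF CJ] hgrad_def mult.commute)
  also have "\<dots> = (\<integral>z. g z $ j * J (op z (ginv x)) \<partial>lborel)"
    by (rule weak[OF C1_0_translate[OF J], symmetric])
  also have "\<dots> = (\<integral>z. (J (op z (ginv x)) *\<^sub>R g z) $ j \<partial>lborel)"
    by (simp add: mult.commute)
  also have "\<dots> = moll J g x $ j"
    by (simp only: moll_eq[OF \<open>J \<in> borel_measurable borel\<close> \<open>g \<in> borel_measurable borel\<close>]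
        integral_bounded_linear[OF bounded_linear_vec_nth integrable_moll(1)[OF J g]])
  finally show "hgrad op emb (moll J f) x $ j = moll J g x $ j" .
qed

text \<open>Approximate \<open>f\<close>, cut off to a compact set, by a continuous
  \<open>c\<close>. Left invariance makes the translated error as small as the original one, and the
  translates of \<open>c\<close> converge uniformly on K.\<close>

lemma translation_continuous_L1:
  fixes f :: "real^'n \<Rightarrow> 'b::{banach, second_countable_topology}"
  assumes f: "locally_integrable f" and K: "compact K" and e: "0 < (e::real)"
  shows "\<exists>\<delta>>0. \<forall>w. norm w < \<delta> \<longrightarrow> (\<integral>\<^sup>+x. norm (f (op w x) - f x) * indicator K x \<partial>lborel) \<le> e"
proof -
  \<comment> \<open>Large enough that wx stays in Z for x in K and |w| <= 1, so that cutting off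
    \<open>f\<close> outside Z is invisible in the integral.\<close>
  define Z where "Z = (\<lambda>z. op (fst z) (snd z)) ` (cball 0 1 \<times> K)"
  have Z: "compact Z"
    unfolding Z_def by (intro compact_continuous_image compact_Times C1_continuous_on[OF C1_op2] K) auto
  have ZI: "op w x \<in> Z" if "norm w \<le> 1" "x \<in> K" for w x
    unfolding Z_def using that by (intro image_eqI[of _ _ "(w, x)"]) auto
  define g where "g x = indicator Z x *\<^sub>R f x" for x
  have g: "integrable lborel g"
    using f Z unfolding locally_integrable_def set_integrable_def g_def by blast
  obtain c where c: "continuous_on UNIV c" "(\<integral>\<^sup>+x. norm (g x - c x) \<partial>lborel) < ennreal (e/4)"
    using continuous_L1_dense[OF g, of "e/4"] e by auto
  have [measurable]: "c \<in> borel_measurable borel" "g \<in> borel_measurable borel" "K \<in> sets borel" "f \<in> borel_measurable borel"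
    using c g K f by (auto intro: borel_measurable_continuous_onI simp: compact_imp_closed)
  have fin: "emeasure lborel K < \<infinity>"
    by (intro emeasure_bounded_finite compact_imp_bounded K)
  define m where "m = measure lborel K"
  have m: "emeasure lborel K = ennreal m" "0 \<le> m"
    using fin by (auto simp: m_def emeasure_eq_ennreal_measure)
  define e' where "e' = e / (4 * (m + 1))"
  have e': "0 < e'" "e' * m \<le> e/4"
    using e m(2) by (auto simp: e'_def field_simps)
  have "uniformly_continuous_on (cball 0 1 \<times> K) (\<lambda>z. c (op (fst z) (snd z)))"
    by (intro compact_uniformly_continuous compact_Times K compact_cball
        continuous_on_compose2[OF c(1)] C1_continuous_on[OF C1_op2]) auto
  then obtain d where d: "0 < d" and ud: "\<And>s t. s \<in> cball 0 1 \<times> K \<Longrightarrow> t \<in> cball 0 1 \<times> K \<Longrightarrow> dist t s < d \<Longrightarrow>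
      dist (c (op (fst t) (snd t))) (c (op (fst s) (snd s))) < e'"
    unfolding uniformly_continuous_on_def using e'(1) by blast
  show ?thesis
  proof (intro exI[of _ "min d 1"] conjI allI impI)
    show "0 < min d 1" using d by simp
    fix w :: "real^'n" assume w: "norm w < min d 1"
    have fg: "norm (f (op w x) - f x) = norm (g (op w x) - g x)" if "x \<in> K" for x
      using ZI[of w x] ZI[of 0 x] w that by (simp add: g_def)
    have near: "norm (c (op w x) - c x) \<le> e'" if "x \<in> K" for x
      using ud[of "(0, x)" "(w, x)"] w that by (auto simp: dist_Pair_Pair dist_norm)
    have tri: "norm (g (op w x) - g x) \<le> norm (g (op w x) - c (op w x)) + norm (c (op w x) - c x) + norm (g x - c x)" for x
      by (smt (verit) norm_minus_commute norm_triangle_sub diff_add_cancel norm_triangle_ineq add_diff_eq diff_diff_eq2)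
    have "ennreal (norm (f (op w x) - f x) * indicator K x) \<le>
        ennreal (norm (g (op w x) - c (op w x))) + ennreal e' * indicator K x + ennreal (norm (g x - c x))" for x
    proof (cases "x \<in> K")
      case True
      have "norm (f (op w x) - f x) \<le> norm (g (op w x) - c (op w x)) + e' + norm (g x - c x)"
        using fg[OF True] near[OF True] tri[of x] by simp
      then show ?thesis
        using True e'(1) by (simp add: ennreal_plus[symmetric] ennreal_leI del: ennreal_plus)
    qed simp
    then have "(\<integral>\<^sup>+x. norm (f (op w x) - f x) * indicator K x \<partial>lborel) \<le>
      (\<integral>\<^sup>+x. ennreal (norm (g (op w x) - c (op w x))) + ennreal e' * indicator K x + ennreal (norm (g x - c x)) \<partial>lborel)"
      by (intro nn_integral_mono)
    also have "\<dots> = (\<integral>\<^sup>+x. ennreal (norm (g (op w x) - c (op w x))) \<partial>lborel) + ennreal e' * emeasure lborel K + (\<integral>\<^sup>+x. norm (g x - c x) \<partial>lborel)"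
      by (simp add: nn_integral_add nn_integral_cmult)
    also have "(\<integral>\<^sup>+x. ennreal (norm (g (op w x) - c (op w x))) \<partial>lborel) = (\<integral>\<^sup>+x. norm (g x - c x) \<partial>lborel)"
      by (rule nn_integral_left) simp
    also have "\<dots> + ennreal e' * emeasure lborel K + \<dots> \<le> ennreal (e/4) + ennreal (e/4) + ennreal (e/4)"
    proof (intro add_mono)
      show "ennreal e' * emeasure lborel K \<le> ennreal (e/4)"
        using e' m by (simp add: ennreal_mult'[symmetric] ennreal_leI)
    qed (use c(2) in auto)
    also have "\<dots> \<le> ennreal e"
      using e by (simp add: ennreal_plus[symmetric] ennreal_leI del: ennreal_plus)
    finally show "(\<integral>\<^sup>+x. norm (f (op w x) - f x) * indicator K x \<partial>lborel) \<le> e" .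
  qed
qed

text \<open>Minkowski's inequality by Fubini: the L1 error of the average is at most the average of
  the L1 errors of the translates, and \<open>J\<close> has total mass 1.\<close>

lemma moll_L1:
  fixes f :: "real^'n \<Rightarrow> 'b::{banach, second_countable_topology}"
  assumes f: "locally_integrable f" and K: "compact K" and e: "0 < (e::real)"
  shows "\<exists>\<delta>>0. \<forall>J. mollifier \<delta> J \<longrightarrow> (\<integral>\<^sup>+x. norm (moll J f x - f x) * indicator K x \<partial>lborel) \<le> e"
proof -
  obtain \<delta> where \<delta>: "0 < \<delta>" "\<And>w. norm w < \<delta> \<Longrightarrow> (\<integral>\<^sup>+x. norm (f (op w x) - f x) * indicator K x \<partial>lborel) \<le> e"
    using translation_continuous_L1[OF assms] by blast
  show ?thesis
  proof (intro exI[of _ \<delta>] conjI allI impI \<delta>(1))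
    fix J :: "real^'n \<Rightarrow> real" assume J: "mollifier \<delta> J"
    then have J0: "C1_0 J" "\<And>w. 0 \<le> J w" "(\<integral>w. J w \<partial>lborel) = 1" "\<And>w. J w \<noteq> 0 \<Longrightarrow> norm w < \<delta>"
      by (auto simp: mollifier_def)
    have [measurable]: "J \<in> borel_measurable borel" "f \<in> borel_measurable borel" "K \<in> sets borel"
      using J0 f K by (auto simp: C1_0_iff C1_measurable compact_imp_closed)
    have iJ: "integrable lborel J"
      by (rule C1_0_integrable[OF J0(1)])
    have pt: "ennreal (norm (moll J f x - f x)) \<le> (\<integral>\<^sup>+w. J w * norm (f (op w x) - f x) \<partial>lborel)" for x
    proof -
      have "moll J f x - f x = (\<integral>w. J w *\<^sub>R f (op w x) \<partial>lborel) - (\<integral>w. J w *\<^sub>R f x \<partial>lborel)"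
        using iJ by (simp add: moll_def J0(3))
      also have "\<dots> = (\<integral>w. J w *\<^sub>R (f (op w x) - f x) \<partial>lborel)"
        using integrable_moll(2)[OF J0(1) f] iJ by (simp add: scaleR_diff_right)
      finally have "ennreal (norm (moll J f x - f x)) \<le> (\<integral>\<^sup>+w. norm (J w *\<^sub>R (f (op w x) - f x)) \<partial>lborel)"
        using integral_norm_bound_ennreal[of lborel "\<lambda>w. J w *\<^sub>R (f (op w x) - f x)"]
          integrable_moll(2)[OF J0(1) f] iJ by (simp add: scaleR_diff_right)
      then show ?thesis
        using J0(2) by simp
    qed
    have "(\<integral>\<^sup>+x. norm (moll J f x - f x) * indicator K x \<partial>lborel)
      \<le> (\<integral>\<^sup>+x. (\<integral>\<^sup>+w. J w * norm (f (op w x) - f x) * indicator K x \<partial>lborel) \<partial>lborel)"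
    proof (intro nn_integral_mono)
      show "ennreal (norm (moll J f x - f x) * indicator K x) \<le> (\<integral>\<^sup>+w. J w * norm (f (op w x) - f x) * indicator K x \<partial>lborel)" for x
        using pt[of x] by (cases "x \<in> K") auto
    qed
    also have "\<dots> = (\<integral>\<^sup>+w. (\<integral>\<^sup>+x. J w * norm (f (op w x) - f x) * indicator K x \<partial>lborel) \<partial>lborel)"
      by (rule lborel_pair.Fubini') measurable
    also have "\<dots> \<le> (\<integral>\<^sup>+w. ennreal (J w) * e \<partial>lborel)"
    proof (intro nn_integral_mono)
      fix w
      have "(\<integral>\<^sup>+x. J w * norm (f (op w x) - f x) * indicator K x \<partial>lborel) =
          ennreal (J w) * (\<integral>\<^sup>+x. norm (f (op w x) - f x) * indicator K x \<partial>lborel)"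
        using J0(2) by (subst nn_integral_cmult[symmetric]) (auto simp: ennreal_mult' mult.assoc)
      also have "\<dots> \<le> ennreal (J w) * e"
        using \<delta>(2)[of w] J0(4)[of w] by (cases "J w = 0") (auto intro: mult_left_mono)
      finally show "(\<integral>\<^sup>+x. J w * norm (f (op w x) - f x) * indicator K x \<partial>lborel) \<le> ennreal (J w) * e" .
    qed
    also have "\<dots> = (\<integral>\<^sup>+w. J w \<partial>lborel) * e"
      by (rule nn_integral_multc) simp
    also have "(\<integral>\<^sup>+w. J w \<partial>lborel) = 1"
      using iJ J0 by (simp add: nn_integral_eq_integral)
    finally show "(\<integral>\<^sup>+x. norm (moll J f x - f x) * indicator K x \<partial>lborel) \<le> e"
      by simp
  qed
qed

end

section \<open>Composite test functions\<close>

text \<open>Dominated convergence with a varying majorant. Clipping \<open>f n\<close> to the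
  interval from -B to B brings it under the usual theorem, and what is cut away is at most
  \<open>w n\<close>, whose integral tends to 0.\<close>

lemma integral_tendsto_dominated_L1:
  fixes f :: "nat \<Rightarrow> 'a \<Rightarrow> real"
  assumes [measurable]: "\<And>n. f n \<in> borel_measurable M" "g \<in> borel_measurable M"
    and B: "integrable M B" and w_nonneg: "\<And>n x. 0 \<le> w n x" and w: "\<And>n. integrable M (w n)" "(\<lambda>n. \<integral>x. w n x \<partial>M) \<longlonglongrightarrow> 0"
    and w0: "AE x in M. (\<lambda>n. w n x) \<longlonglongrightarrow> 0"
    and lim: "AE x in M. (\<lambda>n. f n x) \<longlonglongrightarrow> g x"
    and bound: "\<And>n. AE x in M. \<bar>f n x\<bar> \<le> B x + w n x"
  shows "(\<lambda>n. \<integral>x. f n x \<partial>M) \<longlonglongrightarrow> (\<integral>x. g x \<partial>M)"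
proof -
  define c where "c n x = max (- B x) (min (B x) (f n x))" for n x
  have [measurable]: "B \<in> borel_measurable M" using B by auto
  have [measurable]: "c n \<in> borel_measurable M" for n unfolding c_def by measurable
  have wp: "AE x in M. \<forall>n. \<bar>f n x\<bar> \<le> B x + w n x"
    using bound by (simp add: AE_all_countable)
  have gB: "AE x in M. \<bar>g x\<bar> \<le> B x"
    using wp w0 lim
  proof eventually_elim
    case (elim x)
    have "(\<lambda>n. B x + w n x) \<longlonglongrightarrow> B x + 0"
      by (intro tendsto_intros elim)
    moreover have "(\<lambda>n. \<bar>f n x\<bar>) \<longlonglongrightarrow> \<bar>g x\<bar>"
      by (intro tendsto_intros elim)
    ultimately show ?case
      using elim LIMSEQ_le[of "\<lambda>n. \<bar>f n x\<bar>" "\<bar>g x\<bar>"] by fastforce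
  qed
  have 1: "(\<lambda>n. \<integral>x. c n x \<partial>M) \<longlonglongrightarrow> (\<integral>x. g x \<partial>M)"
  proof (rule integral_dominated_convergence[where w="B"])
    show "AE x in M. (\<lambda>n. c n x) \<longlonglongrightarrow> g x"
      using lim gB
    proof eventually_elim
      case (elim x)
      have "(\<lambda>n. c n x) \<longlonglongrightarrow> max (- B x) (min (B x) (g x))"
        unfolding c_def by (intro tendsto_intros elim)
      then show ?case using elim(2) by (simp add: min_def max_def abs_le_iff split: if_splits)
    qed
    show "AE x in M. norm (c n x) \<le> B x" for n
      using gB by eventually_elim (auto simp: c_def)
  qed (use B in \<open>auto simp: c_def\<close>)
  have f: "integrable M (f n)" for n
    by (rule Bochner_Integration.integrable_bound[OF Bochner_Integration.integrable_add[OF B w(1)[of n]]])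
      (use bound[of n] in auto)
  have c: "integrable M (c n)" for n
    by (rule Bochner_Integration.integrable_bound[OF B]) (use gB in \<open>auto simp: c_def\<close>)
  have fw: "\<bar>(\<integral>x. f n x \<partial>M) - (\<integral>x. c n x \<partial>M)\<bar> \<le> (\<integral>x. w n x \<partial>M)" for n
  proof -
    have "\<bar>(\<integral>x. f n x \<partial>M) - (\<integral>x. c n x \<partial>M)\<bar> = \<bar>\<integral>x. f n x - c n x \<partial>M\<bar>"
      using f c by simp
    also have "\<dots> \<le> (\<integral>x. \<bar>f n x - c n x\<bar> \<partial>M)"
      by (rule integral_abs_bound)
    also have "\<dots> \<le> (\<integral>x. w n x \<partial>M)"
    proof (rule integral_mono_AE)
      show "AE x in M. \<bar>f n x - c n x\<bar> \<le> w n x"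
        using bound[of n] gB by eventually_elim (use w_nonneg in \<open>auto simp: c_def max_def min_def abs_le_iff\<close>)
    qed (use f c w in auto)
    finally show ?thesis .
  qed
  have "(\<lambda>n. (\<integral>x. f n x \<partial>M) - (\<integral>x. c n x \<partial>M)) \<longlonglongrightarrow> 0"
    by (rule Lim_null_comparison[OF _ w(2)]) (use fw in simp)
  from tendsto_add[OF this 1] show ?thesis by simp
qed

lemma lebesgue_ex_borel_vec:
  fixes f :: "real^'n \<Rightarrow> real^'m"
  assumes "f \<in> borel_measurable lebesgue"
  shows "\<exists>g \<in> borel_measurable borel. AE x in lborel. f x = g x"
proof -
  have "\<forall>i. \<exists>g\<in>borel_measurable lborel. AE x in lborel. f x $ i = g x"
    by (intro allI completion_ex_borel_measurable_real measurable_compose[OF assms]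
        borel_measurable_continuous_onI continuous_intros)
  then obtain g where g: "\<And>i. g i \<in> borel_measurable lborel" "\<And>i. AE x in lborel. f x $ i = g i x"
    by metis
  have "AE x in lborel. \<forall>i. f x $ i = g i x"
    using g(2) by (simp add: AE_all_countable)
  then have "AE x in lborel. f x = (\<chi> i. g i x)"
    by eventually_elim (simp add: vec_eq_iff)
  moreover have "(\<lambda>x. \<chi> i. g i x) \<in> borel_measurable borel"
  proof (rule borel_measurable_euclidean_space[THEN iffD2], rule ballI)
    fix b :: "real^'m" assume "b \<in> Basis"
    then obtain k where b: "b = axis k 1"
      by (auto simp: Basis_vec_def)
    show "(\<lambda>x. (\<chi> i. g i x) \<bullet> b) \<in> borel_measurable borel"
      using g(1)[of k] by (simp add: b inner_axis)
  qed
  ultimately show ?thesis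
    by (intro bexI[of _ "\<lambda>x. \<chi> i. g i x"])
qed

lemma powr_le_1_plus:
  fixes a :: real assumes "0 \<le> a" "r \<le> s" "0 \<le> r" shows "a powr r \<le> 1 + a powr s"
proof (cases "a \<le> 1")
  case True
  then have "a powr r \<le> 1" using assms by (simp add: powr_le1)
  then show ?thesis by (simp add: add_increasing2)
next
  case False
  then have "a powr r \<le> a powr s" using assms by (intro powr_mono) auto
  then show ?thesis by simp
qed

lemma le_1_plus_powr:
  fixes a :: real assumes "0 \<le> a" "1 \<le> s" shows "a \<le> 1 + a powr s"
  using powr_le_1_plus[of a 1 s] assms by (cases "a = 0") auto

lemma locally_integrable_bound:
  fixes f :: "real^'n \<Rightarrow> 'b::{banach, second_countable_topology}" and g :: "real^'n \<Rightarrow> 'c::{banach, second_countable_topology}"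
  assumes f: "f \<in> borel_measurable borel" and g: "locally_integrable g"
    and le: "\<And>x. norm (f x) \<le> 1 + norm (g x)"
  shows "locally_integrable f"
  unfolding locally_integrable_def set_integrable_def
proof (intro conjI allI impI f)
  fix K :: "(real^'n) set" assume K: "compact K"
  have [measurable]: "K \<in> sets borel" "f \<in> borel_measurable borel"
    using K f by (auto simp: compact_imp_closed)
  have "integrable lborel (\<lambda>x. indicator K x *\<^sub>R (1::real))"
    by (rule borel_integrable_compact[OF K continuous_on_const])
  moreover have "integrable lborel (\<lambda>x. norm (indicator K x *\<^sub>R g x))"
    by (rule integrable_norm) (use g K in \<open>simp add: locally_integrable_def set_integrable_def\<close>)
  ultimately have i: "integrable lborel (\<lambda>x. indicator K x *\<^sub>R (1::real) + norm (indicator K x *\<^sub>R g x))"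
    by (rule Bochner_Integration.integrable_add)
  show "integrable lborel (\<lambda>x. indicator K x *\<^sub>R f x)"
    by (rule Bochner_Integration.integrable_bound[OF i]) (use le in \<open>auto simp: indicator_def\<close>)
qed

lemma C1_0_zero_outside: "x \<notin> closure {x. \<eta> x \<noteq> 0} \<Longrightarrow> \<eta> x = (0::real)"
  using closure_subset[of "{x. \<eta> x \<noteq> 0}"] by auto

context carnot
begin

lemma hgrad_zero_outside:
  assumes "x \<notin> closure {x. \<eta> x \<noteq> 0}" shows "hgrad op emb \<eta> x = 0"
proof -
  have "(\<eta> has_derivative (\<lambda>_. 0)) (at x)"
  proof (rule has_derivative_transform_within_open[OF has_derivative_const[of 0]])
    show "open (- closure {x. \<eta> x \<noteq> 0})" "x \<in> - closure {x. \<eta> x \<noteq> 0}"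
      using assms by (simp_all add: open_Compl)
    show "0 = \<eta> y" if "y \<in> - closure {x. \<eta> x \<noteq> 0}" for y
      using C1_0_zero_outside[of y \<eta>] that by (metis ComplD)
  qed
  from hgrad_eqI[OF this] show ?thesis by (simp add: vec_eq_iff)
qed

text \<open>An inequality with constant \<open>a\<close> and \<open>b\<close> survives averaging
  against a probability density. It is applied with the point x of the flux frozen, so that |h x|
  and H x are constants while \<open>Dv\<close> is averaged.\<close>

lemma norm_moll_le:
  fixes f :: "real^'n \<Rightarrow> 'b::{banach, second_countable_topology}"
  assumes J: "mollifier \<delta> J" and f: "locally_integrable f"
    and g: "locally_integrable g" and le: "\<And>y. a * norm (f y) \<le> b + g y" and a: "0 \<le> a"
  shows "a * norm (moll J f x) \<le> b + moll J g x"
proof -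
  have J0: "C1_0 J" "\<And>w. 0 \<le> J w" "(\<integral>w. J w \<partial>lborel) = 1" and iJ: "integrable lborel J"
    using J C1_0_integrable by (auto simp: mollifier_def)
  have if': "integrable lborel (\<lambda>w. norm (J w *\<^sub>R f (op w x)))"
    using integrable_moll(2)[OF J0(1) f] by (rule integrable_norm)
  have ig: "integrable lborel (\<lambda>w. J w * g (op w x))"
    using integrable_moll(2)[OF J0(1) g] by simp
  have "a * norm (moll J f x) \<le> a * (\<integral>w. norm (J w *\<^sub>R f (op w x)) \<partial>lborel)"
    unfolding moll_def by (intro mult_left_mono a integral_norm_bound)
  also have "\<dots> = (\<integral>w. a * norm (J w *\<^sub>R f (op w x)) \<partial>lborel)"
    by simp
  also have "\<dots> \<le> (\<integral>w. J w * b + J w * g (op w x) \<partial>lborel)"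
  proof (rule integral_mono)
    show "a * norm (J w *\<^sub>R f (op w x)) \<le> J w * b + J w * g (op w x)" for w
      using mult_left_mono[OF le[of "op w x"] J0(2)[of w]] J0(2)[of w] by (simp add: algebra_simps)
  qed (use if' ig iJ in auto)
  also have "\<dots> = b + moll J g x"
    using ig iJ J0(3) by (simp add: moll_def)
  finally show ?thesis .
qed

lemma ex_mollifier_sequence:
  fixes f :: "real^'n \<Rightarrow> 'b::{banach, second_countable_topology}" and g :: "real^'n \<Rightarrow> 'c::{banach, second_countable_topology}"
    and k :: "real^'n \<Rightarrow> 'd::{banach, second_countable_topology}"
  assumes f: "locally_integrable f" and g: "locally_integrable g" and k: "locally_integrable k" and K: "compact K"
  obtains J where "\<And>n. C1_0 (J n)" "\<And>n w. 0 \<le> J n w" "\<And>n. \<exists>\<delta>. mollifier \<delta> (J n)"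
    "\<And>n. integrable lborel (\<lambda>x. indicator K x * norm (moll (J n) f x - f x))"
    "\<And>n. integrable lborel (\<lambda>x. indicator K x * norm (moll (J n) k x - k x))"
    "(\<lambda>n. \<integral>x. indicator K x * norm (moll (J n) k x - k x) \<partial>lborel) \<longlonglongrightarrow> 0"
    "AE x in lborel. x \<in> K \<longrightarrow> (\<lambda>n. moll (J n) f x) \<longlonglongrightarrow> f x"
    "AE x in lborel. x \<in> K \<longrightarrow> (\<lambda>n. moll (J n) g x) \<longlonglongrightarrow> g x"
    "AE x in lborel. x \<in> K \<longrightarrow> (\<lambda>n. moll (J n) k x) \<longlonglongrightarrow> k x"
proof -
  have [measurable]: "K \<in> sets borel" "f \<in> borel_measurable borel" "g \<in> borel_measurable borel" "k \<in> borel_measurable borel"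
    using K f g k by (auto simp: compact_imp_closed)
  have "\<exists>J. (\<exists>\<delta>. mollifier \<delta> J) \<and> (\<integral>\<^sup>+x. norm (moll J f x - f x) * indicator K x \<partial>lborel) \<le> ennreal (1 / Suc n)
    \<and> (\<integral>\<^sup>+x. norm (moll J g x - g x) * indicator K x \<partial>lborel) \<le> ennreal (1 / Suc n)
    \<and> (\<integral>\<^sup>+x. norm (moll J k x - k x) * indicator K x \<partial>lborel) \<le> ennreal (1 / Suc n)" for n
  proof -
    have e: "0 < 1 / real (Suc n)" by simp
    obtain a where a: "0 < a" "\<And>J. mollifier a J \<Longrightarrow> (\<integral>\<^sup>+x. norm (moll J f x - f x) * indicator K x \<partial>lborel) \<le> ennreal (1 / Suc n)"
      using moll_L1[OF f K e] by (elim exE conjE) (rule that, assumption, elim allE, erule mp)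
    obtain b where b: "0 < b" "\<And>J. mollifier b J \<Longrightarrow> (\<integral>\<^sup>+x. norm (moll J g x - g x) * indicator K x \<partial>lborel) \<le> ennreal (1 / Suc n)"
      using moll_L1[OF g K e] by (elim exE conjE) (rule that, assumption, elim allE, erule mp)
    obtain c where c: "0 < c" "\<And>J. mollifier c J \<Longrightarrow> (\<integral>\<^sup>+x. norm (moll J k x - k x) * indicator K x \<partial>lborel) \<le> ennreal (1 / Suc n)"
      using moll_L1[OF k K e] by (elim exE conjE) (rule that, assumption, elim allE, erule mp)
    define d where "d = min a (min b c)"
    obtain J :: "real^'n \<Rightarrow> real" where J: "mollifier d J"
      using ex_mollifier[of d] a b c by (auto simp: d_def)
    then have "mollifier a J" "mollifier b J" "mollifier c J"
      by (auto simp: mollifier_def d_def)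
    then show ?thesis
      using J a b c by blast
  qed
  then have "\<exists>J. \<forall>n. (\<exists>\<delta>. mollifier \<delta> (J n)) \<and> (\<integral>\<^sup>+x. norm (moll (J n) f x - f x) * indicator K x \<partial>lborel) \<le> ennreal (1 / Suc n)
    \<and> (\<integral>\<^sup>+x. norm (moll (J n) g x - g x) * indicator K x \<partial>lborel) \<le> ennreal (1 / Suc n)
    \<and> (\<integral>\<^sup>+x. norm (moll (J n) k x - k x) * indicator K x \<partial>lborel) \<le> ennreal (1 / Suc n)"
    by (intro choice allI)
  then obtain J where J: "\<And>n. \<exists>\<delta>. mollifier \<delta> (J n)"
    and Jf: "\<And>n. (\<integral>\<^sup>+x. norm (moll (J n) f x - f x) * indicator K x \<partial>lborel) \<le> ennreal (1 / Suc n)"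
    and Jg: "\<And>n. (\<integral>\<^sup>+x. norm (moll (J n) g x - g x) * indicator K x \<partial>lborel) \<le> ennreal (1 / Suc n)"
    and Jk: "\<And>n. (\<integral>\<^sup>+x. norm (moll (J n) k x - k x) * indicator K x \<partial>lborel) \<le> ennreal (1 / Suc n)"
    by (elim exE) (rule that, (erule allE, elim conjE, assumption)+)
  have J0: "C1_0 (J n)" "0 \<le> J n w" for n w
    using J[of n] by (auto simp: mollifier_def)
  have [measurable]: "J n \<in> borel_measurable borel" for n
    using J0(1)[of n] by (simp add: C1_0_iff C1_measurable)
  have moll_meas: "moll (J n) u \<in> borel_measurable borel" if [measurable]: "u \<in> borel_measurable borel"
    for n and u :: "real^'n \<Rightarrow> 'z::{banach, second_countable_topology}"
    unfolding moll_def by measurable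
  have int: "integrable lborel (\<lambda>x. indicator K x * norm (moll (J n) u x - u x))"
    and le: "(\<integral>x. indicator K x * norm (moll (J n) u x - u x) \<partial>lborel) \<le> 1 / Suc n"
    if u: "u \<in> borel_measurable borel"
      and b: "(\<integral>\<^sup>+x. norm (moll (J n) u x - u x) * indicator K x \<partial>lborel) \<le> ennreal (1 / Suc n)"
    for n and u :: "real^'n \<Rightarrow> 'z::{banach, second_countable_topology}"
  proof -
    have [measurable]: "u \<in> borel_measurable borel" "moll (J n) u \<in> borel_measurable borel"
      using u moll_meas by auto
    have b': "(\<integral>\<^sup>+x. ennreal (indicator K x * norm (moll (J n) u x - u x)) \<partial>lborel) \<le> ennreal (1 / Suc n)"
      using b by (simp add: mult.commute)
    show *: "integrable lborel (\<lambda>x. indicator K x * norm (moll (J n) u x - u x))"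
      by (rule integrableI_bounded) (use b' in \<open>auto intro: le_less_trans\<close>)
    then have "ennreal (\<integral>x. indicator K x * norm (moll (J n) u x - u x) \<partial>lborel) \<le> ennreal (1 / Suc n)"
      using b' by (subst (asm) nn_integral_eq_integral) auto
    then show "(\<integral>x. indicator K x * norm (moll (J n) u x - u x) \<partial>lborel) \<le> 1 / Suc n"
      by (subst (asm) ennreal_le_iff) auto
  qed
  note kf = int[OF _ Jf] le[OF _ Jf] and kg = int[OF _ Jg] le[OF _ Jg] and kk = int[OF _ Jk] le[OF _ Jk]
  \<comment> \<open>The sum of the three errors tends to 0 in L1, so one subsequence converges a.e.
    for all three functions at once.\<close>
  define E where "E n x = indicator K x * norm (moll (J n) f x - f x)
      + (indicator K x * norm (moll (J n) g x - g x) + indicator K x * norm (moll (J n) k x - k x))" for n x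
  have E0: "0 \<le> E n x" for n x
    by (simp add: E_def)
  have iE: "integrable lborel (E n)" for n
    unfolding E_def by (intro Bochner_Integration.integrable_add kf kg kk) auto
  have E: "(\<integral>x. norm (E n x) \<partial>lborel) \<le> 3 * (1 / Suc n)" for n
    using kf[of n] kg[of n] kk[of n] by (simp add: E0 E_def[of n])
  have z: "(\<lambda>n. c * (1 / real (Suc n))) \<longlonglongrightarrow> 0" for c :: real
    using tendsto_mult[OF tendsto_const lim_inverse_n', of c] LIMSEQ_Suc by fastforce
  have "(\<lambda>n. \<integral>x. norm (E n x) \<partial>lborel) \<longlonglongrightarrow> 0"
    by (rule Lim_null_comparison[OF _ z[of 3]]) (use E in \<open>simp add: E0 integral_nonneg_AE\<close>)
  from tendsto_L1_AE_subseq[OF iE this]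
  obtain r where r: "strict_mono r" "AE x in lborel. (\<lambda>n. E (r n) x) \<longlonglongrightarrow> 0"
    by blast
  have ae: "AE x in lborel. x \<in> K \<longrightarrow> (\<lambda>n. moll (J (r n)) u x) \<longlonglongrightarrow> u x"
    if "\<And>n x. indicator K x * norm (moll (J n) u x - u x) \<le> E n x"
    for u :: "real^'n \<Rightarrow> 'z::{banach, second_countable_topology}"
    using r(2)
  proof eventually_elim
    case (elim x)
    show ?case
    proof
      assume x: "x \<in> K"
      have "(\<lambda>n. moll (J (r n)) u x - u x) \<longlonglongrightarrow> 0"
        by (rule Lim_null_comparison[OF _ elim]) (use that[of x] x in simp)
      then show "(\<lambda>n. moll (J (r n)) u x) \<longlonglongrightarrow> u x"
        by (rule LIM_zero_cancel)
    qed
  qed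
  show thesis
  proof (rule that[of "\<lambda>n. J (r n)"])
    have "(\<lambda>n. \<integral>x. indicator K x * norm (moll (J n) k x - k x) \<partial>lborel) \<longlonglongrightarrow> 0"
      by (rule Lim_null_comparison[OF _ z[of 1]]) (use kk in \<open>simp add: integral_nonneg_AE\<close>)
    from LIMSEQ_subseq_LIMSEQ[OF this r(1)]
    show "(\<lambda>n. \<integral>x. indicator K x * norm (moll (J (r n)) k x - k x) \<partial>lborel) \<longlonglongrightarrow> 0"
      by (simp add: o_def)
  qed (use J J0 kf kk in \<open>auto intro!: ae simp: E_def\<close>)
qed

text \<open>For v only of Sobolev class \<gamma>(v) \<eta> is no admissible test function, so
  \<gamma>(V n) \<eta> is used with mollified \<open>V n\<close>. Young's inequality bounds |h|
  |moll Dv| by H + moll G with G = |Dv|^p, and moll G tends to G in L1 on the support; this is the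
  situation of \<open>integral_tendsto_dominated_L1\<close>.\<close>

lemma test_composition_borel:
  fixes v :: "real^'n \<Rightarrow> real" and Dv h :: "real^'n \<Rightarrow> real^'l" and p :: real
  assumes p: "1 < p"
    and v: "locally_integrable v" and v0: "\<And>x. 0 \<le> v x" and Dv: "locally_integrable Dv"
    and Dvp: "locally_integrable (\<lambda>x. norm (Dv x) powr p)"
    and h: "h \<in> borel_measurable borel" and hp: "locally_integrable (\<lambda>x. norm (h x) powr (p / (p - 1)))"
    and weak: "\<And>\<phi> j. C1_0 \<phi> \<Longrightarrow>
        (\<integral>x. Dv x $ j * \<phi> x \<partial>lborel) = - (\<integral>x. v x * hgrad op emb \<phi> x $ j \<partial>lborel)"
    and sub: "\<And>\<phi>. C1_0 \<phi> \<Longrightarrow> (\<And>x. 0 \<le> \<phi> x) \<Longrightarrow> (\<integral>x. h x \<bullet> hgrad op emb \<phi> x \<partial>lborel) \<le> 0"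
    and \<gamma>: "\<And>t. 0 \<le> t \<Longrightarrow> (\<gamma> has_real_derivative \<gamma>' t) (at t)" "continuous_on {0..} \<gamma>'"
      "\<And>t. 0 \<le> t \<Longrightarrow> 0 \<le> \<gamma> t \<and> \<gamma> t \<le> C" "\<And>t. 0 \<le> t \<Longrightarrow> 0 \<le> \<gamma>' t \<and> \<gamma>' t \<le> C"
    and \<eta>: "C1_0 \<eta>" "\<And>x. 0 \<le> \<eta> x"
  shows "integrable lborel (\<lambda>x. \<gamma>' (v x) * (h x \<bullet> Dv x) * \<eta> x)"
    "integrable lborel (\<lambda>x. \<gamma> (v x) * (h x \<bullet> hgrad op emb \<eta> x))"
    "(\<integral>x. \<gamma>' (v x) * (h x \<bullet> Dv x) * \<eta> x \<partial>lborel) \<le> - (\<integral>x. \<gamma> (v x) * (h x \<bullet> hgrad op emb \<eta> x) \<partial>lborel)"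
proof -
  define K where "K = closure {x. \<eta> x \<noteq> 0}"
  have C1\<eta>: "C1 \<eta>" and K: "compact K"
    using \<eta>(1) by (auto simp: C1_0_iff K_def)
  define q where "q = p / (p - 1)"
  have q: "1 < q" "1 / p + 1 / q = 1"
    using p by (auto simp: q_def field_simps)
  have outside: "\<eta> x = 0" "hgrad op emb \<eta> x = 0" if "x \<notin> K" for x
    using that C1_0_zero_outside[of x \<eta>] hgrad_zero_outside[of x \<eta>] by (simp_all add: K_def)
  have [measurable]: "K \<in> sets borel" "h \<in> borel_measurable borel" "v \<in> borel_measurable borel" "Dv \<in> borel_measurable borel"
    "\<eta> \<in> borel_measurable borel"
    using K h v Dv by (auto simp: compact_imp_closed C1_measurable[OF C1\<eta>])
  have [measurable]: "hgrad op emb \<eta> \<in> borel_measurable borel"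
    by (intro borel_measurable_continuous_onI hgrad_continuous C1\<eta>)
  have c\<gamma>: "continuous_on {0..} \<gamma>"
    using \<gamma>(1) by (meson DERIV_continuous atLeast_iff continuous_at_imp_continuous_on)
  have comp_meas: "(\<lambda>x. \<phi> (u x)) \<in> borel_measurable borel"
    if "continuous_on {0..} \<phi>" "\<And>x. 0 \<le> u x" "u \<in> borel_measurable borel" for \<phi> :: "real \<Rightarrow> real" and u :: "real^'n \<Rightarrow> real"
  proof -
    have "\<phi> \<in> borel_measurable (restrict_space borel {0..})"
      by (rule borel_measurable_continuous_on_restrict[OF that(1)])
    moreover have "u \<in> measurable borel (restrict_space borel {0..})"
      using that by (intro measurable_restrict_space2) auto
    ultimately show ?thesis by (rule measurable_compose[rotated])
  qed
  have [measurable]: "(\<lambda>x. \<gamma> (v x)) \<in> borel_measurable borel" "(\<lambda>x. \<gamma>' (v x)) \<in> borel_measurable borel"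
    using comp_meas[OF c\<gamma> v0] comp_meas[OF \<gamma>(2) v0] by auto
  obtain M where M: "\<And>x. \<eta> x \<le> M" "\<And>x. norm (hgrad op emb \<eta> x) \<le> M"
  proof -
    have "bounded (\<eta> ` K)" "bounded (hgrad op emb \<eta> ` K)"
      by (intro compact_imp_bounded compact_continuous_image K C1_continuous_on[OF C1\<eta>] hgrad_continuous[OF C1\<eta>])+
    then obtain a b where ab: "\<And>x. x \<in> K \<Longrightarrow> norm (\<eta> x) \<le> a" "\<And>x. x \<in> K \<Longrightarrow> norm (hgrad op emb \<eta> x) \<le> b"
      by (fastforce simp: bounded_iff)
    show thesis
    proof (rule that[of "max 0 (max a b)"])
      show "\<eta> x \<le> max 0 (max a b)" for x
        using ab(1)[of x] outside(1)[of x] by (cases "x \<in> K") auto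
      show "norm (hgrad op emb \<eta> x) \<le> max 0 (max a b)" for x
        using ab(2)[of x] outside(2)[of x] by (cases "x \<in> K") auto
    qed
  qed
  have M0: "0 \<le> M" using M(1)[of 0] \<eta>(2)[of 0] by linarith
  have C0: "0 \<le> C" using \<gamma>(3)[of 0] by auto
  define H where "H x = norm (h x) powr q" for x
  define G where "G x = norm (Dv x) powr p" for x
  have H0: "0 \<le> H x" and G0: "0 \<le> G x" for x by (auto simp: H_def G_def)
  have G: "locally_integrable G" using Dvp by (simp add: G_def[abs_def])
  \<comment> \<open>Two different points are needed: mollification averages \<open>Dv\<close> over y
    while the flux stays at x.\<close>
  have young: "norm (h x) * norm (Dv y) \<le> H x + G y" for x y
  proof -
    have "norm (h x) * norm (Dv y) \<le> norm (h x) powr q / q + norm (Dv y) powr p / p"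
      using Youngs_inequality[of q p "norm (h x)" "norm (Dv y)"] p q by (simp add: add.commute)
    also have "\<dots> \<le> H x + G y"
      unfolding H_def G_def using p q by (intro add_mono) (auto simp: divide_le_eq mult_le_cancel_left1)
    finally show ?thesis .
  qed
  have hH: "norm (h x) \<le> 1 + H x" for x
    using le_1_plus_powr[of "norm (h x)" q] q by (simp add: H_def)
  \<comment> \<open>Sum of the two bounds \<open>C * M * (H x + G x)\<close> and
    \<open>C * M * (1 + H x)\<close> for the two terms of the limit.\<close>
  define b where "b x = C * M * (1 + 2 * H x + G x)" for x
  have b0: "0 \<le> b x" for x
    using C0 M0 H0 G0 by (auto simp: b_def intro!: mult_nonneg_nonneg add_nonneg_nonneg)
  have iH: "integrable lborel (\<lambda>x. indicator K x * H x)"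
    using hp K by (simp add: locally_integrable_def set_integrable_def H_def q_def)
  have iG: "integrable lborel (\<lambda>x. indicator K x * G x)"
    using Dvp K by (simp add: locally_integrable_def set_integrable_def G_def)
  have i1: "integrable lborel (indicator K :: _ \<Rightarrow> real)"
    using borel_integrable_compact[OF K continuous_on_const, of "1::real"] by simp
  have ib: "integrable lborel (\<lambda>x. indicator K x * b x)"
  proof -
    have "integrable lborel (\<lambda>x. C * M * (indicator K x + 2 * (indicator K x * H x) + indicator K x * G x))"
      by (intro integrable_mult_right Bochner_Integration.integrable_add iH iG i1)
    then show ?thesis
      by (simp add: b_def algebra_simps)
  qed
  define P1 where "P1 x = \<gamma>' (v x) * (h x \<bullet> Dv x) * \<eta> x" for x
  define P2 where "P2 x = \<gamma> (v x) * (h x \<bullet> hgrad op emb \<eta> x)" for x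
  have b1: "\<bar>\<gamma>' t * (h x \<bullet> d) * \<eta> x\<bar> \<le> C * M * (H x + k) * indicator K x"
    if "0 \<le> t" "norm (h x) * norm d \<le> H x + k" for t x d k
  proof (cases "x \<in> K")
    case True
    have "\<bar>\<gamma>' t * (h x \<bullet> d) * \<eta> x\<bar> = \<gamma>' t * \<eta> x * \<bar>h x \<bullet> d\<bar>"
      using \<gamma>(4)[OF that(1)] \<eta>(2)[of x] by (simp add: abs_mult)
    also have "\<dots> \<le> (C * M) * (H x + k)"
      using \<gamma>(4)[OF that(1)] \<eta>(2)[of x] M(1)[of x] M0 C0 Cauchy_Schwarz_ineq2[of "h x" d] that(2)
      by (intro mult_mono) auto
    finally show ?thesis using True by simp
  qed (simp add: outside)
  have b2: "\<bar>\<gamma> t * (h x \<bullet> hgrad op emb \<eta> x)\<bar> \<le> C * M * (1 + H x) * indicator K x" if "0 \<le> t" for t x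
  proof (cases "x \<in> K")
    case True
    have "\<bar>\<gamma> t * (h x \<bullet> hgrad op emb \<eta> x)\<bar> = \<gamma> t * \<bar>h x \<bullet> hgrad op emb \<eta> x\<bar>"
      using \<gamma>(3)[OF that] by (simp add: abs_mult)
    also have "\<dots> \<le> C * (norm (h x) * norm (hgrad op emb \<eta> x))"
      using \<gamma>(3)[OF that] C0 Cauchy_Schwarz_ineq2 by (intro mult_mono) auto
    also have "\<dots> \<le> C * ((1 + H x) * M)"
      using hH[of x] M(2)[of x] C0 H0[of x] by (intro mult_mono) auto
    finally show ?thesis using True by (simp add: mult_ac)
  qed (simp add: outside)
  have P1: "\<bar>P1 x\<bar> \<le> indicator K x * b x" and P2: "\<bar>P2 x\<bar> \<le> indicator K x * b x" for x
  proof -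
    have "C * M * (H x + G x) \<le> b x" "C * M * (1 + H x) \<le> b x"
      using C0 M0 H0[of x] G0[of x] unfolding b_def by (auto intro!: mult_left_mono)
    then show "\<bar>P1 x\<bar> \<le> indicator K x * b x" "\<bar>P2 x\<bar> \<le> indicator K x * b x"
      using b1[OF v0 young, of x x x] b2[OF v0, of x x] unfolding P1_def P2_def by (auto simp: indicator_def split: if_splits)
  qed
  have [measurable]: "P1 \<in> borel_measurable borel" "P2 \<in> borel_measurable borel"
    unfolding P1_def[abs_def] P2_def[abs_def] by measurable
  have iP1: "integrable lborel P1" and iP2: "integrable lborel P2"
    by (rule Bochner_Integration.integrable_bound[OF ib]; use P1 P2 in \<open>auto intro: order_trans[OF _ abs_ge_self]\<close>)+
  then show "integrable lborel (\<lambda>x. \<gamma>' (v x) * (h x \<bullet> Dv x) * \<eta> x)"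
    "integrable lborel (\<lambda>x. \<gamma> (v x) * (h x \<bullet> hgrad op emb \<eta> x))"
    by (simp_all add: P1_def[abs_def] P2_def[abs_def])
  obtain J where J: "\<And>n. C1_0 (J n)" "\<And>n w. 0 \<le> J n w" "\<And>n. \<exists>\<delta>. mollifier \<delta> (J n)"
    "\<And>n. integrable lborel (\<lambda>x. indicator K x * norm (moll (J n) v x - v x))"
    "\<And>n. integrable lborel (\<lambda>x. indicator K x * norm (moll (J n) G x - G x))"
    "(\<lambda>n. \<integral>x. indicator K x * norm (moll (J n) G x - G x) \<partial>lborel) \<longlonglongrightarrow> 0"
    "AE x in lborel. x \<in> K \<longrightarrow> (\<lambda>n. moll (J n) v x) \<longlonglongrightarrow> v x"
    "AE x in lborel. x \<in> K \<longrightarrow> (\<lambda>n. moll (J n) Dv x) \<longlonglongrightarrow> Dv x"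
    "AE x in lborel. x \<in> K \<longrightarrow> (\<lambda>n. moll (J n) G x) \<longlonglongrightarrow> G x"
    by (rule ex_mollifier_sequence[OF v Dv G K]) (rule that; assumption)
  define V where "V n = moll (J n) v" for n
  have CV: "C1 (V n)" for n
    unfolding V_def by (rule C1_moll(1)[OF J(1) v])
  have V0: "0 \<le> V n x" for n x
    unfolding V_def moll_def using J(2) v0 by (intro integral_nonneg_AE AE_I2) simp
  have HV: "hgrad op emb (V n) x = moll (J n) Dv x" for n x
    unfolding V_def by (rule hgrad_moll[OF J(1) v Dv weak])
  define \<phi> where "\<phi> n x = \<gamma> (V n x) * \<eta> x" for n x
  have der: "((\<lambda>x. \<gamma> (V n x) * \<eta> x) has_derivative
     (\<lambda>d. \<gamma> (V n x) * frechet_derivative \<eta> (at x) d + (\<gamma>' (V n x) * frechet_derivative (V n) (at x) d) * \<eta> x)) (at x)" for n x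
    by (rule has_derivative_mult[OF has_derivative_compose[OF C1_has_derivative[OF CV]
          \<gamma>(1)[OF V0, unfolded has_field_derivative_def]] C1_has_derivative[OF C1\<eta>]])
  have cont: "continuous_on UNIV (\<lambda>x. \<gamma> (V n x))" "continuous_on UNIV (\<lambda>x. \<gamma>' (V n x))" for n
    using V0 by (auto intro!: continuous_on_compose2[OF c\<gamma> C1_continuous_on[OF CV]]
        continuous_on_compose2[OF \<gamma>(2) C1_continuous_on[OF CV]])
  have C\<phi>: "C1 (\<phi> n)" for n
    unfolding \<phi>_def
    by (rule C1I[OF der]) (intro continuous_intros cont C1_derivative_continuous C1_continuous_on CV C1\<eta>)
  have "{x. \<phi> n x \<noteq> 0} \<subseteq> K" for n
    using outside by (auto simp: \<phi>_def)
  then have "C1_0 (\<phi> n)" for n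
    using C\<phi> compact_closure bounded_subset[OF compact_imp_bounded[OF K]] by (simp add: C1_0_iff)
  moreover have "0 \<le> \<phi> n x" for n x
    using \<gamma>(3)[OF V0] \<eta>(2) by (simp add: \<phi>_def)
  ultimately have neg: "(\<integral>x. h x \<bullet> hgrad op emb (\<phi> n) x \<partial>lborel) \<le> 0" for n
    by (rule sub)
  define f where "f n x = \<gamma>' (V n x) * (h x \<bullet> moll (J n) Dv x) * \<eta> x + \<gamma> (V n x) * (h x \<bullet> hgrad op emb \<eta> x)" for n x
  have hf: "h x \<bullet> hgrad op emb (\<phi> n) x = f n x" for n x
  proof -
    have "hgrad op emb (\<phi> n) x = \<gamma> (V n x) *\<^sub>R hgrad op emb \<eta> x + (\<gamma>' (V n x) * \<eta> x) *\<^sub>R hgrad op emb (V n) x"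
      unfolding \<phi>_def using hgrad_eqI[OF der] by (simp add: vec_eq_iff hgrad_def)
    then show ?thesis
      by (simp add: f_def HV inner_add_right mult_ac)
  qed
  have "(\<lambda>n. \<integral>x. f n x \<partial>lborel) \<longlonglongrightarrow> (\<integral>x. P1 x + P2 x \<partial>lborel)"
  proof (rule integral_tendsto_dominated_L1[where B="\<lambda>x. indicator K x * b x" and w="\<lambda>n x. C * M * (indicator K x * norm (moll (J n) G x - G x))"])
    show "f n \<in> borel_measurable lborel" for n
    proof -
      have [measurable]: "hgrad op emb (\<phi> n) \<in> borel_measurable borel"
        by (intro borel_measurable_continuous_onI hgrad_continuous C\<phi>)
      show ?thesis unfolding hf[symmetric, abs_def] by measurable
    qed
    show "AE x in lborel. \<bar>f n x\<bar> \<le> indicator K x * b x + C * M * (indicator K x * norm (moll (J n) G x - G x))" for n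
    proof (rule AE_I2)
      fix x
      obtain \<delta> where "mollifier \<delta> (J n)" using J(3) by blast
      from norm_moll_le[OF this Dv G, of "norm (h x)" "H x" x] young
      have "norm (h x) * norm (moll (J n) Dv x) \<le> H x + moll (J n) G x" by simp
      from b1[OF V0[of n x] this] b2[OF V0[of n x], of x]
      have "\<bar>f n x\<bar> \<le> C * M * (H x + moll (J n) G x) * indicator K x + C * M * (1 + H x) * indicator K x"
        unfolding f_def by linarith
      also have "\<dots> = indicator K x * b x + C * M * (indicator K x * (moll (J n) G x - G x))"
        by (simp add: b_def algebra_simps)
      also have "\<dots> \<le> indicator K x * b x + C * M * (indicator K x * norm (moll (J n) G x - G x))"
        using C0 M0 by (intro add_left_mono mult_left_mono) auto
      finally show "\<bar>f n x\<bar> \<le> \<dots>" .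
    qed
    show "AE x in lborel. (\<lambda>n. f n x) \<longlonglongrightarrow> P1 x + P2 x"
      using J(7,8)
    proof eventually_elim
      case (elim x)
      show ?case
      proof (cases "x \<in> K")
        case True
        have "(\<lambda>n. V n x) \<longlonglongrightarrow> v x" and D: "(\<lambda>n. moll (J n) Dv x) \<longlonglongrightarrow> Dv x"
          using elim True by (auto simp: V_def)
        then have "(\<lambda>n. \<gamma> (V n x)) \<longlonglongrightarrow> \<gamma> (v x)" "(\<lambda>n. \<gamma>' (V n x)) \<longlonglongrightarrow> \<gamma>' (v x)"
          using v0 V0 by (auto intro!: continuous_on_tendsto_compose[OF c\<gamma>] continuous_on_tendsto_compose[OF \<gamma>(2)])
        then show ?thesis
          unfolding f_def P1_def P2_def by (intro tendsto_intros D)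
      next
        case False
        then show ?thesis
          by (simp add: f_def P1_def P2_def outside)
      qed
    qed
    show "AE x in lborel. (\<lambda>n. C * M * (indicator K x * norm (moll (J n) G x - G x))) \<longlonglongrightarrow> 0"
      using J(9)
    proof eventually_elim
      case (elim x)
      show ?case
      proof (cases "x \<in> K")
        case True
        with elim have "(\<lambda>n. C * M * (indicator K x * norm (moll (J n) G x - G x))) \<longlonglongrightarrow> C * M * (indicator K x * norm (G x - G x))"
          by (intro tendsto_intros) auto
        then show ?thesis by simp
      qed simp
    qed
    show "(\<lambda>n. \<integral>x. C * M * (indicator K x * norm (moll (J n) G x - G x)) \<partial>lborel) \<longlonglongrightarrow> 0"
      using tendsto_mult[OF tendsto_const J(6), of "C * M"] by simp
    show "integrable lborel (\<lambda>x. C * M * (indicator K x * norm (moll (J n) G x - G x)))" for n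
      by (intro integrable_mult_right J(5))
  qed (use ib C0 M0 in \<open>auto intro!: mult_nonneg_nonneg\<close>)
  then have "(\<integral>x. P1 x + P2 x \<partial>lborel) \<le> 0"
    by (rule LIMSEQ_le_const2) (use neg in \<open>auto simp: hf\<close>)
  then show "(\<integral>x. \<gamma>' (v x) * (h x \<bullet> Dv x) * \<eta> x \<partial>lborel) \<le> - (\<integral>x. \<gamma> (v x) * (h x \<bullet> hgrad op emb \<eta> x) \<partial>lborel)"
    using iP1 iP2 by (simp add: P1_def[abs_def] P2_def[abs_def])
qed

end

section \<open>Hoelder's inequality and the test functions of the Caccioppoli estimate\<close>

text \<open>After division by the two integrals this is the integrated weighted inequality of
  arithmetic and geometric means. If one integral is 0, that factor vanishes a.e. and so does the
  product, as \<open>0 powr a = 0\<close>.\<close>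

lemma Holder_powr:
  fixes f g :: "'a \<Rightarrow> real"
  assumes f: "integrable M f" and g: "integrable M g" and f0: "\<And>x. 0 \<le> f x" and g0: "\<And>x. 0 \<le> g x"
    and ab: "0 < a" "0 < b" "a + b = 1"
  shows "integrable M (\<lambda>x. f x powr a * g x powr b)"
    and "(\<integral>x. f x powr a * g x powr b \<partial>M) \<le> (\<integral>x. f x \<partial>M) powr a * (\<integral>x. g x \<partial>M) powr b"
proof -
  have [measurable]: "f \<in> borel_measurable M" "g \<in> borel_measurable M"
    using f g by auto
  have young: "x powr a * y powr b \<le> a * x + b * y" if "0 \<le> x" "0 \<le> y" for x y
    using Youngs_inequality_0[of a b x y] ab that by (cases "x = 0 \<or> y = 0") auto
  have "integrable M (\<lambda>x. a * f x + b * g x)"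
    using f g by auto
  then show int: "integrable M (\<lambda>x. f x powr a * g x powr b)"
    by (rule Bochner_Integration.integrable_bound)
      (use young f0 g0 in \<open>auto intro!: AE_I2 order_trans[OF _ abs_ge_self]\<close>)
  define F G where "F = (\<integral>x. f x \<partial>M)" and "G = (\<integral>x. g x \<partial>M)"
  have FG: "0 \<le> F" "0 \<le> G"
    using f0 g0 by (auto simp: F_def G_def)
  show "(\<integral>x. f x powr a * g x powr b \<partial>M) \<le> (\<integral>x. f x \<partial>M) powr a * (\<integral>x. g x \<partial>M) powr b"
  proof (cases "F = 0 \<or> G = 0")
    case True
    then have "(AE x in M. f x = 0) \<or> (AE x in M. g x = 0)"
      using integral_nonneg_eq_0_iff_AE[OF f] integral_nonneg_eq_0_iff_AE[OF g] f0 g0 by (auto simp: F_def G_def)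
    then have "AE x in M. f x powr a * g x powr b = 0"
    proof
      assume "AE x in M. f x = 0" then show ?thesis by eventually_elim simp
    next
      assume "AE x in M. g x = 0" then show ?thesis by eventually_elim simp
    qed
    then have "(\<integral>x. f x powr a * g x powr b \<partial>M) = (\<integral>x. 0 \<partial>M)"
      by (intro integral_cong_AE) auto
    then show ?thesis by simp
  next
    case False
    then have pos: "0 < F" "0 < G" using FG by auto
    have "(\<integral>x. f x powr a * g x powr b \<partial>M) / (F powr a * G powr b) = (\<integral>x. (f x / F) powr a * (g x / G) powr b \<partial>M)"
    proof -
      have "(f x / F) powr a * (g x / G) powr b = (f x powr a * g x powr b) / (F powr a * G powr b)" for x
        using f0 g0 FG by (simp add: powr_divide)
      then show ?thesis by simp
    qed
    also have "\<dots> \<le> (\<integral>x. a * (f x / F) + b * (g x / G) \<partial>M)"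
    proof (rule integral_mono)
      show "integrable M (\<lambda>x. (f x / F) powr a * (g x / G) powr b)"
        using int f0 g0 FG by (simp add: powr_divide)
      show "integrable M (\<lambda>x. a * (f x / F) + b * (g x / G))"
        using f g by auto
      show "(f x / F) powr a * (g x / G) powr b \<le> a * (f x / F) + b * (g x / G)" for x
        using f0 g0 pos by (intro young) auto
    qed
    also have "\<dots> = 1"
      using f g pos ab by (simp add: F_def[symmetric] G_def[symmetric])
    finally show ?thesis
      using pos by (simp add: divide_le_eq F_def G_def)
  qed
qed

text \<open>The function \<open>\<gamma>\<close> solves \<open>\<gamma>\<^sup>p = s\<^sup>1\<^sup>-\<^sup>p (t + e)\<^sup>s\<^sup>+\<^sup>p\<^sup>-\<^sup>1 (\<gamma>')\<^sup>p\<^sup>-\<^sup>1\<close>, the relation that also holds for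
  the power \<open>(t + e)\<^sup>s\<close>; unlike the latter it is bounded.\<close>

definition gam :: "real \<Rightarrow> real \<Rightarrow> real \<Rightarrow> real \<Rightarrow> real" where
  "gam p s e t = ((t + e) powr (- (s / (p - 1))) + e) powr (- (p - 1))"

definition gam' :: "real \<Rightarrow> real \<Rightarrow> real \<Rightarrow> real \<Rightarrow> real" where
  "gam' p s e t = s * ((t + e) powr (- (s / (p - 1))) + e) powr (- p) * (t + e) powr (- (s / (p - 1)) - 1)"

lemma gam_derivative:
  assumes "1 < p" "0 < e" "0 \<le> t"
  shows "(gam p s e has_real_derivative gam' p s e t) (at t)"
proof -
  have pos: "0 < t + e" "0 < (t + e) powr (- (s / (p - 1))) + e"
    using assms by (auto intro!: add_nonneg_pos)
  have 1: "((\<lambda>t. (t + e) powr (- (s / (p - 1))) + e) has_real_derivative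
      - (s / (p - 1)) * (t + e) powr (- (s / (p - 1)) - 1)) (at t)"
    using pos by (auto intro!: derivative_eq_intros)
  have "(gam p s e has_real_derivative
      (- (p - 1)) * ((t + e) powr (- (s / (p - 1))) + e) powr (- (p - 1) - 1) * (- (s / (p - 1)) * (t + e) powr (- (s / (p - 1)) - 1))) (at t)"
    unfolding gam_def[abs_def] using DERIV_fun_powr[OF 1 pos(2), of "- (p - 1)"] by simp
  moreover have "- (p - 1) - 1 = - p" by simp
  moreover have "(- (p - 1)) * a * (- (s / (p - 1)) * b) = s * a * b" for a b
    using assms by (simp add: field_simps)
  ultimately show ?thesis
    by (simp only: gam'_def)
qed

lemma gam'_continuous: "0 < e \<Longrightarrow> continuous_on {0..} (gam' p s e)"
proof -
  assume e: "0 < e"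
  have "t + e \<noteq> 0" "(t + e) powr a + e \<noteq> 0" if "0 \<le> t" for t a
    using that e by (auto simp: add_nonneg_eq_0_iff)
  then show ?thesis
    unfolding gam'_def[abs_def] by (intro continuous_intros) auto
qed

lemma gam_bounds:
  assumes "1 < p" "0 < e" "0 < s" "0 \<le> t"
  shows "0 \<le> gam p s e t" "gam p s e t \<le> e powr (- (p - 1))"
    and "0 \<le> gam' p s e t" "gam' p s e t \<le> s * e powr (- p) * e powr (- (s / (p - 1)) - 1)"
proof -
  have "0 < s / (p - 1)" using assms by simp
  then have sp: "- (s / (p - 1)) - 1 \<le> 0" by linarith
  let ?Y = "(t + e) powr (- (s / (p - 1))) + e"
  have Y: "e \<le> ?Y" by simp
  show "0 \<le> gam p s e t" "0 \<le> gam' p s e t"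
    using assms by (auto simp: gam_def gam'_def)
  show "gam p s e t \<le> e powr (- (p - 1))"
    unfolding gam_def using assms Y by (intro powr_mono2') auto
  have "?Y powr (- p) \<le> e powr (- p)"
    using assms Y by (intro powr_mono2') auto
  moreover have "(t + e) powr (- (s / (p - 1)) - 1) \<le> e powr (- (s / (p - 1)) - 1)"
    using assms by (intro powr_mono2'[OF sp]) auto
  ultimately show "gam' p s e t \<le> s * e powr (- p) * e powr (- (s / (p - 1)) - 1)"
    unfolding gam'_def using assms by (intro mult_mono) auto
qed

text \<open>This is the p-th root of the differential relation for \<open>gam\<close>: it lets
  Hoelder's inequality separate the energy density from a pure power of v. The relation is
  separable, with solution \<gamma>^(-1/(p-1)) = (t + e)^(-s/(p-1)) + const; taking the constant to
  be \<open>e\<close> > 0 is what bounds \<gamma>.\<close>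

lemma gam_factor:
  assumes "1 < p" "0 < e" "0 < s" "0 \<le> t"
  shows "gam p s e t = gam' p s e t powr ((p - 1) / p) * (s powr (- ((p - 1) / p)) * (t + e) powr ((s + p - 1) / p))"
proof -
  define Y where "Y = (t + e) powr (- (s / (p - 1))) + e"
  define \<tau> where "\<tau> = t + e"
  have pos: "0 < \<tau>" "0 < Y" using assms by (auto simp: Y_def \<tau>_def intro!: add_nonneg_pos)
  have e1: "(- p) * ((p - 1) / p) = - (p - 1)" and e2: "(- (s / (p - 1)) - 1) * ((p - 1) / p) = - ((s + p - 1) / p)"
    using assms by (auto simp: field_simps)
  have "gam' p s e t powr ((p - 1) / p) = (s * Y powr (- p) * \<tau> powr (- (s / (p - 1)) - 1)) powr ((p - 1) / p)"
    by (simp add: gam'_def Y_def \<tau>_def)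
  also have "\<dots> = s powr ((p - 1) / p) * Y powr ((- p) * ((p - 1) / p)) * \<tau> powr ((- (s / (p - 1)) - 1) * ((p - 1) / p))"
    using assms pos by (simp only: powr_mult powr_powr)
  finally have "gam' p s e t powr ((p - 1) / p) = s powr ((p - 1) / p) * Y powr (- (p - 1)) * \<tau> powr (- ((s + p - 1) / p))"
    by (simp only: e1 e2)
  moreover have "s powr ((p - 1) / p) * s powr (- ((p - 1) / p)) = 1" "\<tau> powr (- ((s + p - 1) / p)) * \<tau> powr ((s + p - 1) / p) = 1"
    using assms pos by (simp_all flip: powr_add)
  ultimately have "gam' p s e t powr ((p - 1) / p) * (s powr (- ((p - 1) / p)) * \<tau> powr ((s + p - 1) / p)) = Y powr (- (p - 1))"
    by (simp add: mult_ac)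
  then show ?thesis
    by (simp add: gam_def Y_def \<tau>_def)
qed

lemma gam_exponent:
  fixes p s :: real
  assumes "1 < p" shows "(- (s / (p - 1))) * (- p) + (- (s / (p - 1)) - 1) = s - 1"
proof -
  define a where "a = s / (p - 1)"
  have "a * (p - 1) = s" using assms by (simp add: a_def)
  then show ?thesis unfolding a_def[symmetric] by (simp add: algebra_simps)
qed

text \<open>Dropping the bounding constant \<open>e\<close> from the base of the negative power
  increases it, and leaves the derivative of (t + e)^s. This majorant serves for the passage e to
  0.\<close>

lemma gam'_le:
  assumes "1 < p" "0 < e" "0 < s" "0 \<le> t"
  shows "gam' p s e t \<le> s * (t + e) powr (s - 1)"
proof -
  define \<tau> where "\<tau> = t + e"
  have pos: "0 < \<tau>" using assms by (simp add: \<tau>_def)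
  have ex: "(- (s / (p - 1))) * (- p) + (- (s / (p - 1)) - 1) = s - 1"
    by (rule gam_exponent[OF assms(1)])
  have "(\<tau> powr (- (s / (p - 1))) + e) powr (- p) \<le> (\<tau> powr (- (s / (p - 1)))) powr (- p)"
    using assms pos by (intro powr_mono2') auto
  then have "gam' p s e t \<le> s * (\<tau> powr (- (s / (p - 1)))) powr (- p) * \<tau> powr (- (s / (p - 1)) - 1)"
    unfolding gam'_def \<tau>_def[symmetric] using assms by (intro mult_mono) auto
  also have "\<dots> = s * \<tau> powr ((- (s / (p - 1))) * (- p) + (- (s / (p - 1)) - 1))"
    by (simp only: powr_powr powr_add mult.assoc)
  finally show ?thesis
    by (simp only: ex \<tau>_def)
qed

text \<open>For s < 1 this lower bound blows up as e tends to 0, which forces the flux to vanish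
  where v = 0.\<close>

lemma gam'_0_ge:
  assumes "1 < p" "0 < e" "e \<le> 1" "0 < s"
  shows "s * 2 powr (- p) * e powr (s - 1) \<le> gam' p s e 0"
proof -
  have ex: "(- (s / (p - 1))) * (- p) + (- (s / (p - 1)) - 1) = s - 1"
    by (rule gam_exponent[OF assms(1)])
  \<comment> \<open>For e <= 1 the added constant is at most the other summand, so the base is at
    most doubled.\<close>
  have "e \<le> 1 * e powr (- (s / (p - 1)))"
  proof -
    have "1 \<le> e powr (- (s / (p - 1)))"
      using assms by (simp add: powr_minus powr_le1 one_le_inverse_iff)
    then show ?thesis using assms by simp
  qed
  then have "(2 * e powr (- (s / (p - 1)))) powr (- p) \<le> (e powr (- (s / (p - 1))) + e) powr (- p)"
    using assms by (intro powr_mono2') (auto intro!: add_pos_pos)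
  then have "2 powr (- p) * (e powr (- (s / (p - 1)))) powr (- p) \<le> (e powr (- (s / (p - 1))) + e) powr (- p)"
    by (simp only: powr_mult)
  then have "s * (2 powr (- p) * (e powr (- (s / (p - 1)))) powr (- p)) * e powr (- (s / (p - 1)) - 1) \<le> gam' p s e 0"
    unfolding gam'_def using assms by (simp add: mult_left_mono mult_right_mono)
  moreover have "s * (2 powr (- p) * (e powr (- (s / (p - 1)))) powr (- p)) * e powr (- (s / (p - 1)) - 1)
      = s * 2 powr (- p) * e powr ((- (s / (p - 1))) * (- p) + (- (s / (p - 1)) - 1))"
    by (simp only: powr_powr powr_add mult.assoc)
  ultimately show ?thesis
    by (simp only: ex)
qed

lemma gam'_tendsto:
  assumes "1 < p" "0 < s" "0 < t" "e \<longlonglongrightarrow> 0"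
  shows "(\<lambda>n. gam' p s (e n) t) \<longlonglongrightarrow> s * t powr (s - 1)"
proof -
  have ex: "(- (s / (p - 1))) * (- p) + (- (s / (p - 1)) - 1) = s - 1"
    by (rule gam_exponent[OF assms(1)])
  have "(\<lambda>n. gam' p s (e n) t) \<longlonglongrightarrow> s * ((t + 0) powr (- (s / (p - 1))) + 0) powr (- p) * (t + 0) powr (- (s / (p - 1)) - 1)"
    unfolding gam'_def using assms by (intro tendsto_intros) auto
  also have "s * ((t + 0) powr (- (s / (p - 1))) + 0) powr (- p) * (t + 0) powr (- (s / (p - 1)) - 1)
      = s * t powr ((- (s / (p - 1))) * (- p) + (- (s / (p - 1)) - 1))"
    by (simp only: powr_powr powr_add mult.assoc add_0_right)
  finally show ?thesis by (simp only: ex)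
qed

section \<open>Borel representatives, Fatou's lemma and absorption\<close>

lemma borel_lebesgue: "f \<in> borel_measurable borel \<Longrightarrow> f \<in> borel_measurable lebesgue"
  by (rule measurable_completion) simp

lemma lborel_lebesgue_cong:
  fixes f g :: "'a::euclidean_space \<Rightarrow> real"
  assumes f: "f \<in> borel_measurable lebesgue" and g: "g \<in> borel_measurable borel"
    and eq: "AE x in lborel. f x = g x"
  shows "(\<integral>x. f x \<partial>lebesgue) = (\<integral>x. g x \<partial>lborel)" "integrable lebesgue f \<longleftrightarrow> integrable lborel g"
proof -
  have g': "g \<in> borel_measurable lborel" "g \<in> borel_measurable lebesgue"
    using g borel_lebesgue by simp_all
  have eq': "AE x in lebesgue. f x = g x"
    by (rule AE_completion[OF eq])
  show "(\<integral>x. f x \<partial>lebesgue) = (\<integral>x. g x \<partial>lborel)"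
    using integral_cong_AE[OF f g'(2) eq'] integral_completion[OF g'(1)] by simp
  show "integrable lebesgue f \<longleftrightarrow> integrable lborel g"
    using integrable_cong_AE[OF f g'(2) eq'] integrable_completion[OF g'(1)] by simp
qed

lemma locally_integrable_lebesgue_cong:
  fixes u u' :: "real^'n \<Rightarrow> real"
  assumes u: "u \<in> borel_measurable lebesgue" "\<And>K. compact K \<Longrightarrow> set_integrable lebesgue K u"
    and eq: "AE x in lborel. u x = u' x" and u': "u' \<in> borel_measurable borel"
  shows "locally_integrable u'"
  unfolding locally_integrable_def set_integrable_def
proof (intro conjI allI impI u')
  fix K :: "(real^'n) set" assume K: "compact K"
  have [measurable]: "K \<in> sets borel" "u' \<in> borel_measurable borel" "u \<in> borel_measurable lebesgue"
    using K u' u by (auto simp: compact_imp_closed)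
  have "K \<in> sets lebesgue" using K by (simp add: compact_imp_closed)
  then have m: "(\<lambda>x. indicator K x *\<^sub>R u x) \<in> borel_measurable lebesgue"
    by measurable
  have "AE x in lborel. indicator K x *\<^sub>R u x = indicator K x *\<^sub>R u' x"
    using eq by eventually_elim simp
  from lborel_lebesgue_cong(2)[OF m _ this] u(2)[OF K] show "integrable lborel (\<lambda>x. indicator K x *\<^sub>R u' x)"
    by (simp add: set_integrable_def)
qed

lemma sets_lebesgue_nonzero:
  fixes f :: "'a::euclidean_space \<Rightarrow> 'b::real_normed_vector"
  assumes "f \<in> borel_measurable lebesgue" shows "{x. f x \<noteq> 0} \<in> sets lebesgue"
  using measurable_sets[OF assms, of "- {0}"] by (simp add: vimage_def)

lemma integrable_times_indicator:
  fixes f :: "'a \<Rightarrow> real"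
  assumes f: "integrable M f" and S: "S \<in> sets M" shows "integrable M (\<lambda>x. f x * indicator S x)"
  by (rule Bochner_Integration.integrable_bound[OF f])
    (use f S in \<open>auto simp: indicator_def intro!: borel_measurable_times borel_measurable_indicator[OF S, unfolded indicator_def]\<close>)

text \<open>Fatou's lemma.\<close>

lemma integrable_bounded_limit:
  fixes f :: "nat \<Rightarrow> 'a \<Rightarrow> real"
  assumes f: "\<And>n. integrable M (f n)" and f0: "\<And>n x. 0 \<le> f n x" and M: "\<And>n. (\<integral>x. f n x \<partial>M) \<le> C"
    and lim: "AE x in M. (\<lambda>n. f n x) \<longlonglongrightarrow> g x" and g: "g \<in> borel_measurable M"
  shows "integrable M g"
proof (rule integrableI_bounded[OF g])
  have [measurable]: "f n \<in> borel_measurable M" for n using f by auto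
  have "(\<integral>\<^sup>+x. ennreal (norm (g x)) \<partial>M) = (\<integral>\<^sup>+x. liminf (\<lambda>n. ennreal (f n x)) \<partial>M)"
  proof (rule nn_integral_cong_AE)
    show "AE x in M. ennreal (norm (g x)) = liminf (\<lambda>n. ennreal (f n x))"
      using lim
    proof eventually_elim
      case (elim x)
      have "0 \<le> g x"
        by (rule LIMSEQ_le_const[OF elim]) (use f0 in auto)
      moreover have "(\<lambda>n. ennreal (f n x)) \<longlonglongrightarrow> ennreal (g x)"
        using elim by (rule tendsto_ennrealI)
      ultimately show ?case
        using lim_imp_Liminf[OF sequentially_bot] by fastforce
    qed
  qed
  also have "\<dots> \<le> liminf (\<lambda>n. \<integral>\<^sup>+x. ennreal (f n x) \<partial>M)"
    by (rule nn_integral_liminf) simp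
  also have "\<dots> \<le> limsup (\<lambda>n. \<integral>\<^sup>+x. ennreal (f n x) \<partial>M)"
    by (rule Liminf_le_Limsup) simp
  also have "\<dots> \<le> ennreal C"
  proof (rule Limsup_bounded, rule always_eventually, rule allI)
    show "(\<integral>\<^sup>+x. ennreal (f n x) \<partial>M) \<le> ennreal C" for n
      using M[of n] by (subst nn_integral_eq_integral[OF f]) (auto simp: f0 ennreal_leI)
  qed
  also have "\<dots> < \<infinity>" by simp
  finally show "(\<integral>\<^sup>+x. ennreal (norm (g x)) \<partial>M) < \<infinity>" .
qed

text \<open>Division by E^((p-1)/p) is possible because E is a real number, so the energy must be
  known to be finite before this is applied.\<close>

lemma absorb_powr:
  fixes E W c k p :: real
  assumes le: "k * E \<le> c * (E powr ((p - 1) / p) * W powr (1 / p))"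
    and p: "1 < p" and k: "0 < k" and nonneg: "0 \<le> E" "0 \<le> W" "0 \<le> c"
  shows "E \<le> (c / k) powr p * W"
proof (cases "E = 0")
  case True
  then show ?thesis using nonneg by simp
next
  case False
  then have E: "0 < E" using nonneg by simp
  have "(p - 1) / p + 1 / p = 1" using p by (simp add: field_simps)
  then have split: "E = E powr ((p - 1) / p) * E powr (1 / p)"
    using E by (simp flip: powr_add)
  have "E powr ((p - 1) / p) * (k * E powr (1 / p)) \<le> E powr ((p - 1) / p) * (c * W powr (1 / p))"
    using le by (subst (asm) (1) split) (simp add: mult_ac)
  then have "k * E powr (1 / p) \<le> c * W powr (1 / p)"
    using E by simp
  then have "E powr (1 / p) \<le> (c / k) * W powr (1 / p)"
    using k by (simp add: field_simps)
  then have "(E powr (1 / p)) powr p \<le> ((c / k) * W powr (1 / p)) powr p"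
    using p by (intro powr_mono2) auto
  moreover have "1 / p * p = 1" using p by simp
  ultimately show ?thesis
    using nonneg by (simp only: powr_mult powr_powr powr_one)
qed

lemma powr_add_le:
  fixes a b r :: real
  assumes "0 \<le> a" "0 \<le> b" "b \<le> 1" "0 \<le> r"
  shows "(a + b) powr r \<le> 2 powr r * (a powr r + 1)"
proof -
  have "(a + b) powr r \<le> (2 * max a 1) powr r"
    using assms by (intro powr_mono2) auto
  also have "\<dots> = 2 powr r * max a 1 powr r"
    by (simp add: powr_mult)
  also have "max a 1 powr r \<le> a powr r + 1"
    using assms by (auto simp: max_def)
  finally show ?thesis by simp
qed

section \<open>The Caccioppoli estimate\<close>

context carnot
begin

text \<open>Where \<eta> > 0, the last condition says that |grad \<eta>|^p \<eta>^(1-p), the weight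
  in the Caccioppoli bound, is at most B^p \<eta>^\<delta>. A power of \<eta> is left over for
  Hoelder's inequality against the integral of v^q \<eta>.\<close>

definition cutoff :: "real \<Rightarrow> real \<Rightarrow> real \<Rightarrow> (real^'n \<Rightarrow> real) \<Rightarrow> bool" where
  "cutoff p \<delta> B \<eta> \<longleftrightarrow> C1_0 \<eta> \<and> (\<forall>x. 0 \<le> \<eta> x \<and> \<eta> x \<le> 1) \<and>
     (\<forall>x. norm (hgrad op emb \<eta> x) \<le> B * \<eta> x powr ((p - 1 + \<delta>) / p))"

lemma cutoff_mono:
  assumes "cutoff p \<delta> B \<eta>" "0 \<le> B" "1 < p" "\<delta>' \<le> \<delta>" shows "cutoff p \<delta>' B \<eta>"
proof -
  have "\<eta> x powr ((p - 1 + \<delta>) / p) \<le> \<eta> x powr ((p - 1 + \<delta>') / p)" for x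
    using assms by (intro powr_mono') (auto simp: cutoff_def divide_right_mono)
  then show ?thesis
    using assms unfolding cutoff_def by (meson mult_left_mono order_trans)
qed

end

text \<open>One inequality of the system, with \<open>h\<close> for A(x, v, Dv). Of its right-hand
  side only the sign remains. Nonnegativity of \<open>v\<close> is required everywhere, since
  \<open>gam\<close> is controlled on nonnegative arguments only.\<close>

locale subsolution = carnot op deg emb
  for op :: "real^'n \<Rightarrow> real^'n \<Rightarrow> real^'n" and deg :: "'n \<Rightarrow> nat" and emb :: "'l::finite \<Rightarrow> 'n" +
  fixes p k q :: real and v :: "real^'n \<Rightarrow> real" and Dv h :: "real^'n \<Rightarrow> real^'l"
  assumes p: "1 < p" and k: "0 < k" and q: "p - 1 < q"
    and W1p: "W1p_L_loc op emb p v Dv" and v_nonneg: "\<And>x. 0 \<le> v x"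
    and h_meas [measurable]: "h \<in> borel_measurable lebesgue" and h_loc: "Lp_loc (p / (p - 1)) (\<lambda>x. norm (h x))"
    and coercive: "AE x in lebesgue. k * norm (h x) powr (p / (p - 1)) \<le> h x \<bullet> Dv x"
    and sub: "\<And>\<phi>. C1_0 \<phi> \<Longrightarrow> (\<And>x. 0 \<le> \<phi> x) \<Longrightarrow> (\<integral>x. h x \<bullet> hgrad op emb \<phi> x \<partial>lebesgue) \<le> 0"
    and v_loc: "Lp_loc 1 (\<lambda>x. v x powr q)"
begin

lemma v_meas [measurable]: "v \<in> borel_measurable lebesgue" and Dv_meas [measurable]: "Dv \<in> borel_measurable lebesgue"
  using W1p by (auto simp: W1p_L_loc_def Lp_loc_def)

text \<open>\<open>test_composition_borel\<close> for Borel representatives of \<open>v\<close>,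
  \<open>Dv\<close> and \<open>h\<close>. The weak gradient, the sign condition and all integrals
  are unaffected by changes on null sets.\<close>

lemma test_gam:
  assumes s: "0 < s" and e: "0 < e" and \<eta>: "C1_0 \<eta>" "\<And>x. 0 \<le> \<eta> x"
  shows "integrable lebesgue (\<lambda>x. gam' p s e (v x) * (h x \<bullet> Dv x) * \<eta> x)"
    "integrable lebesgue (\<lambda>x. gam p s e (v x) * (h x \<bullet> hgrad op emb \<eta> x))"
    "(\<integral>x. gam' p s e (v x) * (h x \<bullet> Dv x) * \<eta> x \<partial>lebesgue) \<le> - (\<integral>x. gam p s e (v x) * (h x \<bullet> hgrad op emb \<eta> x) \<partial>lebesgue)"
proof -
  obtain v1 where v1: "v1 \<in> borel_measurable lborel" "AE x in lborel. v x = v1 x"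
    using completion_ex_borel_measurable_real[OF v_meas] by auto
  define v' where "v' x = max 0 (v1 x)" for x
  obtain Dv' where Dv': "Dv' \<in> borel_measurable borel" "AE x in lborel. Dv x = Dv' x"
    using lebesgue_ex_borel_vec[OF Dv_meas] by auto
  obtain h' where h': "h' \<in> borel_measurable borel" "AE x in lborel. h x = h' x"
    using lebesgue_ex_borel_vec[OF h_meas] by auto
  have [measurable]: "v' \<in> borel_measurable borel" "Dv' \<in> borel_measurable borel" "h' \<in> borel_measurable borel"
    unfolding v'_def[abs_def] using v1(1) Dv'(1) h'(1) by auto
  have aev: "AE x in lborel. v x = v' x"
    using v1(2)
  proof eventually_elim
    case (elim x)
    then show ?case using v_nonneg[of x] by (simp add: v'_def)
  qed
  have v'0: "0 \<le> v' x" for x by (simp add: v'_def)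
  have C1\<eta>: "C1 \<eta>" using \<eta>(1) by (simp add: C1_0_iff)
  have grad_meas: "hgrad op emb \<phi> \<in> borel_measurable borel" if "C1_0 \<phi>" for \<phi>
    using that by (intro borel_measurable_continuous_onI hgrad_continuous) (simp add: C1_0_iff)
  have fun_meas: "\<phi> \<in> borel_measurable borel" if "C1_0 \<phi>" for \<phi> :: "real^'n \<Rightarrow> real"
    using that by (simp add: C1_0_iff C1_measurable)
  have lv: "locally_integrable v'"
  proof -
    have "locally_integrable (\<lambda>x. \<bar>v' x\<bar> powr p)"
    proof (rule locally_integrable_lebesgue_cong[where u="\<lambda>x. \<bar>v x\<bar> powr p"])
      show "set_integrable lebesgue K (\<lambda>x. \<bar>v x\<bar> powr p)" if "compact K" for K
        using W1p that by (simp add: W1p_L_loc_def Lp_loc_def)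
      show "AE x in lborel. \<bar>v x\<bar> powr p = \<bar>v' x\<bar> powr p"
        using aev by eventually_elim simp
    qed measurable
    then show ?thesis
      by (rule locally_integrable_bound[rotated]) (use le_1_plus_powr[of "\<bar>v' x\<bar>" p for x] p in auto)
  qed
  have lDvp: "locally_integrable (\<lambda>x. norm (Dv' x) powr p)"
  proof (rule locally_integrable_lebesgue_cong[where u="\<lambda>x. norm (Dv x) powr p"])
    show "set_integrable lebesgue K (\<lambda>x. norm (Dv x) powr p)" if "compact K" for K
      using W1p that by (simp add: W1p_L_loc_def Lp_loc_def)
    show "AE x in lborel. norm (Dv x) powr p = norm (Dv' x) powr p"
      using Dv'(2) by eventually_elim simp
  qed measurable
  then have lDv: "locally_integrable Dv'"
    by (rule locally_integrable_bound[rotated]) (use le_1_plus_powr[of "norm (Dv' x)" p for x] p in auto)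
  have lh: "locally_integrable (\<lambda>x. norm (h' x) powr (p / (p - 1)))"
  proof (rule locally_integrable_lebesgue_cong[where u="\<lambda>x. norm (h x) powr (p / (p - 1))"])
    show "set_integrable lebesgue K (\<lambda>x. norm (h x) powr (p / (p - 1)))" if "compact K" for K
      using h_loc that by (simp add: Lp_loc_def)
    show "AE x in lborel. norm (h x) powr (p / (p - 1)) = norm (h' x) powr (p / (p - 1))"
      using h'(2) by eventually_elim simp
  qed measurable
  have weak: "(\<integral>x. Dv' x $ j * \<phi> x \<partial>lborel) = - (\<integral>x. v' x * hgrad op emb \<phi> x $ j \<partial>lborel)" if \<phi>: "C1_0 \<phi>" for \<phi> j
  proof -
    have C: "C1 \<phi>" using \<phi> by (simp add: C1_0_iff)
    have [measurable]: "(\<lambda>x. hgrad op emb \<phi> x $ j) \<in> borel_measurable borel" "\<phi> \<in> borel_measurable borel"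
      by (intro borel_measurable_continuous_onI continuous_intros hgrad_continuous C fun_meas[OF \<phi>])+
    have [measurable]: "(\<lambda>x. hgrad op emb \<phi> x $ j) \<in> borel_measurable lebesgue" "\<phi> \<in> borel_measurable lebesgue"
      by (rule borel_lebesgue, measurable)+
    have nth: "(\<lambda>y. y $ j) \<in> borel_measurable borel" for j :: 'l
      by (intro borel_measurable_continuous_onI continuous_intros)
    have [measurable]: "(\<lambda>x. Dv x $ j) \<in> borel_measurable lebesgue" "(\<lambda>x. Dv' x $ j) \<in> borel_measurable borel"
      by (rule measurable_compose[OF _ nth]; measurable)+
    have "(\<integral>x. Dv x $ j * \<phi> x \<partial>lebesgue) = - (\<integral>x. v x * hgrad op emb \<phi> x $ j \<partial>lebesgue)"
      using W1p \<phi> by (auto simp: W1p_L_loc_def weak_hgrad_def hdiv_eq_hgrad[OF C])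
    moreover have "(\<integral>x. Dv x $ j * \<phi> x \<partial>lebesgue) = (\<integral>x. Dv' x $ j * \<phi> x \<partial>lborel)"
    proof (rule lborel_lebesgue_cong(1))
      show "AE x in lborel. Dv x $ j * \<phi> x = Dv' x $ j * \<phi> x"
        using Dv'(2) by eventually_elim simp
    qed measurable
    moreover have "(\<integral>x. v x * hgrad op emb \<phi> x $ j \<partial>lebesgue) = (\<integral>x. v' x * hgrad op emb \<phi> x $ j \<partial>lborel)"
    proof (rule lborel_lebesgue_cong(1))
      show "AE x in lborel. v x * hgrad op emb \<phi> x $ j = v' x * hgrad op emb \<phi> x $ j"
        using aev by eventually_elim simp
    qed measurable
    ultimately show ?thesis by simp
  qed
  have sub': "(\<integral>x. h' x \<bullet> hgrad op emb \<phi> x \<partial>lborel) \<le> 0" if \<phi>: "C1_0 \<phi>" "\<And>x. 0 \<le> \<phi> x" for \<phi>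
  proof -
    have [measurable]: "hgrad op emb \<phi> \<in> borel_measurable borel" "hgrad op emb \<phi> \<in> borel_measurable lebesgue"
      using grad_meas[OF \<phi>(1)] borel_lebesgue by auto
    have "(\<integral>x. h x \<bullet> hgrad op emb \<phi> x \<partial>lebesgue) = (\<integral>x. h' x \<bullet> hgrad op emb \<phi> x \<partial>lborel)"
    proof (rule lborel_lebesgue_cong(1))
      show "AE x in lborel. h x \<bullet> hgrad op emb \<phi> x = h' x \<bullet> hgrad op emb \<phi> x"
        using h'(2) by eventually_elim simp
    qed measurable
    then show ?thesis using sub[OF \<phi>] by simp
  qed
  define C where "C = max (e powr (- (p - 1))) (s * e powr (- p) * e powr (- (s / (p - 1)) - 1))"
  have bounds: "0 \<le> gam p s e t \<and> gam p s e t \<le> C" "0 \<le> gam' p s e t \<and> gam' p s e t \<le> C" if "0 \<le> t" for t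
    using gam_bounds[OF p e s that] by (auto simp: C_def)
  note T = test_composition_borel[OF p lv v'0 lDv lDvp h'(1) lh weak sub' gam_derivative[OF p e] gam'_continuous[OF e] bounds \<eta>]
  have [measurable]: "hgrad op emb \<eta> \<in> borel_measurable borel" "hgrad op emb \<eta> \<in> borel_measurable lebesgue"
    "\<eta> \<in> borel_measurable borel" "\<eta> \<in> borel_measurable lebesgue"
    using grad_meas[OF \<eta>(1)] fun_meas[OF \<eta>(1)] borel_lebesgue by auto
  have 1: "(\<lambda>x. gam' p s e (v x) * (h x \<bullet> Dv x) * \<eta> x) \<in> borel_measurable lebesgue"
    "(\<lambda>x. gam p s e (v x) * (h x \<bullet> hgrad op emb \<eta> x)) \<in> borel_measurable lebesgue"
    "(\<lambda>x. gam' p s e (v' x) * (h' x \<bullet> Dv' x) * \<eta> x) \<in> borel_measurable borel"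
    "(\<lambda>x. gam p s e (v' x) * (h' x \<bullet> hgrad op emb \<eta> x)) \<in> borel_measurable borel"
    unfolding gam_def gam'_def by measurable
  have 2: "AE x in lborel. gam' p s e (v x) * (h x \<bullet> Dv x) * \<eta> x = gam' p s e (v' x) * (h' x \<bullet> Dv' x) * \<eta> x"
    using aev Dv'(2) h'(2) by eventually_elim simp
  have 3: "AE x in lborel. gam p s e (v x) * (h x \<bullet> hgrad op emb \<eta> x) = gam p s e (v' x) * (h' x \<bullet> hgrad op emb \<eta> x)"
    using aev h'(2) by eventually_elim simp
  show "integrable lebesgue (\<lambda>x. gam' p s e (v x) * (h x \<bullet> Dv x) * \<eta> x)"
    by (rule lborel_lebesgue_cong(2)[OF 1(1,3) 2, THEN iffD2]) (rule T(1))
  show "integrable lebesgue (\<lambda>x. gam p s e (v x) * (h x \<bullet> hgrad op emb \<eta> x))"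
    by (rule lborel_lebesgue_cong(2)[OF 1(2,4) 3, THEN iffD2]) (rule T(2))
  show "(\<integral>x. gam' p s e (v x) * (h x \<bullet> Dv x) * \<eta> x \<partial>lebesgue) \<le> - (\<integral>x. gam p s e (v x) * (h x \<bullet> hgrad op emb \<eta> x) \<partial>lebesgue)"
    unfolding lborel_lebesgue_cong(1)[OF 1(1,3) 2] lborel_lebesgue_cong(1)[OF 1(2,4) 3] by (rule T(3))
qed

abbreviation H :: "real^'n \<Rightarrow> real" where "H x \<equiv> norm (h x) powr (p / (p - 1))"

lemma integrable_on_support:
  assumes \<eta>: "C1_0 \<eta>"
  shows "integrable lebesgue (\<lambda>x. indicator (closure {x. \<eta> x \<noteq> 0}) x * H x)"
    "integrable lebesgue (\<lambda>x. indicator (closure {x. \<eta> x \<noteq> 0}) x * v x powr q)"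
    "integrable lebesgue (indicator (closure {x. \<eta> x \<noteq> 0}) :: _ \<Rightarrow> real)"
proof -
  have K: "compact (closure {x. \<eta> x \<noteq> 0})"
    using \<eta> by (simp add: C1_0_iff)
  show "integrable lebesgue (\<lambda>x. indicator (closure {x. \<eta> x \<noteq> 0}) x * H x)"
    using h_loc K by (simp add: Lp_loc_def set_integrable_def)
  show "integrable lebesgue (\<lambda>x. indicator (closure {x. \<eta> x \<noteq> 0}) x * v x powr q)"
    using v_loc K by (simp add: Lp_loc_def set_integrable_def)
  have "emeasure lebesgue (closure {x. \<eta> x \<noteq> 0}) < \<infinity>"
    using emeasure_bounded_finite[OF compact_imp_bounded[OF K]] by simp
  then show "integrable lebesgue (indicator (closure {x. \<eta> x \<noteq> 0}) :: _ \<Rightarrow> real)"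
    by (intro integrable_real_indicator) auto
qed

lemma integrable_times_cutoff:
  assumes \<eta>: "C1_0 \<eta>" "\<And>x. 0 \<le> \<eta> x \<and> \<eta> x \<le> 1"
  shows "integrable lebesgue (\<lambda>x. H x * \<eta> x)" "integrable lebesgue (\<lambda>x. v x powr q * \<eta> x)"
proof -
  have [measurable]: "\<eta> \<in> borel_measurable lebesgue"
    using \<eta>(1) by (intro borel_lebesgue C1_measurable) (simp add: C1_0_iff)
  have "\<bar>a * \<eta> x\<bar> \<le> \<bar>indicator (closure {x. \<eta> x \<noteq> 0}) x * a\<bar>" for a x
    using C1_0_zero_outside[of x \<eta>] \<eta>(2)[of x]
    by (cases "x \<in> closure {x. \<eta> x \<noteq> 0}") (auto simp: abs_mult mult_left_le)
  note le = this
  show "integrable lebesgue (\<lambda>x. H x * \<eta> x)"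
    by (rule Bochner_Integration.integrable_bound[OF integrable_on_support(1)[OF \<eta>(1)]])
      (measurable, simp only: real_norm_def, intro AE_I2 le)
  show "integrable lebesgue (\<lambda>x. v x powr q * \<eta> x)"
    by (rule Bochner_Integration.integrable_bound[OF integrable_on_support(2)[OF \<eta>(1)]])
      (measurable, simp only: real_norm_def, intro AE_I2 le)
qed

text \<open>One integrable bound for (v + e)^r \<eta>^\<delta>, valid for all e in [0, 1] and all r
  in [0, q], so that it survives the limit e to 0. It combines t^r <= 1 + t^q with (v + e)^q <= 2^q
  (v^q + 1).\<close>

definition majorant :: "(real^'n \<Rightarrow> real) \<Rightarrow> real^'n \<Rightarrow> real" where
  "majorant \<eta> x = indicator (closure {x. \<eta> x \<noteq> 0}) x * (1 + 2 powr q * (v x powr q + 1))"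

lemma integrable_majorant: "C1_0 \<eta> \<Longrightarrow> integrable lebesgue (majorant \<eta>)"
proof -
  assume \<eta>: "C1_0 \<eta>"
  let ?I = "indicator (closure {x. \<eta> x \<noteq> 0}) :: _ \<Rightarrow> real"
  have "integrable lebesgue (\<lambda>x. ?I x + 2 powr q * (?I x * v x powr q + ?I x))"
    by (intro Bochner_Integration.integrable_add integrable_mult_right integrable_on_support \<eta>)
  then show ?thesis
    by (simp add: majorant_def[abs_def] algebra_simps)
qed

lemma le_majorant:
  assumes "\<And>x. 0 \<le> \<eta> x \<and> \<eta> x \<le> 1" "0 \<le> \<delta>" "0 \<le> r" "r \<le> q" "0 \<le> e" "e \<le> 1"
  shows "(v x + e) powr r * \<eta> x powr \<delta> \<le> majorant \<eta> x"
\<comment> \<open>For \<eta> x = 0 the left side is 0 even when \<delta> = 0, because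
  \<open>0 powr 0 = 0\<close>.\<close>
proof (cases "\<eta> x = 0")
  case False
  then have x: "x \<in> closure {x. \<eta> x \<noteq> 0}"
    using closure_subset[of "{x. \<eta> x \<noteq> 0}"] by auto
  have "(v x + e) powr r * \<eta> x powr \<delta> \<le> (v x + e) powr r * 1"
    using assms by (intro mult_left_mono powr_le1) auto
  also have "\<dots> \<le> 1 + (v x + e) powr q"
    using powr_le_1_plus[of "v x + e" r q] v_nonneg[of x] assms by simp
  also have "\<dots> \<le> 1 + 2 powr q * (v x powr q + 1)"
    using powr_add_le[of "v x" e q] v_nonneg[of x] assms p q by simp
  finally show ?thesis
    using x by (simp add: majorant_def)
qed (simp add: majorant_def)

lemma C1_0_lebesgue_measurable:
  assumes "C1_0 \<eta>"
  shows "\<eta> \<in> borel_measurable lebesgue" "hgrad op emb \<eta> \<in> borel_measurable lebesgue"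
proof -
  have "C1 \<eta>" using assms by (simp add: C1_0_iff)
  then show "\<eta> \<in> borel_measurable lebesgue" "hgrad op emb \<eta> \<in> borel_measurable lebesgue"
    using borel_lebesgue[OF C1_measurable] borel_lebesgue[OF borel_measurable_continuous_onI[OF hgrad_continuous]]
    by blast+
qed

lemma integrable_weighted_power:
  assumes \<eta>: "cutoff p \<delta> B \<eta>" and \<delta>: "0 \<le> \<delta>" and r: "0 \<le> r" "r \<le> q" and e: "0 \<le> e" "e \<le> 1"
  shows "integrable lebesgue (\<lambda>x. (v x + e) powr r * \<eta> x powr \<delta>)"
proof (rule Bochner_Integration.integrable_bound[OF integrable_majorant[of \<eta>]])
  show "C1_0 \<eta>" using \<eta> by (simp add: cutoff_def)
  then have [measurable]: "\<eta> \<in> borel_measurable lebesgue"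
    by (rule C1_0_lebesgue_measurable)
  show "(\<lambda>x. (v x + e) powr r * \<eta> x powr \<delta>) \<in> borel_measurable lebesgue"
    by measurable
  show "AE x in lebesgue. norm ((v x + e) powr r * \<eta> x powr \<delta>) \<le> norm (majorant \<eta> x)"
    using le_majorant[OF _ \<delta> r e, of \<eta>] \<eta> by (auto simp: cutoff_def intro!: AE_I2 order_trans[OF _ abs_ge_self])
qed

text \<open>Coercivity bounds the tested integral from below; \<open>gam_factor\<close>, the cut-off
  condition and Hoelder's inequality with exponents p/(p-1) and p bound it from above. The energy on
  the right is not yet absorbed: its restriction to the set of nonzero gradient is needed for the
  tail argument.\<close>

lemma caccioppoli_approx:
  assumes s: "0 < s" "s + p - 1 \<le> q" and e: "0 < e" "e \<le> 1"
    and \<eta>: "cutoff p \<delta> B \<eta>" and \<delta>: "0 \<le> \<delta>" and B: "0 \<le> B"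
  shows "integrable lebesgue (\<lambda>x. H x * gam' p s e (v x) * \<eta> x)"
    and "k * (\<integral>x. H x * gam' p s e (v x) * \<eta> x \<partial>lebesgue) \<le> (B * s powr (- ((p - 1) / p))) *
      ((\<integral>x. H x * gam' p s e (v x) * \<eta> x * indicator {x. hgrad op emb \<eta> x \<noteq> 0} x \<partial>lebesgue) powr ((p - 1) / p) *
       (\<integral>x. (v x + e) powr (s + p - 1) * \<eta> x powr \<delta> \<partial>lebesgue) powr (1 / p))"
proof -
  define a b where "a = (p - 1) / p" and "b = 1 / p"
  have ab: "0 < a" "0 < b" "a + b = 1"
    using p by (auto simp: a_def b_def field_simps)
  have \<eta>0: "C1_0 \<eta>" "\<And>x. 0 \<le> \<eta> x" "\<And>x. \<eta> x \<le> 1" "\<And>x. norm (hgrad op emb \<eta> x) \<le> B * \<eta> x powr ((p - 1 + \<delta>) / p)"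
    using \<eta> by (auto simp: cutoff_def)
  have [measurable]: "\<eta> \<in> borel_measurable lebesgue" "hgrad op emb \<eta> \<in> borel_measurable lebesgue"
    using C1_0_lebesgue_measurable[OF \<eta>0(1)] by auto
  define f where "f x = H x * gam' p s e (v x) * \<eta> x" for x
  define N where "N = {x. hgrad op emb \<eta> x \<noteq> 0}"
  define g where "g x = (v x + e) powr (s + p - 1) * \<eta> x powr \<delta>" for x
  have f0: "0 \<le> f x" and g0: "0 \<le> g x" for x
    using gam_bounds(3)[OF p e(1) s(1) v_nonneg] \<eta>0(2) by (auto simp: f_def g_def)
  have [measurable]: "f \<in> borel_measurable lebesgue" "g \<in> borel_measurable lebesgue"
    unfolding f_def[abs_def] g_def[abs_def] gam'_def by measurable
  have N: "N \<in> sets lebesgue"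
    unfolding N_def by (rule sets_lebesgue_nonzero) measurable
  note T = test_gam[OF s(1) e(1) \<eta>0(1,2)]
  have kf: "AE x in lebesgue. k * f x \<le> gam' p s e (v x) * (h x \<bullet> Dv x) * \<eta> x"
    using coercive
  proof eventually_elim
    case (elim x)
    have "(gam' p s e (v x) * \<eta> x) * (k * H x) \<le> (gam' p s e (v x) * \<eta> x) * (h x \<bullet> Dv x)"
      using elim gam_bounds(3)[OF p e(1) s(1) v_nonneg[of x]] \<eta>0(2)[of x] by (intro mult_left_mono) auto
    then show ?case by (simp add: f_def mult_ac)
  qed
  have "integrable lebesgue (\<lambda>x. k * f x)"
    by (rule Bochner_Integration.integrable_bound[OF T(1)])
      (use kf k f0 in \<open>auto elim!: eventually_mono intro: order_trans[OF _ abs_ge_self]\<close>)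
  then show intf: "integrable lebesgue (\<lambda>x. H x * gam' p s e (v x) * \<eta> x)"
    using k by (simp add: f_def[abs_def])
  then have intf': "integrable lebesgue f"
    by (simp add: f_def[abs_def])
  have intN: "integrable lebesgue (\<lambda>x. f x * indicator N x)"
    by (rule integrable_times_indicator[OF intf' N])
  have intg: "integrable lebesgue g"
    unfolding g_def[abs_def] using s p e by (intro integrable_weighted_power[OF \<eta> \<delta>]) auto
  define c where "c = B * s powr (- a)"
  have c: "0 \<le> c" using B by (simp add: c_def)
  have pt: "\<bar>gam p s e (v x) * (h x \<bullet> hgrad op emb \<eta> x)\<bar> \<le> c * ((f x * indicator N x) powr a * g x powr b)" for x
  proof (cases "x \<in> N")
    case True
    have hH: "norm (h x) = H x powr a"
      using p by (simp add: powr_powr a_def)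
    \<comment> \<open>Of the cut-off's exponent, the part \<open>a\<close> completes the weight
      \<eta> of the energy and the part \<delta> b gives \<eta>^\<delta> in the second
      factor.\<close>
    have ex: "(p - 1 + \<delta>) / p = a + \<delta> * b" "(s + p - 1) / p = (s + p - 1) * b"
      by (simp_all add: a_def b_def add_divide_distrib)
    have "\<bar>gam p s e (v x) * (h x \<bullet> hgrad op emb \<eta> x)\<bar> \<le> gam p s e (v x) * (norm (h x) * norm (hgrad op emb \<eta> x))"
      using gam_bounds(1)[OF p e(1) s(1) v_nonneg[of x]] Cauchy_Schwarz_ineq2[of "h x" "hgrad op emb \<eta> x"]
      by (simp add: abs_mult mult_left_mono)
    also have "\<dots> \<le> gam p s e (v x) * (norm (h x) * (B * \<eta> x powr ((p - 1 + \<delta>) / p)))"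
      using gam_bounds(1)[OF p e(1) s(1) v_nonneg[of x]] \<eta>0(4)[of x] by (intro mult_left_mono) auto
    also have "\<dots> = (gam' p s e (v x) powr a * (s powr (- a) * (v x + e) powr ((s + p - 1) * b))) * (H x powr a * (B * (\<eta> x powr a * \<eta> x powr (\<delta> * b))))"
      unfolding ex powr_add hH[symmetric] gam_factor[OF p e(1) s(1) v_nonneg[of x]] ex(2) a_def[symmetric] ..
    also have "\<dots> = c * (((H x powr a * gam' p s e (v x) powr a) * \<eta> x powr a) * ((v x + e) powr ((s + p - 1) * b) * \<eta> x powr (\<delta> * b)))"
      by (simp add: c_def mult_ac)
    also have "\<dots> = c * (f x powr a * g x powr b)"
      by (simp only: f_def g_def powr_mult powr_powr)
    finally show ?thesis using True by simp
  qed (simp add: N_def)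
  note Ho = Holder_powr[OF intN intg _ g0 ab]
  have "k * (\<integral>x. f x \<partial>lebesgue) = (\<integral>x. k * f x \<partial>lebesgue)" by simp
  also have "\<dots> \<le> (\<integral>x. gam' p s e (v x) * (h x \<bullet> Dv x) * \<eta> x \<partial>lebesgue)"
    using intf' T(1) kf by (intro integral_mono_AE) auto
  also have "\<dots> \<le> \<bar>\<integral>x. gam p s e (v x) * (h x \<bullet> hgrad op emb \<eta> x) \<partial>lebesgue\<bar>"
    using T(3) by linarith
  also have "\<dots> \<le> (\<integral>x. \<bar>gam p s e (v x) * (h x \<bullet> hgrad op emb \<eta> x)\<bar> \<partial>lebesgue)"
    by (rule integral_abs_bound)
  also have "\<dots> \<le> (\<integral>x. c * ((f x * indicator N x) powr a * g x powr b) \<partial>lebesgue)"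
    using T(2) Ho(1) f0 by (intro integral_mono pt integrable_abs integrable_mult_right) auto
  also have "\<dots> \<le> c * ((\<integral>x. f x * indicator N x \<partial>lebesgue) powr a * (\<integral>x. g x \<partial>lebesgue) powr b)"
    using Ho(2) f0 c by (simp add: mult_left_mono)
  finally show "k * (\<integral>x. H x * gam' p s e (v x) * \<eta> x \<partial>lebesgue) \<le> (B * s powr (- ((p - 1) / p))) *
      ((\<integral>x. H x * gam' p s e (v x) * \<eta> x * indicator {x. hgrad op emb \<eta> x \<noteq> 0} x \<partial>lebesgue) powr ((p - 1) / p) *
       (\<integral>x. (v x + e) powr (s + p - 1) * \<eta> x powr \<delta> \<partial>lebesgue) powr (1 / p))"
    by (simp add: f_def[abs_def] g_def[abs_def] N_def a_def b_def c_def)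
qed

end

lemma powr_shift_le:
  fixes t e a :: real
  assumes "0 < t" "0 \<le> e" "e \<le> 1"
  shows "(t + e) powr a \<le> 2 powr \<bar>a\<bar> * (t powr a + 1)"
proof (cases "0 \<le> a")
  case True
  then show ?thesis using powr_add_le[of t e a] assms by simp
next
  case False
  then have "(t + e) powr a \<le> t powr a"
    using assms by (intro powr_mono2') auto
  also have "\<dots> \<le> 1 * (t powr a + 1)" by simp
  also have "\<dots> \<le> 2 powr \<bar>a\<bar> * (t powr a + 1)"
    by (intro mult_right_mono ge_one_powr_ge_zero) auto
  finally show ?thesis .
qed

section \<open>Removing the regularisation of the test functions\<close>

context subsolution
begin

text \<open>The restricted energy is enlarged to the full one and absorbed; \<open>majorant\<close>
  makes the resulting bound independent of e.\<close>

lemma approx_energy_bound: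
  assumes s: "0 < s" "s + p - 1 \<le> q" and e: "0 < e" "e \<le> 1"
    and \<eta>: "cutoff p \<delta> B \<eta>" and \<delta>: "0 \<le> \<delta>" and B: "0 \<le> B"
  shows "(\<integral>x. H x * gam' p s e (v x) * \<eta> x \<partial>lebesgue)
    \<le> (B * s powr (- ((p - 1) / p)) / k) powr p * (\<integral>x. majorant \<eta> x \<partial>lebesgue)"
proof -
  have \<eta>0: "C1_0 \<eta>" "\<And>x. 0 \<le> \<eta> x" "\<And>x. \<eta> x \<le> 1"
    using \<eta> by (auto simp: cutoff_def)
  define N where "N = {x. hgrad op emb \<eta> x \<noteq> 0}"
  define f where "f x = H x * gam' p s e (v x) * \<eta> x" for x
  have f0: "0 \<le> f x" for x
    using gam_bounds(3)[OF p e(1) s(1) v_nonneg] \<eta>0(2) by (auto simp: f_def)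
  note C = caccioppoli_approx[OF s e \<eta> \<delta> B]
  have [measurable]: "\<eta> \<in> borel_measurable lebesgue" "hgrad op emb \<eta> \<in> borel_measurable lebesgue"
    using C1_0_lebesgue_measurable[OF \<eta>0(1)] by auto
  have N [measurable]: "N \<in> sets lebesgue"
    unfolding N_def by (rule sets_lebesgue_nonzero) measurable
  have int: "integrable lebesgue f" using C(1) by (simp add: f_def[abs_def])
  have intN: "integrable lebesgue (\<lambda>x. f x * indicator N x)"
    by (rule integrable_times_indicator[OF int N])
  have TE: "(\<integral>x. f x * indicator N x \<partial>lebesgue) \<le> (\<integral>x. f x \<partial>lebesgue)"
    by (rule integral_mono[OF intN int]) (use f0 in \<open>auto simp: indicator_def\<close>)
  have T0: "0 \<le> (\<integral>x. f x * indicator N x \<partial>lebesgue)"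
    using f0 by simp
  let ?W = "\<integral>x. (v x + e) powr (s + p - 1) * \<eta> x powr \<delta> \<partial>lebesgue"
  let ?c = "B * s powr (- ((p - 1) / p))"
  have W: "?W \<le> (\<integral>x. majorant \<eta> x \<partial>lebesgue)"
    using s p e \<eta>0 \<delta> by (intro integral_mono integrable_weighted_power[OF \<eta>] integrable_majorant le_majorant) auto
  have "k * (\<integral>x. f x \<partial>lebesgue) \<le> ?c * ((\<integral>x. f x * indicator N x \<partial>lebesgue) powr ((p - 1) / p) * ?W powr (1 / p))"
    using C(2) by (simp add: f_def[abs_def] N_def)
  also have "\<dots> \<le> ?c * ((\<integral>x. f x \<partial>lebesgue) powr ((p - 1) / p) * ?W powr (1 / p))"
    using TE T0 B p by (intro mult_left_mono mult_right_mono powr_mono2) auto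
  finally have "(\<integral>x. f x \<partial>lebesgue) \<le> (?c / k) powr p * ?W"
    by (rule absorb_powr[OF _ p k]) (use f0 B in auto)
  also have "\<dots> \<le> (?c / k) powr p * (\<integral>x. majorant \<eta> x \<partial>lebesgue)"
    by (intro mult_left_mono W) simp
  finally show ?thesis by (simp add: f_def[abs_def])
qed

text \<open>The value of s in the flux bound: below 1, so that the zero-set argument works and (1 -
  s)(p - 1) is positive, and with s + p - 1 strictly below q, so that Hoelder's inequality against
  v^q applies.\<close>

definition small :: real where "small = min (1/2) ((q - p + 1) / 2)"

lemma small: "0 < small" "small < 1" "small + p - 1 < q"
  using q by (auto simp: small_def min_def field_simps)

text \<open>On {v = 0} the regularised energy density is at least a constant times e^(s-1) H \<eta>,
  while the whole energy is bounded independently of e. As s < 1, letting e tend to 0 leaves no flux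
  there.\<close>

lemma flux_zero_on_zero_set:
  assumes \<eta>: "cutoff p \<delta> B \<eta>" and \<delta>: "0 \<le> \<delta>" and B: "0 \<le> B"
  shows "AE x in lebesgue. \<eta> x \<noteq> 0 \<and> v x = 0 \<longrightarrow> h x = 0"
proof -
  define s where "s = small"
  have s: "0 < s" "s < 1" "s + p - 1 \<le> q"
    using small by (auto simp: s_def)
  have \<eta>0: "C1_0 \<eta>" "\<And>x. 0 \<le> \<eta> x" "\<And>x. \<eta> x \<le> 1"
    using \<eta> by (auto simp: cutoff_def)
  have [measurable]: "\<eta> \<in> borel_measurable lebesgue"
    using C1_0_lebesgue_measurable[OF \<eta>0(1)] by auto
  have "{x \<in> space lebesgue. v x = 0} \<in> sets lebesgue" by measurable
  then have [measurable]: "{x. v x = 0} \<in> sets lebesgue" by simp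
  define g where "g x = H x * indicator {x. v x = 0} x * \<eta> x" for x
  have g0: "0 \<le> g x" for x using \<eta>0(2) by (simp add: g_def)
  have ig: "integrable lebesgue g"
    using integrable_times_indicator[OF integrable_times_cutoff(1)[of \<eta>], of "{x. v x = 0}"] \<eta>0
    by (simp add: g_def[abs_def] mult_ac)
  define M where "M = (B * s powr (- ((p - 1) / p)) / k) powr p * (\<integral>x. majorant \<eta> x \<partial>lebesgue)"
  have le: "(\<integral>x. g x \<partial>lebesgue) \<le> M / (s * 2 powr (- p)) * e powr (1 - s)" if e: "0 < e" "e \<le> 1" for e
  proof -
    have "(s * 2 powr (- p) * e powr (s - 1)) * (\<integral>x. g x \<partial>lebesgue) = (\<integral>x. (s * 2 powr (- p) * e powr (s - 1)) * g x \<partial>lebesgue)"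
      by simp
    also have "\<dots> \<le> (\<integral>x. H x * gam' p s e (v x) * \<eta> x \<partial>lebesgue)"
    proof (rule integral_mono[OF _ caccioppoli_approx(1)[OF s(1,3) e \<eta> \<delta> B]])
      show "(s * 2 powr (- p) * e powr (s - 1)) * g x \<le> H x * gam' p s e (v x) * \<eta> x" for x
      proof (cases "v x = 0")
        case True
        have "(H x * \<eta> x) * (s * 2 powr (- p) * e powr (s - 1)) \<le> (H x * \<eta> x) * gam' p s e 0"
          using gam'_0_ge[OF p e s(1)] \<eta>0(2) by (intro mult_left_mono) auto
        then show ?thesis using True by (simp add: g_def mult_ac)
      next
        case False
        then show ?thesis
          using gam_bounds(3)[OF p e(1) s(1) v_nonneg[of x]] \<eta>0(2)[of x] by (simp add: g_def)
      qed
    qed (use ig in simp)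
    also have "\<dots> \<le> M"
      unfolding M_def by (rule approx_energy_bound[OF s(1,3) e \<eta> \<delta> B])
    finally have "(s * 2 powr (- p) * e powr (s - 1)) * (\<integral>x. g x \<partial>lebesgue) \<le> M" .
    then have "e powr (s - 1) * (\<integral>x. g x \<partial>lebesgue) \<le> M / (s * 2 powr (- p))"
      using s by (simp add: field_simps)
    then have "e powr (1 - s) * (e powr (s - 1) * (\<integral>x. g x \<partial>lebesgue)) \<le> e powr (1 - s) * (M / (s * 2 powr (- p)))"
      by (rule mult_left_mono) simp
    moreover have "e powr (1 - s) * e powr (s - 1) = 1"
      using e by (simp flip: powr_add)
    ultimately show ?thesis
      by (metis mult.assoc mult.commute mult_1)
  qed
  have "(\<lambda>n. inverse (real (Suc n))) \<longlonglongrightarrow> 0"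
    by (rule LIMSEQ_inverse_real_of_nat)
  then have "(\<lambda>n. M / (s * 2 powr (- p)) * inverse (real (Suc n)) powr (1 - s)) \<longlonglongrightarrow> M / (s * 2 powr (- p)) * 0 powr (1 - s)"
    using s by (intro tendsto_intros tendsto_powr') auto
  then have "(\<integral>x. g x \<partial>lebesgue) \<le> M / (s * 2 powr (- p)) * 0 powr (1 - s)"
    by (rule LIMSEQ_le_const) (use le[of "inverse (real (Suc n))" for n] in \<open>auto simp: inverse_le_1_iff\<close>)
  moreover have "0 \<le> (\<integral>x. g x \<partial>lebesgue)" using g0 by simp
  ultimately have "(\<integral>x. g x \<partial>lebesgue) = 0" by simp
  then have "AE x in lebesgue. g x = 0"
    using integral_nonneg_eq_0_iff_AE[OF ig] g0 by simp
  then show ?thesis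
    by eventually_elim (auto simp: g_def)
qed

text \<open>The limit e to 0. Fatou's lemma first shows that the limiting energy density is
  integrable; together with H on the support it then dominates the approximations. The set {v = 0},
  where \<open>gam'\<close> need not converge, carries no flux.\<close>

lemma caccioppoli:
  assumes s: "0 < s" "s + p - 1 \<le> q"
    and \<eta>: "cutoff p \<delta> B \<eta>" and \<delta>: "0 \<le> \<delta>" and B: "0 \<le> B"
  shows "integrable lebesgue (\<lambda>x. H x * v x powr (s - 1) * \<eta> x)"
    and "k * s * (\<integral>x. H x * v x powr (s - 1) * \<eta> x \<partial>lebesgue) \<le> B *
      ((\<integral>x. H x * v x powr (s - 1) * \<eta> x * indicator {x. hgrad op emb \<eta> x \<noteq> 0} x \<partial>lebesgue) powr ((p - 1) / p) *
       (\<integral>x. v x powr (s + p - 1) * \<eta> x powr \<delta> \<partial>lebesgue) powr (1 / p))"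
proof -
  have \<eta>0: "C1_0 \<eta>" "\<And>x. 0 \<le> \<eta> x" "\<And>x. \<eta> x \<le> 1"
    using \<eta> by (auto simp: cutoff_def)
  have [measurable]: "\<eta> \<in> borel_measurable lebesgue" "hgrad op emb \<eta> \<in> borel_measurable lebesgue"
    using C1_0_lebesgue_measurable[OF \<eta>0(1)] by auto
  define N where "N = {x. hgrad op emb \<eta> x \<noteq> 0}"
  have N [measurable]: "N \<in> sets lebesgue"
    unfolding N_def by (rule sets_lebesgue_nonzero) measurable
  define e where "e n = inverse (real (Suc n))" for n
  have e: "0 < e n" "e n \<le> 1" for n
    by (auto simp: e_def inverse_le_1_iff)
  have e_lim: "e \<longlonglongrightarrow> 0"
    unfolding e_def[abs_def] by (rule LIMSEQ_inverse_real_of_nat)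
  define f where "f n x = H x * gam' p s (e n) (v x) * \<eta> x" for n x
  define g where "g x = H x * v x powr (s - 1) * \<eta> x" for x
  have f0: "0 \<le> f n x" for n x
    using gam_bounds(3)[OF p e(1) s(1) v_nonneg] \<eta>0(2) by (auto simp: f_def)
  have g0: "0 \<le> g x" for x using \<eta>0(2) by (simp add: g_def)
  have [measurable]: "f n \<in> borel_measurable lebesgue" "g \<in> borel_measurable lebesgue" for n
    unfolding f_def[abs_def] g_def[abs_def] gam'_def by measurable
  have Z: "AE x in lebesgue. \<eta> x \<noteq> 0 \<and> v x = 0 \<longrightarrow> h x = 0"
    by (rule flux_zero_on_zero_set[OF \<eta> \<delta> B])
  have lim: "AE x in lebesgue. (\<lambda>n. f n x) \<longlonglongrightarrow> s * g x"
    using Z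
  proof eventually_elim
    case (elim x)
    show ?case
    proof (cases "v x = 0")
      case True
      with elim have "H x * \<eta> x = 0" by auto
      then show ?thesis by (auto simp: f_def g_def)
    next
      case False
      then have "0 < v x" using v_nonneg[of x] by simp
      have "(\<lambda>n. f n x) \<longlonglongrightarrow> H x * (s * v x powr (s - 1)) * \<eta> x"
        unfolding f_def by (intro tendsto_intros gam'_tendsto p s e_lim \<open>0 < v x\<close>)
      then show ?thesis by (simp add: g_def mult_ac)
    qed
  qed
  have intf: "integrable lebesgue (f n)" for n
    using caccioppoli_approx(1)[OF s e \<eta> \<delta> B] by (simp add: f_def[abs_def])
  define M where "M = (B * s powr (- ((p - 1) / p)) / k) powr p * (\<integral>x. majorant \<eta> x \<partial>lebesgue)"
  have fM: "(\<integral>x. f n x \<partial>lebesgue) \<le> M" for n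
    using approx_energy_bound[OF s e \<eta> \<delta> B] by (simp add: f_def[abs_def] M_def)
  have "integrable lebesgue (\<lambda>x. s * g x)"
    by (rule integrable_bounded_limit[OF intf f0 fM lim]) measurable
  then have intg: "integrable lebesgue g"
    using s by simp
  then show "integrable lebesgue (\<lambda>x. H x * v x powr (s - 1) * \<eta> x)"
    by (simp add: g_def[abs_def])
  \<comment> \<open>From \<open>gam'_le\<close> and (v + e)^(s-1) <= 2^|s-1| (v^(s-1) + 1), which
    holds for v > 0 and either sign of s - 1.\<close>
  define D where "D x = s * 2 powr \<bar>s - 1\<bar> * (g x + indicator (closure {x. \<eta> x \<noteq> 0}) x * H x)" for x
  have intD: "integrable lebesgue D"
    unfolding D_def[abs_def]
    by (intro integrable_mult_right Bochner_Integration.integrable_add intg integrable_on_support \<eta>0(1))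
  have dom: "AE x in lebesgue. \<bar>f n x\<bar> \<le> D x" for n
    using Z
  proof eventually_elim
    case (elim x)
    have D0: "0 \<le> D x"
      using s g0[of x] by (auto simp: D_def intro!: mult_nonneg_nonneg add_nonneg_nonneg)
    show ?case
    proof (cases "v x = 0 \<or> \<eta> x = 0")
      case True
      with elim have "H x * \<eta> x = 0" by auto
      then show ?thesis using D0 by (auto simp: f_def)
    next
      case False
      then have vx: "0 < v x" and x: "x \<in> closure {x. \<eta> x \<noteq> 0}"
        using v_nonneg[of x] closure_subset[of "{x. \<eta> x \<noteq> 0}"] by auto
      have "gam' p s (e n) (v x) \<le> s * (2 powr \<bar>s - 1\<bar> * (v x powr (s - 1) + 1))"
        using gam'_le[OF p e(1)[of n] s(1) v_nonneg[of x]] powr_shift_le[OF vx less_imp_le[OF e(1)[of n]] e(2)[of n], of "s - 1"] s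
        by (meson mult_left_mono less_imp_le order_trans)
      then have "(H x * \<eta> x) * gam' p s (e n) (v x) \<le> (H x * \<eta> x) * (s * (2 powr \<bar>s - 1\<bar> * (v x powr (s - 1) + 1)))"
        using \<eta>0(2) by (intro mult_left_mono) auto
      then have "f n x \<le> s * 2 powr \<bar>s - 1\<bar> * (g x + H x * \<eta> x)"
        by (simp add: f_def g_def algebra_simps)
      also have "\<dots> \<le> D x"
        unfolding D_def using x s \<eta>0(2,3)[of x] by (intro mult_left_mono add_left_mono) (auto simp: mult_left_le)
      finally show ?thesis using f0 by simp
    qed
  qed
  have E: "(\<lambda>n. \<integral>x. f n x \<partial>lebesgue) \<longlonglongrightarrow> (\<integral>x. s * g x \<partial>lebesgue)"
    by (rule integral_dominated_convergence[OF _ _ intD lim]) (use dom in auto)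
  have T: "(\<lambda>n. \<integral>x. f n x * indicator N x \<partial>lebesgue) \<longlonglongrightarrow> (\<integral>x. s * g x * indicator N x \<partial>lebesgue)"
  proof (rule integral_dominated_convergence[OF _ _ intD])
    show "AE x in lebesgue. (\<lambda>n. f n x * indicator N x) \<longlonglongrightarrow> s * g x * indicator N x"
      using lim by eventually_elim (intro tendsto_intros)
    show "AE x in lebesgue. norm (f n x * indicator N x) \<le> D x" for n
      using dom[of n] by eventually_elim (auto simp: indicator_def split: if_splits)
  qed simp_all
  have r: "0 < s + p - 1" using s p by simp
  have W: "(\<lambda>n. \<integral>x. (v x + e n) powr (s + p - 1) * \<eta> x powr \<delta> \<partial>lebesgue) \<longlonglongrightarrow> (\<integral>x. v x powr (s + p - 1) * \<eta> x powr \<delta> \<partial>lebesgue)"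
  proof (rule integral_dominated_convergence[OF _ _ integrable_majorant[OF \<eta>0(1)]])
    show "AE x in lebesgue. (\<lambda>n. (v x + e n) powr (s + p - 1) * \<eta> x powr \<delta>) \<longlonglongrightarrow> v x powr (s + p - 1) * \<eta> x powr \<delta>"
    proof (rule AE_I2)
      fix x
      have "(\<lambda>n. (v x + e n) powr (s + p - 1)) \<longlonglongrightarrow> (v x + 0) powr (s + p - 1)"
        using r v_nonneg[of x] e(1) by (intro tendsto_powr' tendsto_intros e_lim) (auto intro!: always_eventually add_nonneg_nonneg less_imp_le)
      then show "(\<lambda>n. (v x + e n) powr (s + p - 1) * \<eta> x powr \<delta>) \<longlonglongrightarrow> v x powr (s + p - 1) * \<eta> x powr \<delta>"
        by (intro tendsto_mult tendsto_const) simp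
    qed
    show "AE x in lebesgue. norm ((v x + e n) powr (s + p - 1) * \<eta> x powr \<delta>) \<le> majorant \<eta> x" for n
      using le_majorant[of \<eta> \<delta> "s + p - 1" "e n"] \<eta>0 \<delta> r s e[of n] by (intro AE_I2) auto
  qed measurable
  have "(\<integral>x. s * g x \<partial>lebesgue) = s * (\<integral>x. g x \<partial>lebesgue)" "(\<integral>x. s * g x * indicator N x \<partial>lebesgue) = s * (\<integral>x. g x * indicator N x \<partial>lebesgue)"
    by (simp_all add: mult.assoc)
  note sE = this
  let ?a = "(p - 1) / p"
  have a: "0 < ?a" "0 < 1 / p" using p by auto
  have "k * (\<integral>x. s * g x \<partial>lebesgue) \<le> (B * s powr (- ?a)) * ((\<integral>x. s * g x * indicator N x \<partial>lebesgue) powr ?a *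
       (\<integral>x. v x powr (s + p - 1) * \<eta> x powr \<delta> \<partial>lebesgue) powr (1 / p))"
  proof (rule LIMSEQ_le)
    show "(\<lambda>n. k * (\<integral>x. f n x \<partial>lebesgue)) \<longlonglongrightarrow> k * (\<integral>x. s * g x \<partial>lebesgue)"
      by (intro tendsto_intros E)
    show "(\<lambda>n. (B * s powr (- ?a)) * ((\<integral>x. f n x * indicator N x \<partial>lebesgue) powr ?a *
       (\<integral>x. (v x + e n) powr (s + p - 1) * \<eta> x powr \<delta> \<partial>lebesgue) powr (1 / p))) \<longlonglongrightarrow>
       (B * s powr (- ?a)) * ((\<integral>x. s * g x * indicator N x \<partial>lebesgue) powr ?a *
       (\<integral>x. v x powr (s + p - 1) * \<eta> x powr \<delta> \<partial>lebesgue) powr (1 / p))"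
      using a f0 by (intro tendsto_mult tendsto_const tendsto_powr' T W) (auto intro!: always_eventually)
    show "\<exists>n0. \<forall>n\<ge>n0. k * (\<integral>x. f n x \<partial>lebesgue) \<le> (B * s powr (- ?a)) * ((\<integral>x. f n x * indicator N x \<partial>lebesgue) powr ?a *
       (\<integral>x. (v x + e n) powr (s + p - 1) * \<eta> x powr \<delta> \<partial>lebesgue) powr (1 / p))"
      using caccioppoli_approx(2)[OF s e \<eta> \<delta> B] by (simp add: f_def[abs_def] N_def)
  qed
  also have "\<dots> = B * ((s powr (- ?a) * s powr ?a) * ((\<integral>x. g x * indicator N x \<partial>lebesgue) powr ?a *
       (\<integral>x. v x powr (s + p - 1) * \<eta> x powr \<delta> \<partial>lebesgue) powr (1 / p)))"
    by (simp add: sE powr_mult mult_ac)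
  also have "s powr (- ?a) * s powr ?a = 1"
    using s by (simp flip: powr_add)
  finally show "k * s * (\<integral>x. H x * v x powr (s - 1) * \<eta> x \<partial>lebesgue) \<le> B *
      ((\<integral>x. H x * v x powr (s - 1) * \<eta> x * indicator {x. hgrad op emb \<eta> x \<noteq> 0} x \<partial>lebesgue) powr ((p - 1) / p) *
       (\<integral>x. v x powr (s + p - 1) * \<eta> x powr \<delta> \<partial>lebesgue) powr (1 / p))"
    by (simp add: sE g_def[abs_def] N_def mult.assoc)
qed

section \<open>Energy and flux in terms of the integral of v^q\<close>

lemma energy_bound:
  assumes s: "0 < s" "s + p - 1 \<le> q"
    and \<eta>: "cutoff p \<delta> B \<eta>" and \<delta>: "0 \<le> \<delta>" and B: "0 \<le> B"
  shows "(\<integral>x. H x * v x powr (s - 1) * \<eta> x \<partial>lebesgue)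
    \<le> (B / (k * s)) powr p * (\<integral>x. v x powr (s + p - 1) * \<eta> x powr \<delta> \<partial>lebesgue)"
proof -
  have \<eta>0: "C1_0 \<eta>" "\<And>x. 0 \<le> \<eta> x"
    using \<eta> by (auto simp: cutoff_def)
  define g where "g x = H x * v x powr (s - 1) * \<eta> x" for x
  define N where "N = {x. hgrad op emb \<eta> x \<noteq> 0}"
  have [measurable]: "hgrad op emb \<eta> \<in> borel_measurable lebesgue"
    using C1_0_lebesgue_measurable[OF \<eta>0(1)] by auto
  have N [measurable]: "N \<in> sets lebesgue"
    unfolding N_def by (rule sets_lebesgue_nonzero) measurable
  have g0: "0 \<le> g x" for x using \<eta>0(2) by (simp add: g_def)
  have intg: "integrable lebesgue g"
    using caccioppoli(1)[OF assms] by (simp add: g_def[abs_def])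
  have intN: "integrable lebesgue (\<lambda>x. g x * indicator N x)"
    by (rule integrable_times_indicator[OF intg N])
  have "(\<integral>x. g x * indicator N x \<partial>lebesgue) \<le> (\<integral>x. g x \<partial>lebesgue)"
    by (rule integral_mono[OF intN intg]) (use g0 in \<open>auto simp: indicator_def\<close>)
  moreover have "0 \<le> (\<integral>x. g x * indicator N x \<partial>lebesgue)" using g0 by simp
  ultimately have "(\<integral>x. g x * indicator N x \<partial>lebesgue) powr ((p - 1) / p) \<le> (\<integral>x. g x \<partial>lebesgue) powr ((p - 1) / p)"
    using p by (intro powr_mono2) auto
  then have "B * ((\<integral>x. g x * indicator N x \<partial>lebesgue) powr ((p - 1) / p) * (\<integral>x. v x powr (s + p - 1) * \<eta> x powr \<delta> \<partial>lebesgue) powr (1 / p))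
    \<le> B * ((\<integral>x. g x \<partial>lebesgue) powr ((p - 1) / p) * (\<integral>x. v x powr (s + p - 1) * \<eta> x powr \<delta> \<partial>lebesgue) powr (1 / p))"
    using B by (intro mult_left_mono mult_right_mono) auto
  then have "(k * s) * (\<integral>x. g x \<partial>lebesgue) \<le> B * ((\<integral>x. g x \<partial>lebesgue) powr ((p - 1) / p) * (\<integral>x. v x powr (s + p - 1) * \<eta> x powr \<delta> \<partial>lebesgue) powr (1 / p))"
    using caccioppoli(2)[OF assms] by (simp add: g_def[abs_def] N_def)
  from absorb_powr[OF this p] show ?thesis
    using g0 k s B by (simp add: g_def[abs_def])
qed

text \<open>Hoelder's inequality between v^q \<eta> and the indicator of the support. As \<eta> <=
  1, the condition r/q <= \<delta> lets \<eta>^\<delta> be replaced by the exact weight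
  \<eta>^(r/q).\<close>

lemma weighted_power_le:
  assumes r: "0 < r" "r < q" "r / q \<le> \<delta>" and \<eta>: "cutoff p \<delta> B \<eta>"
  shows "(\<integral>x. v x powr r * \<eta> x powr \<delta> \<partial>lebesgue) \<le>
    (\<integral>x. v x powr q * \<eta> x \<partial>lebesgue) powr (r / q) * (\<integral>x. indicator {x. \<eta> x \<noteq> 0} x \<partial>lebesgue) powr (1 - r / q)"
proof -
  have \<eta>0: "C1_0 \<eta>" "\<And>x. 0 \<le> \<eta> x" "\<And>x. \<eta> x \<le> 1"
    using \<eta> by (auto simp: cutoff_def)
  have q0: "0 < q" using r by simp
  have \<delta>0: "0 \<le> \<delta>" using r q0 by (meson divide_nonneg_pos less_imp_le order_trans)
  have [measurable]: "\<eta> \<in> borel_measurable lebesgue"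
    using C1_0_lebesgue_measurable[OF \<eta>0(1)] by auto
  have [measurable]: "{x. \<eta> x \<noteq> 0} \<in> sets lebesgue"
    by (rule sets_lebesgue_nonzero) measurable
  have sub: "{x. \<eta> x \<noteq> 0} \<subseteq> closure {x. \<eta> x \<noteq> 0}" by (rule closure_subset)
  have i1: "integrable lebesgue (\<lambda>x. v x powr q * \<eta> x)"
    using \<eta>0 by (intro integrable_times_cutoff) auto
  have i2: "integrable lebesgue (indicator {x. \<eta> x \<noteq> 0} :: _ \<Rightarrow> real)"
    by (rule Bochner_Integration.integrable_bound[OF integrable_on_support(3)[OF \<eta>0(1)]])
      (use sub in \<open>auto simp: indicator_def\<close>)
  have ab: "0 < r / q" "0 < 1 - r / q" "r / q + (1 - r / q) = 1"
    using r q0 by (auto simp: field_simps)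
  note Ho = Holder_powr[OF i1 i2 _ _ ab]
  have pt: "v x powr r * \<eta> x powr \<delta> \<le> (v x powr q * \<eta> x) powr (r / q) * indicator {x. \<eta> x \<noteq> 0} x powr (1 - r / q)" for x
  proof (cases "\<eta> x = 0")
    case False
    have "\<eta> x powr \<delta> \<le> \<eta> x powr (r / q)"
      using \<eta>0(2,3) r by (intro powr_mono') auto
    then have "v x powr r * \<eta> x powr \<delta> \<le> v x powr r * \<eta> x powr (r / q)"
      by (rule mult_left_mono) simp
    then show ?thesis
      using False q0 by (simp add: powr_mult powr_powr)
  qed simp
  have "integrable lebesgue (\<lambda>x. v x powr r * \<eta> x powr \<delta>)"
    using integrable_weighted_power[OF \<eta> \<delta>0, of r 0] r by simp
  then have "(\<integral>x. v x powr r * \<eta> x powr \<delta> \<partial>lebesgue) \<le> (\<integral>x. (v x powr q * \<eta> x) powr (r / q) * indicator {x. \<eta> x \<noteq> 0} x powr (1 - r / q) \<partial>lebesgue)"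
    using Ho(1) \<eta>0(2) by (intro integral_mono pt) auto
  also have "\<dots> \<le> (\<integral>x. v x powr q * \<eta> x \<partial>lebesgue) powr (r / q) * (\<integral>x. indicator {x. \<eta> x \<noteq> 0} x \<partial>lebesgue) powr (1 - r / q)"
    by (rule Ho(2)) (use \<eta>0(2) in auto)
  finally show ?thesis .
qed

text \<open>Write |h| as the energy density H v^(s-1) to the power (p-1)/p times a compensating
  power of v, and apply Hoelder's inequality. The energy and the remaining factor are both bounded
  through \<open>weighted_power_le\<close>. Here h = 0 on {v = 0} justifies the splitting.\<close>

lemma flux_bound:
  assumes \<eta>: "cutoff p ((small + p - 1) / q) B \<eta>" and B: "0 \<le> B"
  shows "\<bar>\<integral>x. h x \<bullet> hgrad op emb \<eta> x \<partial>lebesgue\<bar> \<le> (k * small) powr (- (p - 1)) * B powr p *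
    (\<integral>x. v x powr q * \<eta> x \<partial>lebesgue) powr ((p - 1) / q) * (\<integral>x. indicator {x. \<eta> x \<noteq> 0} x \<partial>lebesgue) powr (1 - (p - 1) / q)"
proof -
  define s where "s = small"
  have s: "0 < s" "s < 1" "s + p - 1 < q" "s + p - 1 \<le> q"
    using small by (auto simp: s_def)
  \<comment> \<open>\<open>r1\<close> is the power of v in the energy bound; \<open>r2\<close> is
    the one whose p-th root cancels v^((s-1)(p-1)/p). Since r2 <= r1, the value \<delta> = r1 / q
    meets the weight condition for both.\<close>
  define r1 r2 \<delta> where "r1 = s + p - 1" and "r2 = (1 - s) * (p - 1)" and "\<delta> = r1 / q"
  have q0: "0 < q" using p q by simp
  have r: "0 < r1" "r1 < q" "0 < r2" "r2 \<le> r1"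
  proof -
    show "0 < r1" "r1 < q" using s p by (auto simp: r1_def)
    show "0 < r2" using s p by (simp add: r2_def)
    have "r2 \<le> 1 * (p - 1)"
      unfolding r2_def using s p by (intro mult_right_mono) auto
    then show "r2 \<le> r1" using s by (simp add: r1_def)
  qed
  have \<delta>: "0 \<le> \<delta>" "r1 / q \<le> \<delta>" "r2 / q \<le> \<delta>"
    using r q0 by (auto simp: \<delta>_def divide_right_mono)
  have \<eta>': "cutoff p \<delta> B \<eta>"
    using \<eta> by (simp add: \<delta>_def r1_def s_def)
  have \<eta>0: "C1_0 \<eta>" "\<And>x. 0 \<le> \<eta> x" "\<And>x. \<eta> x \<le> 1" "\<And>x. norm (hgrad op emb \<eta> x) \<le> B * \<eta> x powr ((p - 1 + \<delta>) / p)"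
    using \<eta>' by (auto simp: cutoff_def)
  have [measurable]: "\<eta> \<in> borel_measurable lebesgue" "hgrad op emb \<eta> \<in> borel_measurable lebesgue"
    using C1_0_lebesgue_measurable[OF \<eta>0(1)] by auto
  define a b where "a = (p - 1) / p" and "b = 1 / p"
  have ab: "0 < a" "0 < b" "a + b = 1"
    using p by (auto simp: a_def b_def field_simps)
  define g where "g x = H x * v x powr (s - 1) * \<eta> x" for x
  define w where "w x = v x powr r2 * \<eta> x powr \<delta>" for x
  have g0: "0 \<le> g x" and w0: "0 \<le> w x" for x using \<eta>0(2) by (auto simp: g_def w_def)
  have intg: "integrable lebesgue g"
    using caccioppoli(1)[OF s(1,4) \<eta>' \<delta>(1) B] by (simp add: g_def[abs_def])
  have intw: "integrable lebesgue w"
    using integrable_weighted_power[OF \<eta>' \<delta>(1), of r2 0] r by (simp add: w_def[abs_def])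
  note Ho = Holder_powr[OF intg intw g0 w0 ab]
  have pt: "AE x in lebesgue. \<bar>h x \<bullet> hgrad op emb \<eta> x\<bar> \<le> B * (g x powr a * w x powr b)"
    using flux_zero_on_zero_set[OF \<eta>' \<delta>(1) B]
  proof eventually_elim
    case (elim x)
    have "\<bar>h x \<bullet> hgrad op emb \<eta> x\<bar> \<le> norm (h x) * norm (hgrad op emb \<eta> x)"
      by (rule Cauchy_Schwarz_ineq2)
    also have "\<dots> \<le> norm (h x) * (B * \<eta> x powr ((p - 1 + \<delta>) / p))"
      by (intro mult_left_mono \<eta>0) simp
    also have "\<dots> \<le> B * (g x powr a * w x powr b)"
    proof (cases "v x = 0 \<or> \<eta> x = 0")
      case True
      with elim have z: "norm (h x) * (B * \<eta> x powr ((p - 1 + \<delta>) / p)) = 0" by auto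
      show ?thesis unfolding z using B by simp
    next
      case False
      then have vx: "0 < v x" using v_nonneg[of x] by simp
      have ex: "(p - 1 + \<delta>) / p = a + \<delta> * b" "r2 * b = - ((s - 1) * a)"
        using p by (simp_all add: a_def b_def r2_def field_simps)
      have hH: "norm (h x) = H x powr a"
        using p by (simp add: powr_powr a_def)
      have "g x powr a * w x powr b = H x powr a * (v x powr ((s - 1) * a) * v x powr (r2 * b)) * (\<eta> x powr a * \<eta> x powr (\<delta> * b))"
        by (simp only: g_def w_def powr_mult powr_powr mult_ac)
      also have "v x powr ((s - 1) * a) * v x powr (r2 * b) = 1"
        unfolding ex(2) powr_add[symmetric] using vx by simp
      also have "\<eta> x powr a * \<eta> x powr (\<delta> * b) = \<eta> x powr ((p - 1 + \<delta>) / p)"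
        unfolding ex(1) powr_add ..
      finally show ?thesis using hH by (simp add: mult_ac)
    qed
    finally show ?case .
  qed
  have intR: "integrable lebesgue (\<lambda>x. B * (g x powr a * w x powr b))"
    by (intro integrable_mult_right Ho(1))
  have intL: "integrable lebesgue (\<lambda>x. h x \<bullet> hgrad op emb \<eta> x)"
    by (rule Bochner_Integration.integrable_bound[OF intR])
      (use pt in \<open>auto elim!: eventually_mono intro: order_trans[OF _ abs_ge_self]\<close>)
  let ?X = "\<integral>x. g x \<partial>lebesgue" and ?W1 = "\<integral>x. v x powr r1 * \<eta> x powr \<delta> \<partial>lebesgue" and ?W2 = "\<integral>x. w x \<partial>lebesgue"
  let ?V = "\<integral>x. v x powr q * \<eta> x \<partial>lebesgue" and ?A = "\<integral>x. indicator {x. \<eta> x \<noteq> 0} x \<partial>lebesgue"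
  have W1: "?W1 \<le> ?V powr (r1 / q) * ?A powr (1 - r1 / q)"
    by (rule weighted_power_le[OF r(1,2) \<delta>(2) \<eta>'])
  have W2: "?W2 \<le> ?V powr (r2 / q) * ?A powr (1 - r2 / q)"
    unfolding w_def using r by (intro weighted_power_le[OF r(3) _ \<delta>(3) \<eta>']) simp
  have X: "?X \<le> (B / (k * s)) powr p * ?W1"
    using energy_bound[OF s(1,4) \<eta>' \<delta>(1) B] by (simp add: g_def[abs_def] r1_def)
  have "\<bar>\<integral>x. h x \<bullet> hgrad op emb \<eta> x \<partial>lebesgue\<bar> \<le> (\<integral>x. \<bar>h x \<bullet> hgrad op emb \<eta> x\<bar> \<partial>lebesgue)"
    by (rule integral_abs_bound)
  also have "\<dots> \<le> (\<integral>x. B * (g x powr a * w x powr b) \<partial>lebesgue)"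
    by (rule integral_mono_AE[OF integrable_abs[OF intL] intR pt])
  also have "\<dots> \<le> B * (?X powr a * ?W2 powr b)"
    using Ho(2) B by (simp add: mult_left_mono)
  also have "\<dots> \<le> B * (((B / (k * s)) powr p * (?V powr (r1 / q) * ?A powr (1 - r1 / q))) powr a * (?V powr (r2 / q) * ?A powr (1 - r2 / q)) powr b)"
  proof (intro mult_left_mono B mult_mono powr_mono2)
    show "?X \<le> (B / (k * s)) powr p * (?V powr (r1 / q) * ?A powr (1 - r1 / q))"
      using X W1 by (meson mult_left_mono order_trans powr_ge_zero)
  qed (use W2 ab g0 w0 in auto)
  also have "\<dots> = (B * (B / (k * s)) powr (p * a)) * (?V powr (r1 / q * a) * ?V powr (r2 / q * b)) * (?A powr ((1 - r1 / q) * a) * ?A powr ((1 - r2 / q) * b))"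
    by (simp only: powr_mult powr_powr mult_ac)
  \<comment> \<open>The auxiliary s drops out of the exponent because r1 (p - 1) + r2 = p (p -
    1).\<close>
  also have "?V powr (r1 / q * a) * ?V powr (r2 / q * b) = ?V powr ((p - 1) / q)"
  proof -
    have "r1 * (p - 1) + r2 = p * (p - 1)" by (simp add: r1_def r2_def algebra_simps)
    moreover have "r1 / q * a + r2 / q * b = (r1 * (p - 1) + r2) / (p * q)"
      by (simp add: a_def b_def add_divide_distrib mult.commute)
    ultimately have "r1 / q * a + r2 / q * b = (p - 1) / q"
      using p by simp
    then show ?thesis by (simp flip: powr_add)
  qed
  also have "?A powr ((1 - r1 / q) * a) * ?A powr ((1 - r2 / q) * b) = ?A powr (1 - (p - 1) / q)"
  proof -
    have "r1 * (p - 1) + r2 = p * (p - 1)" by (simp add: r1_def r2_def algebra_simps)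
    moreover have "r1 / q * a + r2 / q * b = (r1 * (p - 1) + r2) / (p * q)"
      by (simp add: a_def b_def add_divide_distrib mult.commute)
    ultimately have "r1 / q * a + r2 / q * b = (p - 1) / q"
      using p by simp
    then have "(1 - r1 / q) * a + (1 - r2 / q) * b = 1 - (p - 1) / q"
      using ab(3) by (simp add: algebra_simps)
    then show ?thesis by (simp flip: powr_add)
  qed
  also have "B * (B / (k * s)) powr (p * a) = (k * s) powr (- (p - 1)) * B powr p"
  proof -
    have pa: "p * a = p - 1" using p by (simp add: a_def)
    have "B powr p = B powr (1 + (p - 1))" by simp
    also have "\<dots> = B * B powr (p - 1)" unfolding powr_add using B by simp
    finally have "B powr p = B * B powr (p - 1)" .
    moreover have "(B / (k * s)) powr (p * a) = B powr (p - 1) / (k * s) powr (p - 1)"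
      unfolding pa using B k s by (simp add: powr_divide)
    moreover have "(k * s) powr (- (p - 1)) = 1 / (k * s) powr (p - 1)"
      by (rule powr_minus_divide)
    ultimately show ?thesis
      by (simp only: mult_1 times_divide_eq_left times_divide_eq_right)
  qed
  finally show ?thesis by (simp add: s_def)
qed

end

section \<open>Cut-off functions\<close>

context carnot
begin

text \<open>Equal to 1 on the unit ball and positive only for |x|^2 < 2. Its negative values are
  clipped only in \<open>eta\<close>, where the power m of the positive part keeps the function
  C1.\<close>

definition bump :: "real^'n \<Rightarrow> real" where
  "bump x = 1 - (max 0 (x \<bullet> x - 1)) ^ 2"

definition eta :: "nat \<Rightarrow> real \<Rightarrow> real^'n \<Rightarrow> real" where
  "eta m R x = (max 0 (bump (dil deg (1 / R) x))) ^ m"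

lemma C1_bump: "C1 bump"
proof -
  have sq: "C1 (\<lambda>x::real^'n. - (1 - x \<bullet> x))"
    by (rule C1_compose[OF C1_bounded_linear C1_const_minus_norm_square])
      (rule bounded_linear_minus[OF bounded_linear_ident])
  have "C1 (\<lambda>x::real^'n. (max 0 (x \<bullet> x - 1)) ^ 2)"
    using C1_pos_part_power[OF _ sq, of 2] by simp
  from C1_has_derivative[OF this] have
    "(bump has_derivative (\<lambda>h. 0 - frechet_derivative (\<lambda>x. (max 0 (x \<bullet> x - 1)) ^ 2) (at x) h)) (at x)" for x
    unfolding bump_def[abs_def] by (intro has_derivative_diff has_derivative_const)
  then show ?thesis
    by (rule C1I) (intro continuous_intros C1_derivative_continuous \<open>C1 (\<lambda>x. (max 0 (x \<bullet> x - 1)) ^ 2)\<close>)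
qed

lemma bump_pos: "0 < bump x \<Longrightarrow> x \<bullet> x < 2"
proof (rule ccontr)
  assume b: "0 < bump x" and "\<not> x \<bullet> x < 2"
  then have "1 ^ 2 \<le> (max 0 (x \<bullet> x - 1)) ^ 2" by (intro power_mono) auto
  then show False using b by (simp add: bump_def)
qed

lemma bump_eq_1: "norm x \<le> 1 \<Longrightarrow> bump x = 1"
proof -
  assume "norm x \<le> 1"
  then have "x \<bullet> x \<le> 1"
    by (simp add: power2_norm_eq_inner[symmetric] abs_square_le_1)
  then show "bump x = 1"
    by (simp add: bump_def max_def)
qed

lemma bump_le_1: "bump x \<le> 1"
  by (simp add: bump_def)

lemma norm_dil_le:
  assumes "0 \<le> r" "r \<le> 1" shows "norm (dil deg r x) \<le> r * norm x"
proof -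
  have "norm (dil deg r x) \<le> norm (r *\<^sub>R x)"
  proof (rule norm_le_componentwise_cart)
    fix i
    have "r ^ deg i \<le> r ^ 1"
      using assms deg_ge by (intro power_decreasing) auto
    then show "norm (dil deg r x $ i) \<le> norm ((r *\<^sub>R x) $ i)"
      using assms by (simp add: dil_def abs_mult mult_right_mono)
  qed
  then show ?thesis using assms by simp
qed

lemma C1_eta: "2 \<le> m \<Longrightarrow> C1 (eta m R)"
  unfolding eta_def[abs_def]
  by (intro C1_pos_part_power C1_compose[OF C1_bump] C1_bounded_linear bounded_linear_dil)

lemma eta_bounds: "0 \<le> eta m R x" "eta m R x \<le> 1"
  using bump_le_1 by (auto simp: eta_def intro!: power_le_one)

lemma eta_nonzero:
  assumes "eta m R x \<noteq> 0" "0 < m" shows "dil deg (1 / R) x \<bullet> dil deg (1 / R) x < 2"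
  using assms by (intro bump_pos) (auto simp: eta_def max_def split: if_splits)

lemma eta_eq_1: "1 \<le> R \<Longrightarrow> norm x \<le> R \<Longrightarrow> eta m R x = 1"
proof -
  assume R: "1 \<le> R" and x: "norm x \<le> R"
  have "norm (dil deg (1 / R) x) \<le> 1 / R * norm x"
    using R by (intro norm_dil_le) auto
  also have "\<dots> \<le> 1" using R x by (simp add: divide_le_eq)
  finally show ?thesis by (simp add: eta_def bump_eq_1)
qed

text \<open>On the support the rescaled point has norm below 2. A dilation by 1/2 at least halves
  the norm, as all degrees are at least 1, and so reaches the unit ball, where \<open>bump\<close>
  is 1.\<close>

lemma eta_double:
  assumes "1 \<le> R" "0 < m" "eta m R x \<noteq> 0" shows "eta m (2 * R) x = 1"
proof -
  let ?y = "dil deg (1 / R) x"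
  have "(norm ?y)\<^sup>2 < 2\<^sup>2"
    using eta_nonzero[OF assms(3,2)] by (simp add: power2_norm_eq_inner)
  then have "norm ?y < 2"
    by (rule power2_less_imp_less) simp
  then have "norm (dil deg (1 / 2) ?y) \<le> 1"
    using norm_dil_le[of "1/2" ?y] by simp
  moreover have "dil deg (1 / 2) ?y = dil deg (1 / (2 * R)) x"
    by (simp add: dil_dil)
  ultimately show ?thesis by (simp add: eta_def bump_eq_1)
qed

text \<open>The image of the cube [-2, 2]^N under the dilation by R. Its volume 4^N R^Q is where the
  homogeneous dimension enters.\<close>

definition support_box :: "real \<Rightarrow> (real^'n) set" where
  "support_box R = cbox (\<chi> i. - (2 * R ^ deg i)) (\<chi> i. 2 * R ^ deg i)"

lemma eta_support:
  assumes "0 < R" "0 < m" shows "{x. eta m R x \<noteq> 0} \<subseteq> support_box R"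
proof
  fix x assume "x \<in> {x. eta m R x \<noteq> 0}"
  then have "(norm (dil deg (1 / R) x))\<^sup>2 < 2\<^sup>2"
    using eta_nonzero[of m R x] assms by (simp add: power2_norm_eq_inner)
  then have n: "norm (dil deg (1 / R) x) < 2"
    by (rule power2_less_imp_less) simp
  have "\<bar>x $ i\<bar> \<le> 2 * R ^ deg i" for i
  proof -
    have "\<bar>dil deg (1 / R) x $ i\<bar> < 2"
      using component_le_norm_cart[of "dil deg (1 / R) x" i] n by simp
    then have "\<bar>x $ i\<bar> / R ^ deg i < 2"
      using assms by (simp add: dil_def power_divide abs_mult)
    then show ?thesis using assms by (simp add: field_simps)
  qed
  then show "x \<in> support_box R"
    by (simp add: support_box_def mem_box_cart abs_le_iff minus_le_iff)
qed

lemma C1_0_eta: "0 < R \<Longrightarrow> 2 \<le> m \<Longrightarrow> C1_0 (eta m R)"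
  using bounded_subset[OF _ eta_support[of R m]] compact_imp_bounded[of "support_box R"]
  by (simp add: C1_0_iff C1_eta compact_closure support_box_def bounded_cbox)

lemma measure_eta_support:
  assumes "0 < R" "2 \<le> m"
  shows "(\<integral>x. indicator {x. eta m R x \<noteq> 0} x \<partial>lebesgue) \<le> 4 ^ CARD('n) * R powr hom_dim deg"
proof -
  have [measurable]: "eta m R \<in> borel_measurable lebesgue"
    using assms by (intro borel_lebesgue C1_measurable C1_eta)
  have S: "{x. eta m R x \<noteq> 0} \<in> sets lebesgue"
    by (rule sets_lebesgue_nonzero) measurable
  have "(\<integral>x. indicator {x. eta m R x \<noteq> 0} x \<partial>lebesgue) = measure lebesgue {x. eta m R x \<noteq> 0}"
    using S by simp
  also have "\<dots> \<le> measure lebesgue (support_box R)"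
    using assms S by (intro measure_mono_fmeasurable eta_support) (auto simp: support_box_def)
  also have "\<dots> = measure lborel (support_box R)"
    by (simp add: support_box_def)
  also have "\<dots> = (\<Prod>i\<in>UNIV. 4 * R ^ deg i)"
  proof -
    have "0 \<in> support_box R"
      using assms by (simp add: support_box_def mem_box_cart)
    then have ne: "support_box R \<noteq> {}" by auto
    show ?thesis
      using content_cbox_cart[OF ne[unfolded support_box_def]] by (simp add: support_box_def)
  qed
  also have "\<dots> = 4 ^ CARD('n) * R ^ (\<Sum>i\<in>UNIV. deg i)"
    by (simp add: prod.distrib power_sum)
  also have "R ^ (\<Sum>i\<in>UNIV. deg i) = R powr hom_dim deg"
    unfolding hom_dim_def using assms by (simp only: powr_realpow)
  finally show ?thesis .
qed

lemma hgrad_dil: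
  assumes "C1 \<phi>" "0 < r"
  shows "hgrad op emb (\<lambda>x. \<phi> (dil deg r x)) x = r *\<^sub>R hgrad op emb \<phi> (dil deg r x)"
proof -
  have der: "((\<lambda>x. \<phi> (dil deg r x)) has_derivative (\<lambda>v. frechet_derivative \<phi> (at (dil deg r x)) (dil deg r v))) (at x)"
    by (rule has_derivative_compose[OF bounded_linear_imp_has_derivative[OF bounded_linear_dil] C1_has_derivative[OF assms(1)]])
  have lin: "linear (frechet_derivative \<phi> (at y))" for y
    by (rule has_derivative_linear[OF C1_has_derivative[OF assms(1)]])
  show ?thesis
    unfolding hgrad_eqI[OF der] by (simp add: vec_eq_iff hgrad_def hfield_dil[OF assms(2), symmetric] linear_cmul[OF lin])
qed

lemma hgrad_power_pos_part:
  assumes "2 \<le> m" "C1 \<phi>"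
  shows "hgrad op emb (\<lambda>x. (max 0 (\<phi> x)) ^ m) x = (real m * (max 0 (\<phi> x)) ^ (m - 1)) *\<^sub>R hgrad op emb \<phi> x"
proof -
  have "((\<lambda>x. (max 0 (\<phi> x)) ^ m) has_derivative (\<lambda>v. real m * (max 0 (\<phi> x)) ^ (m - 1) * frechet_derivative \<phi> (at x) v)) (at x)"
    by (rule has_derivative_compose[OF C1_has_derivative[OF assms(2)] pos_part_power_derivative[OF assms(1), unfolded has_field_derivative_def]])
  from hgrad_eqI[OF this] show ?thesis
    by (simp add: vec_eq_iff hgrad_def)
qed

text \<open>Scaling gives the factor 1/R, and differentiating an m-th power leaves the power m - 1,
  that is \<eta>^(1-1/m). The gradient of \<open>bump\<close> matters only where \<open>bump\<close>
  is positive, inside a fixed ball, hence C does not depend on R.\<close>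

lemma eta_gradient:
  assumes m: "2 \<le> m"
  shows "\<exists>C\<ge>0. \<forall>R x. 0 < R \<longrightarrow> norm (hgrad op emb (eta m R) x) \<le> C / R * eta m R x powr (1 - 1 / m)"
proof -
  have "bounded (hgrad op emb bump ` cball 0 2)"
    by (intro compact_imp_bounded compact_continuous_image hgrad_continuous C1_bump compact_cball)
  then obtain M where "\<forall>y\<in>cball 0 2. norm (hgrad op emb bump y) \<le> M"
    by (auto simp: bounded_iff)
  then have M: "norm (hgrad op emb bump y) \<le> M" if "norm y \<le> 2" for y
    using that by simp
  have M0: "0 \<le> M" using order_trans[OF norm_ge_zero M[of 0]] by simp
  have "norm (hgrad op emb (eta m R) x) \<le> real m * M / R * eta m R x powr (1 - 1 / m)" if R: "0 < R" for R x
  proof -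
    define y where "y = dil deg (1 / R) x"
    define b where "b = max 0 (bump y)"
    have C: "C1 (\<lambda>y. (max 0 (bump y)) ^ m)" by (rule C1_pos_part_power[OF m C1_bump])
    have g: "hgrad op emb (eta m R) x = (1 / R) *\<^sub>R ((real m * b ^ (m - 1)) *\<^sub>R hgrad op emb bump y)"
      unfolding eta_def[abs_def] using R by (simp add: hgrad_dil[OF C] hgrad_power_pos_part[OF m C1_bump] y_def b_def)
    have b0: "0 \<le> b" by (simp add: b_def)
    have pw: "eta m R x powr (1 - 1 / m) = b ^ (m - 1)"
    proof (cases "b = 0")
      case True
      then show ?thesis using m by (simp add: eta_def b_def y_def power_0_left)
    next
      case False
      then have "0 < b" using b0 by simp
      then have "(b ^ m) powr (1 - 1 / m) = b powr (real m * (1 - 1 / m))"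
        by (simp add: powr_realpow[symmetric] powr_powr)
      also have "real m * (1 - 1 / m) = real (m - 1)"
        using m by (simp add: field_simps of_nat_diff)
      finally show ?thesis
        using \<open>0 < b\<close> by (simp add: powr_realpow eta_def b_def y_def)
    qed
    have "b ^ (m - 1) * norm (hgrad op emb bump y) \<le> b ^ (m - 1) * M"
    proof (cases "b = 0")
      case False
      then have "y \<bullet> y < 2" by (intro bump_pos) (auto simp: b_def max_def split: if_splits)
      then have "(norm y)\<^sup>2 < 2\<^sup>2" by (simp add: power2_norm_eq_inner)
      then have "norm y < 2" by (rule power2_less_imp_less) simp
      then show ?thesis using b0 M[of y] by (intro mult_left_mono) auto
    qed (use m in \<open>simp add: power_0_left\<close>)
    then have "real m / R * (b ^ (m - 1) * norm (hgrad op emb bump y)) \<le> real m / R * (b ^ (m - 1) * M)"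
      by (rule mult_left_mono) (use R in simp)
    then show ?thesis
      unfolding g pw using R b0 by (simp add: mult_ac)
  qed
  then show ?thesis using M0 by (intro exI[of _ "real m * M"]) auto
qed

text \<open>The hypothesis p <= (1 - \<delta>) m is equivalent to (p - 1 + \<delta>)/p <= 1 - 1/m;
  as \<eta> <= 1, the smaller exponent gives the weaker bound.\<close>

lemma cutoff_eta:
  assumes m: "2 \<le> m" and R: "0 < R" and C: "0 \<le> C" and p: "1 < p" and \<delta>: "p \<le> (1 - \<delta>) * m"
    and grad: "\<And>x. norm (hgrad op emb (eta m R) x) \<le> C / R * eta m R x powr (1 - 1 / m)"
  shows "cutoff p \<delta> (C / R) (eta m R)"
proof -
  have "(p - 1 + \<delta>) / p \<le> 1 - 1 / m"
    using m p \<delta> by (simp add: field_simps)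
  then have "eta m R x powr (1 - 1 / m) \<le> eta m R x powr ((p - 1 + \<delta>) / p)" for x
    using eta_bounds by (intro powr_mono') auto
  then have "C / R * eta m R x powr (1 - 1 / m) \<le> C / R * eta m R x powr ((p - 1 + \<delta>) / p)" for x
    using C R by (intro mult_left_mono) auto
  then show ?thesis
    using grad eta_bounds C1_0_eta[OF R m] unfolding cutoff_def by (meson order_trans)
qed

lemma hgrad_eta_zero:
  assumes "1 \<le> R" "norm x < R" shows "hgrad op emb (eta m R) x = 0"
proof -
  have "(eta m R has_derivative (\<lambda>_. 0)) (at x)"
    by (rule has_derivative_transform_within_open[OF has_derivative_const[of 1], of "ball 0 R"])
      (use assms eta_eq_1 in auto)
  from hgrad_eqI[OF this] show ?thesis by (simp add: vec_eq_iff)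
qed

end

section \<open>The Liouville theorem\<close>

context carnot
begin

lemma zero_if_eta_integrals:
  fixes w :: "real^'n \<Rightarrow> real"
  assumes m: "2 \<le> m" and w0: "\<And>x. 0 \<le> w x"
    and int: "\<And>R. 1 \<le> R \<Longrightarrow> integrable lebesgue (\<lambda>x. w x * eta m R x)"
    and le: "\<And>R. 1 \<le> R \<Longrightarrow> (\<integral>x. w x * eta m R x \<partial>lebesgue) \<le> 0"
  shows "AE x in lebesgue. w x = 0"
proof -
  have "AE x in lebesgue. w x * eta m (real (Suc n)) x = 0" for n
  proof -
    have R: "1 \<le> real (Suc n)" by simp
    have nn: "0 \<le> w x * eta m (real (Suc n)) x" for x
      using w0 eta_bounds by simp
    have "0 \<le> (\<integral>x. w x * eta m (real (Suc n)) x \<partial>lebesgue)"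
      using nn by (intro integral_nonneg_AE AE_I2)
    then have "(\<integral>x. w x * eta m (real (Suc n)) x \<partial>lebesgue) = 0"
      using le[OF R] by (rule order_antisym[rotated])
    then show ?thesis
      using integral_nonneg_eq_0_iff_AE[OF int[OF R]] nn by simp
  qed
  then have "AE x in lebesgue. \<forall>n. w x * eta m (real (Suc n)) x = 0"
    unfolding AE_all_countable by blast
  then show ?thesis
  proof eventually_elim
    case (elim x)
    obtain n where "norm x \<le> real n" using real_arch_simple by blast
    then have "eta m (real (Suc n)) x = 1"
      by (intro eta_eq_1) auto
    then show ?case using elim by (metis mult.right_neutral)
  qed
qed

end

context subsolution
begin

lemma integrable_power_eta:
  assumes "1 \<le> R" "2 \<le> m" shows "integrable lebesgue (\<lambda>x. v x powr q * eta m R x)"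
  using assms eta_bounds by (intro integrable_times_cutoff C1_0_eta) auto

text \<open>With \<open>s = q - p + 1\<close> the Caccioppoli estimate is controlled by the integral of \<open>v\<^sup>q\<close>, so growth of
  order at most \<open>R\<^sup>p\<close> makes the energy finite; the estimate by the energy away from a ball
  then makes it vanish.\<close>

lemma flux_zero_if_growth:
  assumes m: "2 \<le> m" "p \<le> (1 - (small + p - 1) / q) * m" and C0: "0 \<le> C0"
    and grad: "\<And>R x. 0 < R \<Longrightarrow> norm (hgrad op emb (eta m R) x) \<le> C0 / R * eta m R x powr (1 - 1 / m)"
    and growth: "\<And>R. 1 \<le> R \<Longrightarrow> (\<integral>x. v x powr q * eta m R x \<partial>lebesgue) \<le> M * R powr p"
  shows "AE x in lebesgue. h x = 0"
proof -
  define s where "s = q - p + 1"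
  have s: "0 < s" "s + p - 1 = q" using q by (auto simp: s_def)
  have q0: "0 < q" using p q by simp
  have \<delta>0: "0 \<le> (small + p - 1) / q" using small p q0 by simp
  have cut: "cutoff p ((small + p - 1) / q) (C0 / R) (eta m R)" if "1 \<le> R" for R
    using cutoff_eta[OF m(1) _ C0 p m(2) grad] that by simp
  have cut0: "cutoff p 0 (C0 / R) (eta m R)" if "1 \<le> R" for R
    using cutoff_mono[OF cut[OF that] _ p \<delta>0] C0 that by simp
  have B: "0 \<le> C0 / R" if "1 \<le> R" for R using C0 that by simp
  have "0 \<le> (\<integral>x. v x powr q * eta m 1 x \<partial>lebesgue)"
    by (intro integral_nonneg_AE AE_I2) (simp add: eta_bounds)
  then have M0: "0 \<le> M"
    using growth[of 1] by simp
  \<comment> \<open>The factor \<open>eta m R x powr 0\<close> is the indicator of {eta > 0}, as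
    \<open>0 powr 0 = 0\<close>. The cut-off at scale 2R equals 1 there, so the growth hypothesis at
    2R bounds \<open>W R\<close>.\<close>
  define W where "W R = (\<integral>x. v x powr q * eta m R x powr 0 \<partial>lebesgue)" for R
  have W: "0 \<le> W R" "W R \<le> M * 2 powr p * R powr p" if R: "1 \<le> R" for R
  proof -
    show "0 \<le> W R" by (simp add: W_def)
    have "W R \<le> (\<integral>x. v x powr q * eta m (2 * R) x \<partial>lebesgue)"
      unfolding W_def
    proof (rule integral_mono)
      show "integrable lebesgue (\<lambda>x. v x powr q * eta m R x powr 0)"
        using integrable_weighted_power[OF cut0[OF R], of q 0] q0 by simp
      show "integrable lebesgue (\<lambda>x. v x powr q * eta m (2 * R) x)"
        using R m by (intro integrable_power_eta) auto
      show "v x powr q * eta m R x powr 0 \<le> v x powr q * eta m (2 * R) x" for x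
        using eta_double[OF R, of m x] m eta_bounds[of m "2 * R" x] by (intro mult_left_mono) auto
    qed
    also have "\<dots> \<le> M * (2 * R) powr p"
      using R by (intro growth) simp
    finally show "W R \<le> M * 2 powr p * R powr p"
      using R by (simp add: powr_mult)
  qed
  define G where "G x = H x * v x powr (s - 1)" for x
  have G0: "0 \<le> G x" for x by (simp add: G_def)
  have [measurable]: "G \<in> borel_measurable lebesgue" unfolding G_def[abs_def] by measurable
  have intG: "integrable lebesgue (\<lambda>x. G x * eta m R x)" if "1 \<le> R" for R
    using caccioppoli(1)[OF s(1) _ cut0[OF that] _ B[OF that]] s(2) by (simp add: G_def)
  \<comment> \<open>The factor R^(-p) from the gradient cancels the growth R^p, so this bound on the
    energy does not depend on R.\<close>
  define E where "E = (C0 / (k * s)) powr p * (M * 2 powr p)"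
  have GE: "(\<integral>x. G x * eta m R x \<partial>lebesgue) \<le> E" if R: "1 \<le> R" for R
  proof -
    have "(\<integral>x. G x * eta m R x \<partial>lebesgue) \<le> (C0 / R / (k * s)) powr p * W R"
      using energy_bound[OF s(1) _ cut0[OF R] _ B[OF R]] s(2) by (simp add: G_def W_def)
    also have "\<dots> \<le> (C0 / R / (k * s)) powr p * (M * 2 powr p * R powr p)"
      by (intro mult_left_mono W R) simp
    also have "(C0 / R / (k * s)) powr p = (C0 / (k * s)) powr p / R powr p"
      using R C0 k s by (subst powr_divide[symmetric]) (auto simp: mult_ac)
    also have "(C0 / (k * s)) powr p / R powr p * (M * 2 powr p * R powr p) = E"
      using R by (simp add: E_def)
    finally show ?thesis .
  qed
  have eta_lim: "(\<lambda>n. eta m (real (Suc n)) x) \<longlonglongrightarrow> 1" for x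
  proof -
    obtain n0 where n0: "norm x \<le> real n0" using real_arch_simple by blast
    have "eta m (real (Suc n)) x = 1" if "n0 \<le> n" for n
      using n0 that by (intro eta_eq_1) auto
    then show ?thesis
      by (intro tendsto_eventually) (auto simp: eventually_sequentially)
  qed
  have Gint: "integrable lebesgue G"
  proof (rule integrable_bounded_limit)
    show "integrable lebesgue (\<lambda>x. G x * eta m (real (Suc n)) x)" "(\<integral>x. G x * eta m (real (Suc n)) x \<partial>lebesgue) \<le> E" for n
      by (rule intG GE; simp)+
    show "AE x in lebesgue. (\<lambda>n. G x * eta m (real (Suc n)) x) \<longlonglongrightarrow> G x"
      using tendsto_mult[OF tendsto_const eta_lim] by (intro AE_I2) fastforce
  qed (simp_all add: G0 eta_bounds)
  define T where "T n = (\<integral>x. G x * indicator {x. real (Suc n) \<le> norm x} x \<partial>lebesgue)" for n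
  have ball_meas: "{x::real^'n. real (Suc n) \<le> norm x} \<in> sets lebesgue" for n
  proof -
    have "closed {x::real^'n. real (Suc n) \<le> norm x}"
      by (intro closed_Collect_le continuous_intros)
    then show ?thesis by simp
  qed
  have T_meas: "(\<lambda>x. G x * indicator {x. real (Suc n) \<le> norm x} x) \<in> borel_measurable lebesgue" for n
    using ball_meas[of n] by measurable
  have T_lim: "T \<longlonglongrightarrow> 0"
  proof -
    have "(\<lambda>n. \<integral>x. G x * indicator {x. real (Suc n) \<le> norm x} x \<partial>lebesgue) \<longlonglongrightarrow> (\<integral>x. 0 \<partial>(lebesgue :: (real^'n) measure))"
    proof (rule integral_dominated_convergence[OF _ _ Gint])
      show "AE x in lebesgue. (\<lambda>n. G x * indicator {x. real (Suc n) \<le> norm x} x) \<longlonglongrightarrow> 0"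
      proof (rule AE_I2)
        fix x :: "real^'n"
        obtain n0 where n0: "norm x \<le> real n0" using real_arch_simple by blast
        have "G x * indicator {x. real (Suc n) \<le> norm x} x = 0" if "n0 \<le> n" for n
          using n0 that by (auto simp: indicator_def)
        then show "(\<lambda>n. G x * indicator {x. real (Suc n) \<le> norm x} x) \<longlonglongrightarrow> 0"
          by (intro tendsto_eventually) (auto simp: eventually_sequentially)
      qed
      show "AE x in lebesgue. norm (G x * indicator {x. real (Suc n) \<le> norm x} x) \<le> G x" for n
        using G0 by (intro AE_I2) (auto simp: indicator_def)
      show "(\<lambda>x. G x * indicator {x. real (Suc n) \<le> norm x} x) \<in> borel_measurable lebesgue" for n
        by (rule T_meas)
    qed simp
    then show ?thesis by (simp add: T_def[abs_def])
  qed
  have T0: "0 \<le> T n" for n using G0 by (simp add: T_def)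
  define L where "L = C0 * (M * 2 powr p) powr (1 / p)"
  have L0: "0 \<le> L" using C0 by (simp add: L_def)
  \<comment> \<open>The gradient of the cut-off vanishes inside the ball of radius R, so the
    restricted energy is at most the tail \<open>T n\<close>. The other factor, of order R^(-1) R,
    stays bounded and tends to nothing by itself.\<close>
  have key: "k * s * (\<integral>x. G x * eta m (real (Suc n)) x \<partial>lebesgue) \<le> L * T n powr ((p - 1) / p)" for n
  proof -
    define R where "R = real (Suc n)"
    have R: "1 \<le> R" by (simp add: R_def)
    let ?N = "{x. hgrad op emb (eta m R) x \<noteq> 0}"
    have [measurable]: "hgrad op emb (eta m R) \<in> borel_measurable lebesgue"
      using C1_0_lebesgue_measurable[OF C1_0_eta] R m by simp
    have N: "?N \<in> sets lebesgue"
      by (rule sets_lebesgue_nonzero) measurable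
    have sub: "R \<le> norm x" if "x \<in> ?N" for x
      using hgrad_eta_zero[OF R, of x m] that by (cases "norm x < R") auto
    have "(\<integral>x. G x * eta m R x * indicator ?N x \<partial>lebesgue) \<le> T n"
      unfolding T_def
    proof (rule integral_mono)
      show "integrable lebesgue (\<lambda>x. G x * eta m R x * indicator ?N x)"
        by (rule integrable_times_indicator[OF intG[OF R] N])
      show "integrable lebesgue (\<lambda>x. G x * indicator {x. real (Suc n) \<le> norm x} x)"
        by (rule integrable_times_indicator[OF Gint ball_meas])
      show "G x * eta m R x * indicator ?N x \<le> G x * indicator {x. real (Suc n) \<le> norm x} x" for x
        using sub[of x] G0[of x] eta_bounds[of m R x] by (auto simp: indicator_def R_def mult_left_le)
    qed
    moreover have "0 \<le> (\<integral>x. G x * eta m R x * indicator ?N x \<partial>lebesgue)"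
      using G0 eta_bounds by (intro integral_nonneg_AE AE_I2) auto
    ultimately have Tn: "(\<integral>x. G x * eta m R x * indicator ?N x \<partial>lebesgue) powr ((p - 1) / p) \<le> T n powr ((p - 1) / p)"
      using p by (intro powr_mono2) auto
    have "W R powr (1 / p) \<le> (M * 2 powr p * R powr p) powr (1 / p)"
      using W[OF R] p by (intro powr_mono2) auto
    also have "\<dots> = (M * 2 powr p) powr (1 / p) * R"
    proof -
      have "(R powr p) powr (1 / p) = R" using p R by (simp add: powr_powr)
      then show ?thesis by (simp only: powr_mult)
    qed
    finally have WR: "W R powr (1 / p) \<le> (M * 2 powr p) powr (1 / p) * R" .
    have "k * s * (\<integral>x. G x * eta m R x \<partial>lebesgue) \<le> C0 / R *
      ((\<integral>x. G x * eta m R x * indicator ?N x \<partial>lebesgue) powr ((p - 1) / p) * W R powr (1 / p))"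
      using caccioppoli(2)[OF s(1) _ cut0[OF R] _ B[OF R]] s(2) by (simp add: G_def W_def)
    also have "\<dots> \<le> C0 / R * (T n powr ((p - 1) / p) * ((M * 2 powr p) powr (1 / p) * R))"
      by (intro mult_left_mono mult_mono Tn WR B R) auto
    also have "\<dots> = L * T n powr ((p - 1) / p)"
      using R by (simp add: L_def)
    finally show ?thesis by (simp add: R_def)
  qed
  have "(\<lambda>n. k * s * (\<integral>x. G x * eta m (real (Suc n)) x \<partial>lebesgue)) \<longlonglongrightarrow> k * s * (\<integral>x. G x \<partial>lebesgue)"
  proof (intro tendsto_mult tendsto_const)
    show "(\<lambda>n. \<integral>x. G x * eta m (real (Suc n)) x \<partial>lebesgue) \<longlonglongrightarrow> (\<integral>x. G x \<partial>lebesgue)"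
    proof (rule integral_dominated_convergence[OF _ _ Gint])
      show "AE x in lebesgue. (\<lambda>n. G x * eta m (real (Suc n)) x) \<longlonglongrightarrow> G x"
        using tendsto_mult[OF tendsto_const eta_lim] by (intro AE_I2) fastforce
      show "AE x in lebesgue. norm (G x * eta m (real (Suc n)) x) \<le> G x" for n
        using G0 eta_bounds[of m "real (Suc n)"] by (intro AE_I2) (simp add: mult_left_le)
      show "(\<lambda>x. G x * eta m (real (Suc n)) x) \<in> borel_measurable lebesgue" for n
        by (rule borel_measurable_integrable[OF intG]) simp
    qed simp
  qed
  moreover have "(\<lambda>n. L * T n powr ((p - 1) / p)) \<longlonglongrightarrow> L * 0 powr ((p - 1) / p)"
    using p T0 by (intro tendsto_mult tendsto_const tendsto_powr' T_lim) (auto intro!: always_eventually)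
  ultimately have "k * s * (\<integral>x. G x \<partial>lebesgue) \<le> L * 0 powr ((p - 1) / p)"
    by (rule LIMSEQ_le) (use key in auto)
  then have "(\<integral>x. G x \<partial>lebesgue) \<le> 0"
    using k s by (simp add: mult_le_0_iff)
  moreover have "0 \<le> (\<integral>x. G x \<partial>lebesgue)" using G0 by simp
  ultimately have "(\<integral>x. G x \<partial>lebesgue) = 0" by simp
  then have GZ: "AE x in lebesgue. G x = 0"
    using integral_nonneg_eq_0_iff_AE[OF Gint] G0 by simp
  \<comment> \<open>Vanishing of G gives h = 0 only where v > 0. The remaining set {v = 0} is
    covered by countably many cut-offs.\<close>
  have "AE x in lebesgue. \<forall>n. eta m (real (Suc n)) x \<noteq> 0 \<and> v x = 0 \<longrightarrow> h x = 0"
    unfolding AE_all_countable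
  proof
    fix n
    have R: "1 \<le> real (Suc n)" by simp
    show "AE x in lebesgue. eta m (real (Suc n)) x \<noteq> 0 \<and> v x = 0 \<longrightarrow> h x = 0"
      by (rule flux_zero_on_zero_set[OF cut0[OF R] order_refl B[OF R]])
  qed
  then show ?thesis
    using GZ
  proof eventually_elim
    case (elim x)
    show ?case
    proof (cases "v x = 0")
      case True
      obtain n where "norm x \<le> real n" using real_arch_simple by blast
      then have "eta m (real (Suc n)) x = 1"
        by (intro eta_eq_1) auto
      then show ?thesis using elim(1) True by (metis zero_neq_one)
    qed (use elim(2) in \<open>simp add: G_def\<close>)
  qed
qed

end

text \<open>Inserting the bound for U yields V <= C R^\<beta> V^\<theta> with \<theta> = a1 a2 < 1
  and \<beta> = Q (1 - \<theta>) - p1 - p2 a1. Dividing by V^\<theta> and taking the root 1/(1 -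
  \<theta>) gives any \<alpha> with \<beta> <= \<alpha> (1 - \<theta>).\<close>

lemma bootstrap_growth:
  fixes U V R Q C1 C2 a1 a2 p1 p2 \<alpha> :: real
  assumes V: "V \<le> C1 * R powr (- p1) * U powr a1 * (R powr Q) powr (1 - a1)"
    and U: "U \<le> C2 * R powr (- p2) * V powr a2 * (R powr Q) powr (1 - a2)"
    and nonneg: "0 \<le> U" "0 \<le> V" "0 \<le> C1" "0 \<le> C2" and R: "1 \<le> R"
    and a: "0 < a1" "0 < a2" "a1 * a2 < 1"
    and \<alpha>: "Q * (1 - a1 * a2) - p1 - p2 * a1 \<le> \<alpha> * (1 - a1 * a2)"
  shows "V \<le> (C1 * C2 powr a1) powr (1 / (1 - a1 * a2)) * R powr \<alpha>"
proof (cases "V = 0")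
  case False
  then have V0: "0 < V" using nonneg by simp
  define \<theta> where "\<theta> = a1 * a2"
  have \<theta>: "0 < 1 - \<theta>" using a by (simp add: \<theta>_def)
  have Q: "(R powr Q) powr b = R powr (Q * b)" for b by (simp add: powr_powr)
  have "U powr a1 \<le> (C2 * R powr (- p2) * V powr a2 * (R powr Q) powr (1 - a2)) powr a1"
    using U nonneg a by (intro powr_mono2) auto
  also have "\<dots> = C2 powr a1 * R powr (- p2 * a1) * V powr \<theta> * R powr (Q * (1 - a2) * a1)"
    by (simp only: powr_mult powr_powr \<theta>_def mult.commute[of a2 a1])
  finally have "C1 * R powr (- p1) * U powr a1 * R powr (Q * (1 - a1)) \<le>
      C1 * R powr (- p1) * (C2 powr a1 * R powr (- p2 * a1) * V powr \<theta> * R powr (Q * (1 - a2) * a1)) * R powr (Q * (1 - a1))"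
    using nonneg by (intro mult_right_mono mult_left_mono) auto
  then have "V \<le> C1 * R powr (- p1) * (C2 powr a1 * R powr (- p2 * a1) * V powr \<theta> * R powr (Q * (1 - a2) * a1)) * R powr (Q * (1 - a1))"
    using V unfolding Q by linarith
  also have "\<dots> = (C1 * C2 powr a1) * (R powr (- p1) * R powr (- p2 * a1) * R powr (Q * (1 - a2) * a1) * R powr (Q * (1 - a1))) * V powr \<theta>"
    by (simp only: mult_ac)
  also have "R powr (- p1) * R powr (- p2 * a1) * R powr (Q * (1 - a2) * a1) * R powr (Q * (1 - a1)) = R powr (Q * (1 - \<theta>) - p1 - p2 * a1)"
    by (simp add: powr_add[symmetric] \<theta>_def algebra_simps)
  also have "\<dots> \<le> R powr (\<alpha> * (1 - \<theta>))"
    using R \<alpha> by (intro powr_mono) (auto simp: \<theta>_def)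
  finally have "V \<le> (C1 * C2 powr a1) * R powr (\<alpha> * (1 - \<theta>)) * V powr \<theta>"
    using nonneg by (simp add: mult_left_mono mult_right_mono)
  moreover have "V = V powr (1 - \<theta>) * V powr \<theta>"
    using V0 by (simp add: powr_add[symmetric])
  ultimately have "V powr (1 - \<theta>) * V powr \<theta> \<le> (C1 * C2 powr a1) * R powr (\<alpha> * (1 - \<theta>)) * V powr \<theta>"
    by simp
  then have "V powr (1 - \<theta>) \<le> (C1 * C2 powr a1) * R powr (\<alpha> * (1 - \<theta>))"
    using V0 by simp
  then have "(V powr (1 - \<theta>)) powr (1 / (1 - \<theta>)) \<le> ((C1 * C2 powr a1) * R powr (\<alpha> * (1 - \<theta>))) powr (1 / (1 - \<theta>))"
    using \<theta> by (intro powr_mono2) auto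
  moreover have "(V powr (1 - \<theta>)) powr (1 / (1 - \<theta>)) = V"
    using V0 \<theta> by (simp add: powr_powr)
  moreover have "(R powr (\<alpha> * (1 - \<theta>))) powr (1 / (1 - \<theta>)) = R powr \<alpha>"
    using \<theta> by (simp add: powr_powr)
  ultimately show ?thesis
    unfolding \<theta>_def[symmetric] by (metis powr_mult)
qed (use nonneg in simp)

text \<open>\<open>flux_bound\<close> for the cut-offs at scale R: B = C0/R supplies R^(-p), and the
  volume of the support supplies R^Q.\<close>

lemma (in subsolution) eta_flux_bound:
  assumes m: "2 \<le> m" "p \<le> (1 - (small + p - 1) / q) * m" and C0: "0 \<le> C0"
    and grad: "\<And>R x. 0 < R \<Longrightarrow> norm (hgrad op emb (eta m R) x) \<le> C0 / R * eta m R x powr (1 - 1 / m)"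
  shows "\<exists>C\<ge>0. \<forall>R\<ge>1. \<bar>\<integral>x. h x \<bullet> hgrad op emb (eta m R) x \<partial>lebesgue\<bar> \<le>
    C * R powr (- p) * (\<integral>x. v x powr q * eta m R x \<partial>lebesgue) powr ((p - 1) / q) * (R powr hom_dim deg) powr (1 - (p - 1) / q)"
proof -
  define b where "b = 1 - (p - 1) / q"
  have b: "0 < b" using p q by (simp add: b_def)
  define C where "C = (k * small) powr (- (p - 1)) * C0 powr p * (4 ^ CARD('n)) powr b"
  have "\<bar>\<integral>x. h x \<bullet> hgrad op emb (eta m R) x \<partial>lebesgue\<bar> \<le>
    C * R powr (- p) * (\<integral>x. v x powr q * eta m R x \<partial>lebesgue) powr ((p - 1) / q) * (R powr hom_dim deg) powr b" if R: "1 \<le> R" for R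
  proof -
    let ?V = "\<integral>x. v x powr q * eta m R x \<partial>lebesgue" and ?A = "\<integral>x. indicator {x. eta m R x \<noteq> 0} x \<partial>lebesgue"
    have "\<bar>\<integral>x. h x \<bullet> hgrad op emb (eta m R) x \<partial>lebesgue\<bar> \<le> (k * small) powr (- (p - 1)) * (C0 / R) powr p * ?V powr ((p - 1) / q) * ?A powr b"
      using flux_bound[OF cutoff_eta[OF m(1) _ C0 p m(2) grad]] C0 R by (simp add: b_def)
    also have "\<dots> \<le> (k * small) powr (- (p - 1)) * (C0 / R) powr p * ?V powr ((p - 1) / q) * (4 ^ CARD('n) * R powr hom_dim deg) powr b"
      using measure_eta_support[of R m] R m b by (intro mult_left_mono powr_mono2) auto
    also have "(C0 / R) powr p = C0 powr p * R powr (- p)"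
      using C0 R by (simp add: powr_divide powr_minus_divide)
    also have "(4 ^ CARD('n) * R powr hom_dim deg) powr b = (4 ^ CARD('n)) powr b * (R powr hom_dim deg) powr b"
      by (rule powr_mult)
    finally show ?thesis
      by (simp add: C_def mult_ac)
  qed
  then show ?thesis
    by (intro exI[of _ C]) (auto simp: C_def b_def)
qed

text \<open>One term of the maximum is assumed here; the other follows by exchanging the equations.
  It bounds the growth of V by R^p2, which annihilates \<open>h2\<close>. The second inequality then
  gives U = 0, and the flux bound for \<open>h1\<close>, a positive power of U, gives V = 0.\<close>

lemma liouville_subcritical:
  fixes op :: "real^'n \<Rightarrow> real^'n \<Rightarrow> real^'n" and emb :: "'l::finite \<Rightarrow> 'n"
  assumes u: "subsolution op deg emb p1 k1 q1 u Du h1" and v: "subsolution op deg emb p2 k2 q2 v Dv h2"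
    and uv: "\<And>\<phi>. C1_0 \<phi> \<Longrightarrow> (\<And>x. 0 \<le> \<phi> x) \<Longrightarrow> (\<integral>x. v x powr q2 * \<phi> x \<partial>lebesgue) \<le> - (\<integral>x. h1 x \<bullet> hgrad op emb \<phi> x \<partial>lebesgue)"
    and vu: "\<And>\<phi>. C1_0 \<phi> \<Longrightarrow> (\<And>x. 0 \<le> \<phi> x) \<Longrightarrow> (\<integral>x. u x powr q1 * \<phi> x \<partial>lebesgue) \<le> - (\<integral>x. h2 x \<bullet> hgrad op emb \<phi> x \<partial>lebesgue)"
    and crit: "hom_dim deg \<le> q2 * (p1 * q1 + p2 * (p1 - 1)) / (q1 * q2 - (p1 - 1) * (p2 - 1)) + p2"
  shows "AE x in lebesgue. u x = 0 \<and> v x = 0"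
proof -
  interpret u: subsolution op deg emb p1 k1 q1 u Du h1 by fact
  interpret v: subsolution op deg emb p2 k2 q2 v Dv h2 by fact
  \<comment> \<open>Thresholds for the hypothesis of \<open>cutoff_eta\<close>. A common integer m
    above both, and at least 2 for the C1 property, allows the same cut-off in both
    inequalities.\<close>
  define m1 m2 where "m1 = p1 / (1 - (u.small + p1 - 1) / q1)" and "m2 = p2 / (1 - (v.small + p2 - 1) / q2)"
  define m where "m = max 2 (max (nat \<lceil>m1\<rceil>) (nat \<lceil>m2\<rceil>))"
  have m: "2 \<le> m" and mm: "m1 \<le> m" "m2 \<le> m"
    by (auto simp: m_def le_max_iff_disj) linarith+
  have q: "0 < q1" "0 < q2" using u.p u.q v.p v.q by auto
  have mu: "p1 \<le> (1 - (u.small + p1 - 1) / q1) * m" and mv: "p2 \<le> (1 - (v.small + p2 - 1) / q2) * m"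
    using mm u.small v.small q by (auto simp: m1_def m2_def divide_le_eq mult.commute)
  note eta = u.eta_bounds u.C1_0_eta
  let ?eta = "u.eta m"
  obtain C0 where C0: "0 \<le> C0" and grad: "\<And>R x. 0 < R \<Longrightarrow> norm (hgrad op emb (?eta R) x) \<le> C0 / R * ?eta R x powr (1 - 1 / m)"
    using u.eta_gradient[OF m] by blast
  define U V where "U R = (\<integral>x. u x powr q1 * ?eta R x \<partial>lebesgue)" and "V R = (\<integral>x. v x powr q2 * ?eta R x \<partial>lebesgue)" for R
  have UV0: "0 \<le> U R" "0 \<le> V R" for R
    using u.eta_bounds by (auto simp: U_def V_def intro!: integral_nonneg_AE)
  define a1 a2 where "a1 = (p1 - 1) / q1" and "a2 = (p2 - 1) / q2"
  have a: "0 < a1" "a1 < 1" "0 < a2" "a2 < 1"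
    using u.p u.q v.p v.q q by (auto simp: a1_def a2_def)
  then have \<theta>: "a1 * a2 < 1"
    using mult_strict_mono[of a1 1 a2 1] by simp
  let ?Q = "hom_dim deg"
  obtain C1 where C1: "0 \<le> C1" and F1: "\<And>R. 1 \<le> R \<Longrightarrow> \<bar>\<integral>x. h1 x \<bullet> hgrad op emb (?eta R) x \<partial>lebesgue\<bar> \<le> C1 * R powr (- p1) * U R powr a1 * (R powr ?Q) powr (1 - a1)"
    using u.eta_flux_bound[OF m mu C0 grad] unfolding U_def a1_def by blast
  obtain C2 where C2: "0 \<le> C2" and F2: "\<And>R. 1 \<le> R \<Longrightarrow> \<bar>\<integral>x. h2 x \<bullet> hgrad op emb (?eta R) x \<partial>lebesgue\<bar> \<le> C2 * R powr (- p2) * V R powr a2 * (R powr ?Q) powr (1 - a2)"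
    using v.eta_flux_bound[OF m mv C0 grad] unfolding V_def a2_def by blast
  have VF: "V R \<le> \<bar>\<integral>x. h1 x \<bullet> hgrad op emb (?eta R) x \<partial>lebesgue\<bar>" and UF: "U R \<le> \<bar>\<integral>x. h2 x \<bullet> hgrad op emb (?eta R) x \<partial>lebesgue\<bar>" if "1 \<le> R" for R
    using uv[of "?eta R"] vu[of "?eta R"] u.eta_bounds u.C1_0_eta[of R m] that m unfolding U_def V_def by fastforce+
  \<comment> \<open>Since 1 - a1 a2 = D / (q1 q2) with D > 0, this is the critical condition
    multiplied by D / (q1 q2).\<close>
  have exponent: "?Q * (1 - a1 * a2) - p1 - p2 * a1 \<le> p2 * (1 - a1 * a2)"
  proof -
    define D where "D = q1 * q2 - (p1 - 1) * (p2 - 1)"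
    have D: "1 - a1 * a2 = D / (q1 * q2)"
      using q by (simp add: D_def a1_def a2_def field_simps)
    have D0: "0 < D"
      using \<theta> D q by (metis diff_gt_0_iff_gt mult_pos_pos zero_less_divide_iff order_less_asym)
    have "?Q - p2 \<le> q2 * (p1 * q1 + p2 * (p1 - 1)) / D"
      using crit unfolding D_def[symmetric] by linarith
    then have "(?Q - p2) * D \<le> q2 * (p1 * q1 + p2 * (p1 - 1))"
      unfolding pos_le_divide_eq[OF D0] .
    then have "(?Q - p2) * D / (q1 * q2) \<le> q2 * (p1 * q1 + p2 * (p1 - 1)) / (q1 * q2)"
      by (rule divide_right_mono) (use q in simp)
    then have "(?Q - p2) * (1 - a1 * a2) \<le> q2 * (p1 * q1 + p2 * (p1 - 1)) / (q1 * q2)"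
      unfolding D times_divide_eq_right .
    also have "\<dots> = p1 + p2 * a1"
      using q by (simp add: a1_def field_simps)
    finally show ?thesis by (simp add: algebra_simps)
  qed
  have growth: "V R \<le> (C1 * C2 powr a1) powr (1 / (1 - a1 * a2)) * R powr p2" if R: "1 \<le> R" for R
    by (rule bootstrap_growth[OF order_trans[OF VF F1] order_trans[OF UF F2] UV0 C1 C2 R a(1,3) \<theta> exponent]) (rule R)+
  have h2: "AE x in lebesgue. h2 x = 0"
    by (rule v.flux_zero_if_growth[OF m mv C0 grad growth[unfolded V_def]])
  have U: "U R = 0" if R: "1 \<le> R" for R
  proof -
    have "AE x in lebesgue. h2 x \<bullet> hgrad op emb (?eta R) x = 0"
      using h2 by eventually_elim simp
    then have "(\<integral>x. h2 x \<bullet> hgrad op emb (?eta R) x \<partial>lebesgue) = 0"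
      by (rule integral_eq_zero_AE)
    then show ?thesis using UF[OF R] UV0(1)[of R] by simp
  qed
  \<comment> \<open>The flux bound for \<open>h1\<close> contains \<open>U R powr a1\<close> with a1
    > 0, which is 0 for U R = 0.\<close>
  have "V R \<le> 0" if R: "1 \<le> R" for R
    using order_trans[OF VF[OF R] F1[OF R]] U[OF R] a by simp
  then have "AE x in lebesgue. v x powr q2 = 0"
    using u.zero_if_eta_integrals[OF m, of "\<lambda>x. v x powr q2"] v.integrable_power_eta[OF _ m] unfolding V_def by simp
  moreover have "AE x in lebesgue. u x powr q1 = 0"
    using u.zero_if_eta_integrals[OF m, of "\<lambda>x. u x powr q1"] u.integrable_power_eta[OF _ m] U unfolding U_def by simp
  ultimately show ?thesis
    by eventually_elim simp
qed

section \<open>From the hypotheses on the system to two subsolutions\<close>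

lemma WpC_coercive:
  assumes "WpC p A" "1 < p"
  shows "\<exists>k>0. \<forall>x t \<xi>. k * norm (A x t \<xi>) powr (p / (p - 1)) \<le> A x t \<xi> \<bullet> \<xi>"
proof -
  obtain k where k: "0 < k" and A0: "\<And>x t \<xi>. 0 \<le> A x t \<xi> \<bullet> \<xi>"
    and le: "\<And>x t \<xi>. k powr (p - 1) * norm (A x t \<xi>) powr p \<le> (A x t \<xi> \<bullet> \<xi>) powr (p - 1)"
    using assms(1) by (auto simp: WpC_def)
  have "k * norm (A x t \<xi>) powr (p / (p - 1)) \<le> A x t \<xi> \<bullet> \<xi>" for x t \<xi>
  proof -
    \<comment> \<open>The structural inequality raised to the power 1/(p - 1); the constant of W-p-C
      is kept.\<close>
    have "(k powr (p - 1) * norm (A x t \<xi>) powr p) powr (1 / (p - 1)) \<le> ((A x t \<xi> \<bullet> \<xi>) powr (p - 1)) powr (1 / (p - 1))"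
      using assms(2) le by (intro powr_mono2) auto
    then show ?thesis
      using assms(2) k A0 by (simp add: powr_mult powr_powr)
  qed
  then show ?thesis using k by blast
qed

lemma Lp_loc_cong_AE:
  fixes f g :: "real^'n \<Rightarrow> real"
  assumes f: "Lp_loc p f" and eq: "AE x in lebesgue. g x = f x" and g [measurable]: "g \<in> borel_measurable lebesgue"
  shows "Lp_loc p g"
  unfolding Lp_loc_def set_integrable_def
proof (intro conjI allI impI g)
  fix K :: "(real^'n) set" assume K: "compact K"
  have [measurable]: "K \<in> sets lebesgue" using K by (simp add: compact_imp_closed)
  have "integrable lebesgue (\<lambda>x. indicator K x *\<^sub>R \<bar>f x\<bar> powr p)"
    using f K by (simp add: Lp_loc_def set_integrable_def)
  then show "integrable lebesgue (\<lambda>x. indicator K x *\<^sub>R \<bar>g x\<bar> powr p)"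
  proof (rule integrable_cong_AE_imp)
    show "AE x in lebesgue. indicator K x *\<^sub>R \<bar>f x\<bar> powr p = indicator K x *\<^sub>R \<bar>g x\<bar> powr p"
      using eq by eventually_elim simp
  qed measurable
qed

text \<open>No chain rule is involved: u >= 0 a.e., so the positive part changes u only on a null
  set and the weak gradient is the same.\<close>

lemma W1p_L_loc_max_0:
  fixes u :: "real^'n \<Rightarrow> real"
  assumes W: "W1p_L_loc op emb p u Du" and u0: "AE x in lebesgue. 0 \<le> u x" and G: "carnot op deg emb"
  shows "W1p_L_loc op emb p (\<lambda>x. max 0 (u x)) Du"
proof -
  interpret carnot op deg emb by fact
  have [measurable]: "u \<in> borel_measurable lebesgue"
    using W by (simp add: W1p_L_loc_def Lp_loc_def)
  have eq: "AE x in lebesgue. max 0 (u x) = u x"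
    using u0 by eventually_elim simp
  have "Lp_loc p (\<lambda>x. max 0 (u x))"
    by (rule Lp_loc_cong_AE[OF _ eq]) (use W in \<open>simp_all add: W1p_L_loc_def\<close>)
  moreover have "weak_hgrad op emb (\<lambda>x. max 0 (u x)) Du"
    unfolding weak_hgrad_def
  proof (intro allI impI)
    fix \<phi> :: "real^'n \<Rightarrow> real" and j assume \<phi>: "C1_0 \<phi>"
    have C: "C1 \<phi>" using \<phi> by (simp add: C1_0_iff)
    have [measurable]: "(\<lambda>x. hgrad op emb \<phi> x $ j) \<in> borel_measurable lebesgue"
      by (intro borel_lebesgue borel_measurable_continuous_onI continuous_intros hgrad_continuous C)
    have "(\<integral>x. max 0 (u x) * hgrad op emb \<phi> x $ j \<partial>lebesgue) = (\<integral>x. u x * hgrad op emb \<phi> x $ j \<partial>lebesgue)"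
    proof (rule integral_cong_AE)
      show "AE x in lebesgue. max 0 (u x) * hgrad op emb \<phi> x $ j = u x * hgrad op emb \<phi> x $ j"
        using eq by eventually_elim simp
    qed measurable
    then show "(\<integral>x. Du x $ j * \<phi> x \<partial>lebesgue) = - (\<integral>x. max 0 (u x) * hdiv op emb (\<lambda>y. \<phi> y *\<^sub>R axis j 1) x \<partial>lebesgue)"
      using W \<phi> by (simp add: W1p_L_loc_def weak_hgrad_def hdiv_eq_hgrad[OF C])
  qed
  ultimately show ?thesis
    using W by (simp add: W1p_L_loc_def)
qed


theorem theorem4p1:
  fixes op :: "real^'n \<Rightarrow> real^'n \<Rightarrow> real^'n" and deg :: "'n \<Rightarrow> nat" and emb :: "'l::finite \<Rightarrow> 'n::finite"
    and p1 p2 q1 q2 :: real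
    and A1 A2 :: "real^'n \<Rightarrow> real \<Rightarrow> real^'l \<Rightarrow> real^'l"
    and u v :: "real^'n \<Rightarrow> real" and Du Dv :: "real^'n \<Rightarrow> real^'l"
  assumes G: "homogeneous_carnot_group op deg emb"
    and p1: "p1 > 1" and p2: "p2 > 1"
    and q1: "q1 > p1 - 1" and q2: "q2 > p2 - 1"
    and A1: "WpC p1 A1" and A2: "WpC p2 A2"
    and sol: "weak_solution op emb p1 p2 q1 q2 A1 A2 u Du v Dv"
    and crit: "max (q1 * (p2 * q2 + p1 * (p2 - 1)) / (q1 * q2 - (p1 - 1) * (p2 - 1)) + p1)
                   (q2 * (p1 * q1 + p2 * (p1 - 1)) / (q1 * q2 - (p1 - 1) * (p2 - 1)) + p2)
               \<ge> hom_dim deg"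
  shows "AE x in lebesgue. u x = 0 \<and> v x = 0"
proof -
  interpret carnot op deg emb
    by (rule carnot_if_homogeneous_carnot_group[OF G])
  have Wu: "W1p_L_loc op emb p1 u Du" and Wv: "W1p_L_loc op emb p2 v Dv"
    and u0: "AE x in lebesgue. 0 \<le> u x" and v0: "AE x in lebesgue. 0 \<le> v x"
    and h1: "(\<lambda>x. A1 x (u x) (Du x)) \<in> borel_measurable lebesgue" "Lp_loc (p1 / (p1 - 1)) (\<lambda>x. norm (A1 x (u x) (Du x)))"
    and h2: "(\<lambda>x. A2 x (v x) (Dv x)) \<in> borel_measurable lebesgue" "Lp_loc (p2 / (p2 - 1)) (\<lambda>x. norm (A2 x (v x) (Dv x)))"
    and uq: "Lp_loc 1 (\<lambda>x. u x powr q1)" and vq: "Lp_loc 1 (\<lambda>x. v x powr q2)"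
    and eq1: "\<And>\<phi>. C1_0 \<phi> \<Longrightarrow> (\<And>x. 0 \<le> \<phi> x) \<Longrightarrow> (\<integral>x. v x powr q2 * \<phi> x \<partial>lebesgue) \<le> - (\<integral>x. A1 x (u x) (Du x) \<bullet> hgrad op emb \<phi> x \<partial>lebesgue)"
    and eq2: "\<And>\<phi>. C1_0 \<phi> \<Longrightarrow> (\<And>x. 0 \<le> \<phi> x) \<Longrightarrow> (\<integral>x. u x powr q1 * \<phi> x \<partial>lebesgue) \<le> - (\<integral>x. A2 x (v x) (Dv x) \<bullet> hgrad op emb \<phi> x \<partial>lebesgue)"
    using sol unfolding weak_solution_def by auto
  obtain k1 where k1: "0 < k1" "\<And>x t \<xi>. k1 * norm (A1 x t \<xi>) powr (p1 / (p1 - 1)) \<le> A1 x t \<xi> \<bullet> \<xi>"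
    using WpC_coercive[OF A1 p1] by blast
  obtain k2 where k2: "0 < k2" "\<And>x t \<xi>. k2 * norm (A2 x t \<xi>) powr (p2 / (p2 - 1)) \<le> A2 x t \<xi> \<bullet> \<xi>"
    using WpC_coercive[OF A2 p2] by blast
  have [measurable]: "u \<in> borel_measurable lebesgue" "v \<in> borel_measurable lebesgue"
    using Wu Wv by (auto simp: W1p_L_loc_def Lp_loc_def)
  \<comment> \<open>Representatives that are nonnegative everywhere, as \<open>subsolution\<close>
    requires. The fluxes stay \<open>A1 x (u x) (Du x)\<close> and \<open>A2 x (v x) (Dv x)\<close>,
    so their measurability and coercivity carry over unchanged.\<close>
  define u' v' where "u' x = max 0 (u x)" and "v' x = max 0 (v x)" for x
  have u': "AE x in lebesgue. u' x = u x"
    using u0 by eventually_elim (simp add: u'_def)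
  have v': "AE x in lebesgue. v' x = v x"
    using v0 by eventually_elim (simp add: v'_def)
  have [measurable]: "u' \<in> borel_measurable lebesgue" "v' \<in> borel_measurable lebesgue"
    unfolding u'_def[abs_def] v'_def[abs_def] by measurable
  have uq': "Lp_loc 1 (\<lambda>x. u' x powr q1)"
  proof (rule Lp_loc_cong_AE[OF uq])
    show "AE x in lebesgue. u' x powr q1 = u x powr q1" using u' by eventually_elim simp
  qed measurable
  have vq': "Lp_loc 1 (\<lambda>x. v' x powr q2)"
  proof (rule Lp_loc_cong_AE[OF vq])
    show "AE x in lebesgue. v' x powr q2 = v x powr q2" using v' by eventually_elim simp
  qed measurable
  have cong: "(\<integral>x. w' x powr q * \<phi> x \<partial>lebesgue) = (\<integral>x. w x powr q * \<phi> x \<partial>lebesgue)"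
    if "C1_0 \<phi>" "AE x in lebesgue. w' x = w x" and [measurable]: "w \<in> borel_measurable lebesgue" "w' \<in> borel_measurable lebesgue"
    for \<phi> w w' :: "real^'n \<Rightarrow> real" and q
  proof (rule integral_cong_AE)
    have [measurable]: "\<phi> \<in> borel_measurable lebesgue"
      using that(1) by (intro borel_lebesgue C1_measurable) (simp add: C1_0_iff)
    show "(\<lambda>x. w' x powr q * \<phi> x) \<in> borel_measurable lebesgue" "(\<lambda>x. w x powr q * \<phi> x) \<in> borel_measurable lebesgue"
      by measurable
    show "AE x in lebesgue. w' x powr q * \<phi> x = w x powr q * \<phi> x"
      using that(2) by eventually_elim simp
  qed
  have eq1': "(\<integral>x. v' x powr q2 * \<phi> x \<partial>lebesgue) \<le> - (\<integral>x. A1 x (u x) (Du x) \<bullet> hgrad op emb \<phi> x \<partial>lebesgue)"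
    if "C1_0 \<phi>" "\<And>x. 0 \<le> \<phi> x" for \<phi>
    using eq1[OF that] cong[OF that(1) v'] by simp
  have eq2': "(\<integral>x. u' x powr q1 * \<phi> x \<partial>lebesgue) \<le> - (\<integral>x. A2 x (v x) (Dv x) \<bullet> hgrad op emb \<phi> x \<partial>lebesgue)"
    if "C1_0 \<phi>" "\<And>x. 0 \<le> \<phi> x" for \<phi>
    using eq2[OF that] cong[OF that(1) u'] by simp
  have su: "subsolution op deg emb p1 k1 q1 u' Du (\<lambda>x. A1 x (u x) (Du x))"
  proof unfold_locales
    show "W1p_L_loc op emb p1 u' Du"
      unfolding u'_def[abs_def] by (rule W1p_L_loc_max_0[OF Wu u0 carnot_axioms])
    show "(\<integral>x. A1 x (u x) (Du x) \<bullet> hgrad op emb \<phi> x \<partial>lebesgue) \<le> 0" if "C1_0 \<phi>" "\<And>x. 0 \<le> \<phi> x" for \<phi>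
    proof -
      have "0 \<le> (\<integral>x. v x powr q2 * \<phi> x \<partial>lebesgue)"
        by (intro integral_nonneg_AE AE_I2) (simp add: that(2))
      with eq1[OF that] show ?thesis by linarith
    qed
  qed (use p1 q1 k1 h1 uq' in \<open>auto simp: u'_def\<close>)
  have sv: "subsolution op deg emb p2 k2 q2 v' Dv (\<lambda>x. A2 x (v x) (Dv x))"
  proof unfold_locales
    show "W1p_L_loc op emb p2 v' Dv"
      unfolding v'_def[abs_def] by (rule W1p_L_loc_max_0[OF Wv v0 carnot_axioms])
    show "(\<integral>x. A2 x (v x) (Dv x) \<bullet> hgrad op emb \<phi> x \<partial>lebesgue) \<le> 0" if "C1_0 \<phi>" "\<And>x. 0 \<le> \<phi> x" for \<phi>
    proof -
      have "0 \<le> (\<integral>x. u x powr q1 * \<phi> x \<partial>lebesgue)"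
        by (intro integral_nonneg_AE AE_I2) (simp add: that(2))
      with eq2[OF that] show ?thesis by linarith
    qed
  qed (use p2 q2 k2 h2 vq' in \<open>auto simp: v'_def\<close>)
  have "AE x in lebesgue. u' x = 0 \<and> v' x = 0"
  \<comment> \<open>Either term of the maximum reaches Q; the first one is the second with the roles
    of the two equations exchanged.\<close>
  proof (cases "hom_dim deg \<le> q2 * (p1 * q1 + p2 * (p1 - 1)) / (q1 * q2 - (p1 - 1) * (p2 - 1)) + p2")
    case True
    show ?thesis
      by (rule liouville_subcritical[OF su sv eq1' eq2' True])
  next
    case False
    have crit': "hom_dim deg \<le> q1 * (p2 * q2 + p1 * (p2 - 1)) / (q2 * q1 - (p2 - 1) * (p1 - 1)) + p1"
      using crit False by (simp add: le_max_iff_disj mult.commute)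
    have "AE x in lebesgue. v' x = 0 \<and> u' x = 0"
      by (rule liouville_subcritical[OF sv su eq2' eq1' crit'])
    then show ?thesis by eventually_elim simp
  qed
  then show ?thesis
    using u' v' by eventually_elim simp
qed

end
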